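(* Let $\mathcal{L}\in S$ be an element of the Selberg class with $d_{\mathcal{L}}\ge 1$, with data and constants $k,f,Q,\lambda_j,\mu_j,\omega,a_1,a,b,R$ fixed as in the context. Suppose that the real number $T_0$ satisfies $T_0\ge 2R+1$, $T_0\ge 2R+\max_j\frac{2|\lambda_j+\bar\mu_j|}{\lambda_j}$, $T_0>2R+\max_j\frac{2|\mu_j|}{\lambda_j}$ and, if $k>0$, $T_0\ge 2R+\frac{1}{2^{1/k}-1}$, and let $T>T_0$ be a real number. Then, for either choice of sign, $$\left|\mathcal{N}_{\mathcal{L}}^{\pm}(T_0,T)-\frac{d_{\mathcal{L}}}{2\pi}T\log\frac{T}{e}-\frac{T}{2\pi}\log(\lambda Q^2)\right|<R_{\mathcal{L}}(T_0,T).$$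
   Context: Selberg class. Write $s=\sigma+it$. The Selberg class $S$ consists of functions $\mathcal{L}(s)=\sum_{n\ge1}a(n)n^{-s}$ such that: (1) for every $\epsilon>0$, $|a(n)|\ll_\epsilon n^\epsilon$; (2) there is an integer $k\ge0$ such that $(s-1)^k\mathcal{L}(s)$ is entire of finite order; (3) there are a positive integer $f$, a real $Q>0$, positive reals $\lambda_j$ and complex $\mu_j$ with $\Re(\mu_j)\ge0$ ($1\le j\le f$), and a complex $\omega$ with $|\omega|=1$, such that $\Lambda_{\mathcal{L}}(s)=\omega\overline{\Lambda_{\mathcal{L}}(1-\bar s)}$ where $\Lambda_{\mathcal{L}}(s)=\mathcal{L}(s)Q^s\prod_{j=1}^f\Gamma(\lambda_js+\mu_j)$; (4) $\mathcal{L}(s)=\prod_p\exp\big(\sum_{l\ge1}b(p^l)p^{-ls}\big)$ with $b(p^l)\ll p^{l\theta}$ for some $\theta<\frac12$. In particular $a(1)=1$. Put $d_{\mathcal{L}}=2\sum_j\lambda_j$, $\lambda=\prod_j\lambda_j^{2\lambda_j}$, $\mu=4\sum_j(\frac12-\mu_j)$; assume $d_{\mathcal{L}}\ge1$. The data $k,f,Q,\lambda_j,\mu_j,\omega$ are fixed. Zeros. The zeros $s=-\frac{l+\mu_j}{\lambda_j}$ ($l=0,1,2,\dots$, $1\le j\le f$) are called trivial; the zeros in the strip $0\le\sigma\le1$ are called non-trivial (a trivial and a non-trivial zero may occur at the same point). $\mathcal{N}_{\mathcal{L}}^{+}(T_0,T)$ and $\mathcal{N}_{\mathcal{L}}^{-}(T_0,T)$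 denote the number (counted with multiplicity) of non-trivial zeros $\rho$ of $\mathcal{L}$ with $T_0<\Im(\rho)\le T$ and $-T\le\Im(\rho)<-T_0$ respectively. Constants. $a_1$ is a constant with $|a(n)|\le a_1n$ for all $n$; $a>2$ is a real number with $\sum_{n\ge2}a_1n^{-a}<\frac12$; $b<-3$ is a real number with $\sum_{n\ge2}a_1n^{b+1}<1$; $R=a-b$. $B_2=\frac16$ is the second Bernoulli number. Shorthand. $m=\max_j\max\{\frac{2|\lambda_j+\bar\mu_j|}{\lambda_j},\frac{2|\mu_j|}{\lambda_j}\}$; $E_j=|\lambda_j+\bar\mu_j|^2+2|(\lambda_j+\bar\mu_j)(\lambda_j+\bar\mu_j-\frac12)|+|\mu_j|^2+2|\mu_j(\mu_j-\frac12)|$; for real $x$, $\Theta_j(x)=2+\sec^2\big(\tfrac12\arg(\lambda_j(x+mi))\big)$ (principal argument). Definitions. For positive reals $T_0,T$: $$S(T_0,T,b)=\sum_{j=1}^f\frac{2}{\lambda_j}\log\frac{T}{T_0}\Big(E_j+\frac{|B_2|}{4}\Theta_j(-b)+\frac{|B_2|}{4}\Theta_j(-b-1)\Big),$$ $$R_1(T_0,T,b)=\log\frac{T}{T_0}\Big(-\frac{7d_{\mathcal{L}}}{2}(2b+1)+2\Big|-d_{\mathcal{L}}b+\frac{\Im(\mu)i}{2}\Big|+2d_{\mathcal{L}}\Big)+\frac{3d_{\mathcal{L}}(b^2+b)}{T_0}+S(T_0,T,b),$$ $$V^*(T)=\frac{1}{T-2R}\sum_{j=1}^f\frac1{\lambda_j}\Big(E_j+\frac{|B_2|}{2}\Theta_j(-a-2R)\Big),$$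 $$\begin{aligned}R_2(T)=\frac1{\log2}\Big(&d_{\mathcal{L}}(\tfrac12-a+2R)\log(2T)+\log\tfrac{a_1\pi^2}{6}+V^*(T)\\&+\max\Big\{\max\{\tfrac52\log|\lambda Q^2|,(\tfrac12-a+2R)\log|\lambda Q^2|\}-2d_{\mathcal{L}}+\Big|1-\tfrac{(a+2R)i}{T-2R}\Big|d_{\mathcal{L}}(\tfrac12-a+2R)\\&\qquad+d_{\mathcal{L}}(a+2R)+\tfrac{a+2R}{T-2R}\big|\tfrac{\Im(\mu)}2\big|,\\&\qquad(\tfrac52d_{\mathcal{L}}+1)\log2+k\log3+\max\{0,\tfrac52\log|\lambda Q^2|+\tfrac{5\sqrt5}{2}d_{\mathcal{L}}+|\Im(\mu)|\}\Big\}\Big),\end{aligned}$$ $$\begin{aligned}R_{\mathcal{L}}(T_0,T)&=\frac{d_{\mathcal{L}}}{2\pi}T_0\log\frac{T_0}{e}+\frac{T_0}{2\pi}|\log(\lambda Q^2)|+\frac{R_1(T_0,T,b)}{2\pi}+\frac{\pi}{3\log2}+(R-\tfrac12)(R_2(T_0)+R_2(T)+4)\\&\quad+f\cdot\Big(\big|(b+1)\max_j\{\lambda_j\}+\min_j\{\Re(\mu_j)\}\big|-b\max_j\{\lambda_j\}+(b+1)\min_j\{\lambda_j\}-\min_j\{\Re(\mu_j)\}+\max_j\{\Re(\mu_j)\}\Big).\end{aligned}$$ *)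

theory Defs
  imports "HOL-Complex_Analysis.Complex_Analysis"
begin

section \<open>The Selberg class\<close>

definition finite_order :: "(complex \<Rightarrow> complex) \<Rightarrow> bool" where
  "finite_order G \<longleftrightarrow> (\<exists>r::real. \<forall>\<^sub>F z in at_infinity. norm (G z) \<le> exp (norm z powr r))"

definition completed_L ::
  "(complex \<Rightarrow> complex) \<Rightarrow> nat \<Rightarrow> real \<Rightarrow> (nat \<Rightarrow> real) \<Rightarrow> (nat \<Rightarrow> complex) \<Rightarrow> complex \<Rightarrow> complex" where
  "completed_L L f Q lam mu s =
     L s * of_real Q powr s * (\<Prod>j\<in>{1..f}. Gamma (of_real (lam j) * s + mu j))"

text \<open>
  \<open>selberg_class L a k f Q lam mu \<omega>\<close>: the function \<open>L\<close>, with Dirichlet coefficients \<open>a n\<close> for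
  \<open>n \<ge> 1\<close>, belongs to the Selberg class with the given data (\<open>lam j\<close> and \<open>mu j\<close> matter only for
  \<open>1 \<le> j \<le> f\<close>, and \<open>a 0\<close> not at all).  The function \<open>L\<close> is total; since it
  may have a pole at \<open>1\<close>, its value there is left unconstrained, and \<open>(s - 1) ^ k * L s\<close> is only
  required to agree with an entire function away from \<open>1\<close>.

  The functional equation is an identity of meromorphic functions.  As HOL's \<open>Gamma\<close> is \<open>0\<close> at
  its poles, it is stated at the points where neither side involves the point \<open>1\<close> or a
  pole of a Gamma factor, which is equivalent by analytic continuation.

  The product over the primes is a convergent product over all \<open>n\<close> whose factors at non-primes
  are \<open>1\<close>.
\<close>

definition selberg_class ::
  "(complex \<Rightarrow> complex) \<Rightarrow> (nat \<Rightarrow> complex) \<Rightarrow> nat \<Rightarrow> nat \<Rightarrow> real \<Rightarrow> (nat \<Rightarrow> real) \<Rightarrow> (nat \<Rightarrow> complex)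
     \<Rightarrow> complex \<Rightarrow> bool" where
  "selberg_class L a k f Q lam mu \<omega> \<longleftrightarrow>
     (\<forall>s. Re s > 1 \<longrightarrow> (\<lambda>n. a (Suc n) * of_nat (Suc n) powr (- s)) sums L s) \<and>
     (\<forall>\<epsilon>>0. \<exists>C::real. \<forall>n\<ge>1. norm (a n) \<le> C * real n powr \<epsilon>) \<and>
     (\<exists>G. G holomorphic_on UNIV \<and> finite_order G \<and> (\<forall>s. s \<noteq> 1 \<longrightarrow> G s = (s - 1) ^ k * L s)) \<and>
     f \<ge> 1 \<and> Q > 0 \<and> (\<forall>j\<in>{1..f}. lam j > 0 \<and> Re (mu j) \<ge> 0) \<and> norm \<omega> = 1 \<and>
     (\<forall>s. s \<noteq> 0 \<and> s \<noteq> 1 \<and>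
        (\<forall>j\<in>{1..f}. of_real (lam j) * s + mu j \<notin> \<int>\<^sub>\<le>\<^sub>0 \<and>
                    of_real (lam j) * (1 - cnj s) + mu j \<notin> \<int>\<^sub>\<le>\<^sub>0) \<longrightarrow>
        completed_L L f Q lam mu s = \<omega> * cnj (completed_L L f Q lam mu (1 - cnj s))) \<and>
     (\<exists>(\<beta> :: nat \<Rightarrow> complex) (\<theta>::real) (C::real). \<theta> < 1 / 2 \<and>
        (\<forall>p l. prime p \<and> l \<ge> 1 \<longrightarrow> norm (\<beta> (p ^ l)) \<le> C * real p powr (real l * \<theta>)) \<and>
        (\<forall>s. Re s > 1 \<longrightarrow>
           (\<lambda>n. if prime n
                then exp (\<Sum>l. \<beta> (n ^ Suc l) * of_nat n powr (- of_nat (Suc l) * s))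
                else 1) has_prod L s))"

definition degree_L :: "nat \<Rightarrow> (nat \<Rightarrow> real) \<Rightarrow> real" where
  "degree_L f lam = 2 * (\<Sum>j\<in>{1..f}. lam j)"

definition lambda_L :: "nat \<Rightarrow> (nat \<Rightarrow> real) \<Rightarrow> real" where
  "lambda_L f lam = (\<Prod>j\<in>{1..f}. lam j powr (2 * lam j))"

definition mu_L :: "nat \<Rightarrow> (nat \<Rightarrow> complex) \<Rightarrow> complex" where
  "mu_L f mu = 4 * (\<Sum>j\<in>{1..f}. 1 / 2 - mu j)"


section \<open>Counting non-trivial zeros\<close>

definition nontrivial_zeros :: "(complex \<Rightarrow> complex) \<Rightarrow> complex set" where
  "nontrivial_zeros L = {\<rho>. L \<rho> = 0 \<and> 0 \<le> Re \<rho> \<and> Re \<rho> \<le> 1}"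

text \<open>
  A trivial zero \<open>- (l + mu j) / lam j\<close> may lie on the line \<open>Re s = 0\<close> and is then counted as a
  member of the strip; this only happens for \<open>\<bar>Im s\<bar> \<le> norm (mu j) / lam j\<close>.

  For \<open>T\<^sub>0 > 0\<close> the counting regions avoid the possible pole \<open>1\<close>, so \<open>zorder L \<rho>\<close> is the (positive)
  multiplicity of the zero \<open>\<rho>\<close>, and the index sets are finite.
\<close>

definition N_plus :: "(complex \<Rightarrow> complex) \<Rightarrow> real \<Rightarrow> real \<Rightarrow> nat" where
  "N_plus L T\<^sub>0 T = (\<Sum>\<rho> | \<rho> \<in> nontrivial_zeros L \<and> T\<^sub>0 < Im \<rho> \<and> Im \<rho> \<le> T. nat (zorder L \<rho>))"

definition N_minus :: "(complex \<Rightarrow> complex) \<Rightarrow> real \<Rightarrow> real \<Rightarrow> nat" where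
  "N_minus L T\<^sub>0 T = (\<Sum>\<rho> | \<rho> \<in> nontrivial_zeros L \<and> - T \<le> Im \<rho> \<and> Im \<rho> < - T\<^sub>0. nat (zorder L \<rho>))"


section \<open>The explicit error term\<close>

definition B2 :: real where
  "B2 = 1 / 6"

definition m_L :: "nat \<Rightarrow> (nat \<Rightarrow> real) \<Rightarrow> (nat \<Rightarrow> complex) \<Rightarrow> real" where
  "m_L f lam mu =
     (MAX j\<in>{1..f}. max (2 * norm (of_real (lam j) + cnj (mu j)) / lam j) (2 * norm (mu j) / lam j))"

definition E_L :: "(nat \<Rightarrow> real) \<Rightarrow> (nat \<Rightarrow> complex) \<Rightarrow> nat \<Rightarrow> real" where
  "E_L lam mu j =
     (let w = of_real (lam j) + cnj (mu j) in
        norm w ^ 2 + 2 * norm (w * (w - 1 / 2)) + norm (mu j) ^ 2 + 2 * norm (mu j * (mu j - 1 / 2)))"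

definition Theta_L :: "nat \<Rightarrow> (nat \<Rightarrow> real) \<Rightarrow> (nat \<Rightarrow> complex) \<Rightarrow> nat \<Rightarrow> real \<Rightarrow> real" where
  "Theta_L f lam mu j x =
     2 + 1 / cos (1 / 2 * Arg (of_real (lam j) * (of_real x + of_real (m_L f lam mu) * \<i>))) ^ 2"

definition S_L :: "nat \<Rightarrow> (nat \<Rightarrow> real) \<Rightarrow> (nat \<Rightarrow> complex) \<Rightarrow> real \<Rightarrow> real \<Rightarrow> real \<Rightarrow> real" where
  "S_L f lam mu T\<^sub>0 T b =
     (\<Sum>j\<in>{1..f}. 2 / lam j * ln (T / T\<^sub>0) *
        (E_L lam mu j + \<bar>B2\<bar> / 4 * Theta_L f lam mu j (- b)
                      + \<bar>B2\<bar> / 4 * Theta_L f lam mu j (- b - 1)))"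

definition R1_L :: "nat \<Rightarrow> (nat \<Rightarrow> real) \<Rightarrow> (nat \<Rightarrow> complex) \<Rightarrow> real \<Rightarrow> real \<Rightarrow> real \<Rightarrow> real" where
  "R1_L f lam mu T\<^sub>0 T b =
     (let d = degree_L f lam in
        ln (T / T\<^sub>0) *
          (- (7 * d / 2) * (2 * b + 1)
           + 2 * norm (- of_real d * of_real b + of_real (Im (mu_L f mu)) * \<i> / 2)
           + 2 * d)
        + 3 * d * (b ^ 2 + b) / T\<^sub>0
        + S_L f lam mu T\<^sub>0 T b)"

definition Vstar_L :: "nat \<Rightarrow> (nat \<Rightarrow> real) \<Rightarrow> (nat \<Rightarrow> complex) \<Rightarrow> real \<Rightarrow> real \<Rightarrow> real \<Rightarrow> real" where
  "Vstar_L f lam mu a b T =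
     (let R = a - b in
        1 / (T - 2 * R) *
          (\<Sum>j\<in>{1..f}. 1 / lam j * (E_L lam mu j + \<bar>B2\<bar> / 2 * Theta_L f lam mu j (- a - 2 * R))))"

definition R2_L ::
  "nat \<Rightarrow> nat \<Rightarrow> real \<Rightarrow> (nat \<Rightarrow> real) \<Rightarrow> (nat \<Rightarrow> complex) \<Rightarrow> real \<Rightarrow> real \<Rightarrow> real \<Rightarrow> real \<Rightarrow> real" where
  "R2_L k f Q lam mu a1 a b T =
     (let R = a - b; d = degree_L f lam; M = Im (mu_L f mu);
          \<Lambda> = ln \<bar>lambda_L f lam * Q ^ 2\<bar>
      in 1 / ln 2 *
         (d * (1 / 2 - a + 2 * R) * ln (2 * T) + ln (a1 * pi ^ 2 / 6) + Vstar_L f lam mu a b T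
          + max
              (max (5 / 2 * \<Lambda>) ((1 / 2 - a + 2 * R) * \<Lambda>) - 2 * d
               + norm (1 - of_real (a + 2 * R) * \<i> / of_real (T - 2 * R)) * d * (1 / 2 - a + 2 * R)
               + d * (a + 2 * R) + (a + 2 * R) / (T - 2 * R) * \<bar>M / 2\<bar>)
              ((5 / 2 * d + 1) * ln 2 + real k * ln 3
               + max 0 (5 / 2 * \<Lambda> + 5 * sqrt 5 / 2 * d + \<bar>M\<bar>))))"

definition R_L ::
  "nat \<Rightarrow> nat \<Rightarrow> real \<Rightarrow> (nat \<Rightarrow> real) \<Rightarrow> (nat \<Rightarrow> complex) \<Rightarrow> real \<Rightarrow> real \<Rightarrow> real \<Rightarrow> real \<Rightarrow> real \<Rightarrow> real" where
  "R_L k f Q lam mu a1 a b T\<^sub>0 T =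
     (let R = a - b; d = degree_L f lam;
          lmax = (MAX j\<in>{1..f}. lam j); lmin = (MIN j\<in>{1..f}. lam j);
          mumax = (MAX j\<in>{1..f}. Re (mu j)); mumin = (MIN j\<in>{1..f}. Re (mu j))
      in d / (2 * pi) * T\<^sub>0 * ln (T\<^sub>0 / exp 1)
         + T\<^sub>0 / (2 * pi) * \<bar>ln (lambda_L f lam * Q ^ 2)\<bar>
         + R1_L f lam mu T\<^sub>0 T b / (2 * pi)
         + pi / (3 * ln 2)
         + (R - 1 / 2) * (R2_L k f Q lam mu a1 a b T\<^sub>0 + R2_L k f Q lam mu a1 a b T + 4)
         + real f * (\<bar>(b + 1) * lmax + mumin\<bar> - b * lmax + (b + 1) * lmin - mumin + mumax))"

end

theory Submission
  imports Defs "HOL-Real_Asymp.Real_Asymp"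
begin

text \<open>
  Put \<open>c = min a (- b) + 1\<close>, so that \<open>\<bar>L s - 1\<bar> \<le> 1 / 2\<close> for \<open>Re s \<ge> c\<close>.  The argument principle on
  the rectangle \<open>[1 - c, c] \<times> [T\<^sub>0, T]\<close> together with the functional equation expresses
  \<open>\<pi> * N(T\<^sub>0, T)\<close> as the variation of \<open>arg L\<close> along the right half of the boundary plus the integral
  of the real part of the logarithmic derivative of \<open>Q\<^sup>s \<Prod>\<Gamma>(\<lambda>\<^sub>j s + \<mu>\<^sub>j)\<close> on the critical line.
  The latter gives the main term, because \<open>Re \<psi>(z) = ln \<bar>z\<bar>\<close> up to \<open>\<pi> / Im z\<close>; the error \<open>O(1 / t)\<close>
  integrates to a multiple of \<open>ln (T / T\<^sub>0)\<close>.  The vertical side contributes at most \<open>\<pi>\<close>, and a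
  horizontal side at most \<open>\<pi> * (n + 1)\<close>, where \<open>n\<close> counts the zeros of \<open>Re L\<close> on it (Backlund).
  Jensen's inequality bounds \<open>n\<close> by the growth of \<open>L\<close> on a disc with leftmost abscissa \<open>1 - c\<close>, and
  the growth follows from the functional equation on \<open>Re s = 1 - c\<close> and Phragmen-Lindelof.
  This avoids Littlewood's lemma, and the outcome is smaller than \<open>R_L\<close> by a wide margin.
\<close>

section \<open>The digamma function and ratios of Gamma values\<close>

text \<open>Phragmen-Lindelof needs bounds on the whole edge \<open>Re s = 1 - c\<close>, also at
  low heights, where Gamma factors come near their poles and the digamma estimate degenerates. There
  monotonicity helps: the modulus of \<open>Gamma (w + x) * rGamma w\<close> increases with
  \<open>\<bar>Im w\<bar>\<close>, so the point may be lifted to a safe height.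
  \<open>Re Digamma\<close> serves twice: along horizontal lines it is the derivative of the
  logarithm of the modulus of Gamma (growth of \<open>L\<close>), along vertical lines that of its
  argument (main term). The length behind the constants is \<open>P = c - 1 / 2\<close>. The discs
  of radii \<open>P\<close> and \<open>2 * P\<close> about \<open>c + i T\<close> reach the critical
  line and the line \<open>Re s = 1 - c\<close>; their ratio 2 produces the factor
  \<open>1 / ln 2\<close>. As \<open>2 * (c - 1) \<le> R\<close>, the condition
  \<open>T\<^sub>0 \<ge> 2 * R + 1\<close> leaves room below the larger disc. In the final
  comparison \<open>R - 1 / 2 > 9 / 2\<close> is the multiple of \<open>R2_L\<close> available at
  each end. The count over a half-open range of heights is unchanged by a small upward shift of both
  ends, which disposes of zeros on the contour, and \<open>cnj (L (cnj s))\<close> exchanges the two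
  half planes.\<close>

lemma cauchy_kernel_variation:
  fixes u v y :: real
  assumes y: "y > 0" and "u \<le> v"
  shows "\<bar>v / (v\<^sup>2 + y\<^sup>2) - u / (u\<^sup>2 + y\<^sup>2)\<bar> \<le> (arctan (v / y) - arctan (u / y)) / y"
proof -
  define h where "h = (\<lambda>u. u / (u\<^sup>2 + y\<^sup>2))"
  define A where "A = (\<lambda>u. arctan (u / y) / y)"
  have pos: "u\<^sup>2 + y\<^sup>2 > 0" for u
    using y by (simp add: add_nonneg_pos)
  have dA: "(A has_real_derivative 1 / (u\<^sup>2 + y\<^sup>2)) (at u)" for u
  proof -
    have "1 / (1 + (u / y)\<^sup>2) * (1 / y) / y = 1 / (u\<^sup>2 + y\<^sup>2)"
    proof -
      have "1 + (u / y)\<^sup>2 = (u\<^sup>2 + y\<^sup>2) / y\<^sup>2"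
        using y by (simp add: field_simps)
      then show ?thesis using y by (simp add: power2_eq_square)
    qed
    then show ?thesis
      unfolding A_def using y by (auto intro!: derivative_eq_intros simp: inverse_eq_divide)
  qed
  have dh: "(h has_real_derivative (y\<^sup>2 - u\<^sup>2) / (u\<^sup>2 + y\<^sup>2)\<^sup>2) (at u)" for u
    unfolding h_def using pos[of u]
    by (auto intro!: derivative_eq_intros simp: field_simps power2_eq_square)
  have b: "\<bar>(y\<^sup>2 - u\<^sup>2) / (u\<^sup>2 + y\<^sup>2)\<^sup>2\<bar> \<le> 1 / (u\<^sup>2 + y\<^sup>2)" for u
  proof -
    have "\<bar>y\<^sup>2 - u\<^sup>2\<bar> \<le> u\<^sup>2 + y\<^sup>2" by (simp add: abs_le_iff)
    then have "\<bar>y\<^sup>2 - u\<^sup>2\<bar> / (u\<^sup>2 + y\<^sup>2)\<^sup>2 \<le> (u\<^sup>2 + y\<^sup>2) / (u\<^sup>2 + y\<^sup>2)\<^sup>2"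
      by (rule divide_right_mono) simp
    moreover have "(u\<^sup>2 + y\<^sup>2) / (u\<^sup>2 + y\<^sup>2)\<^sup>2 = 1 / (u\<^sup>2 + y\<^sup>2)"
      unfolding power2_eq_square[of "u\<^sup>2 + y\<^sup>2"] using pos[of u] by simp
    ultimately show ?thesis by simp
  qed
  \<comment> \<open>By \<open>b\<close> the derivative of \<open>h\<close> is dominated by that of
    \<open>A\<close>, so \<open>A - h\<close> and \<open>A + h\<close> are both
    nondecreasing.\<close>
  have "(A u - h u) \<le> (A v - h v)"
  proof (rule DERIV_nonneg_imp_nondecreasing[OF \<open>u \<le> v\<close>])
    fix x show "\<exists>y'. ((\<lambda>u. A u - h u) has_real_derivative y') (at x) \<and> 0 \<le> y'"
      using DERIV_diff[OF dA[of x] dh[of x]] b[of x] by (intro exI conjI) (assumption, linarith)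
  qed
  moreover have "(A u + h u) \<le> (A v + h v)"
  proof (rule DERIV_nonneg_imp_nondecreasing[OF \<open>u \<le> v\<close>])
    fix x show "\<exists>y'. ((\<lambda>u. A u + h u) has_real_derivative y') (at x) \<and> 0 \<le> y'"
      using DERIV_add[OF dA[of x] dh[of x]] b[of x] by (intro exI conjI) (assumption, linarith)
  qed
  moreover have "(arctan (v / y) - arctan (u / y)) / y = A v - A u"
    by (simp add: A_def diff_divide_distrib)
  ultimately show ?thesis unfolding h_def by linarith
qed

text \<open>The left side compares one step of the integral of the kernel with its value at the left
  end. The mean value theorem reduces this to the variation over a unit interval, and the arctan
  form of the bound telescopes when such steps are summed.\<close>

lemma cauchy_kernel_vs_integral:
  fixes u y :: real
  assumes y: "y > 0"
  shows "\<bar>ln ((u + 1)\<^sup>2 + y\<^sup>2) / 2 - ln (u\<^sup>2 + y\<^sup>2) / 2 - u / (u\<^sup>2 + y\<^sup>2)\<bar>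
           \<le> (arctan ((u + 1) / y) - arctan (u / y)) / y"
proof -
  have pos: "u\<^sup>2 + y\<^sup>2 > 0" for u
    using y by (simp add: add_nonneg_pos)
  have "((\<lambda>u. ln (u\<^sup>2 + y\<^sup>2) / 2) has_real_derivative u / (u\<^sup>2 + y\<^sup>2)) (at u)" for u
  proof -
    have "4 * u / (u\<^sup>2 * 4 + y\<^sup>2 * 4) = u / (u\<^sup>2 + y\<^sup>2)"
      using mult_divide_mult_cancel_left[of 4 u "u\<^sup>2 + y\<^sup>2"] by (simp add: algebra_simps)
    then show ?thesis
      using pos[of u] by (auto intro!: derivative_eq_intros)
  qed
  then obtain v where v: "u < v" "v < u + 1"
    and eq: "ln ((u + 1)\<^sup>2 + y\<^sup>2) / 2 - ln (u\<^sup>2 + y\<^sup>2) / 2 = (u + 1 - u) * (v / (v\<^sup>2 + y\<^sup>2))"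
    using MVT2[of u "u + 1" "\<lambda>u. ln (u\<^sup>2 + y\<^sup>2) / 2" "\<lambda>u. u / (u\<^sup>2 + y\<^sup>2)"] by auto
  have "(arctan (v / y) - arctan (u / y)) / y \<le> (arctan ((u + 1) / y) - arctan (u / y)) / y"
    using y v by (intro divide_right_mono) (auto simp: arctan_le_iff divide_right_mono)
  then show ?thesis
    using cauchy_kernel_variation[OF y, of u v] v unfolding eq by simp
qed

text \<open>\<open>Digamma z\<close> is the limit of \<open>ln m\<close> minus the sum of
  \<open>1 / (z + n)\<close> over \<open>n < m\<close>, and the real parts of these terms are values
  of the kernel. Comparison with the integral leaves an error bounded by a total variation, hence by
  a multiple of \<open>1 / Im z\<close> uniformly in \<open>Re z\<close>, even to the left of the
  imaginary axis.\<close>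

lemma Re_Digamma_ln_norm:
  fixes z :: complex
  assumes "Im z > 0"
  shows "\<bar>Re (Digamma z) - ln (norm z)\<bar> \<le> (pi / 2 - arctan (Re z / Im z)) / Im z"
proof -
  define x y where "x = Re z" and "y = Im z"
  have y: "y > 0" using assms by (simp add: y_def)
  define H where "H = (\<lambda>u. ln (u\<^sup>2 + y\<^sup>2) / 2)"
  define h where "h = (\<lambda>u. u / (u\<^sup>2 + y\<^sup>2))"
  have pos: "u\<^sup>2 + y\<^sup>2 > 0" for u
    using y by (simp add: add_nonneg_pos)
  have sum_bound: "\<bar>H (x + real m) - H x - (\<Sum>n<m. h (x + real n))\<bar> \<le> (pi / 2 - arctan (x / y)) / y" for m
  proof -
    have "H (x + real m) - H x - (\<Sum>n<m. h (x + real n))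
        = (\<Sum>n<m. H (x + real n + 1) - H (x + real n) - h (x + real n))"
      by (induction m) (auto simp: algebra_simps)
    also have "\<bar>\<dots>\<bar> \<le> (\<Sum>n<m. (arctan ((x + real n + 1) / y) - arctan ((x + real n) / y)) / y)"
      unfolding H_def h_def
      by (rule order_trans[OF sum_abs sum_mono]) (rule cauchy_kernel_vs_integral[OF y])
    also have "\<dots> = (arctan ((x + real m) / y) - arctan (x / y)) / y"
      by (induction m) (auto simp: algebra_simps diff_divide_distrib)
    also have "\<dots> \<le> (pi / 2 - arctan (x / y)) / y"
      using y arctan_ubound[of "(x + real m) / y"] by (intro divide_right_mono) auto
    finally show ?thesis .
  qed
  have z0: "z \<noteq> 0" using assms by auto
  have "(\<lambda>m. Re (of_real (ln (real m)) - (\<Sum>n<m. inverse (z + of_nat n)))) \<longlonglongrightarrow> Re (Digamma z)"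
    by (intro tendsto_Re Digamma_LIMSEQ z0)
  also have "(\<lambda>m. Re (of_real (ln (real m)) - (\<Sum>n<m. inverse (z + of_nat n))))
      = (\<lambda>m. ln (real m) - (\<Sum>n<m. h (x + real n)))"
    by (auto simp: h_def x_def y_def)
  finally have 1: "(\<lambda>m. ln (real m) - (\<Sum>n<m. h (x + real n))) \<longlonglongrightarrow> Re (Digamma z)" .
  have 2: "(\<lambda>m::nat. H (x + real m) - ln (real m)) \<longlonglongrightarrow> 0"
    unfolding H_def by real_asymp
  have "(\<lambda>m. H (x + real m) - H x - (\<Sum>n<m. h (x + real n))) \<longlonglongrightarrow> 0 + Re (Digamma z) - H x"
    using tendsto_diff[OF tendsto_add[OF 2 1] tendsto_const[of "H x"]]
    by (simp add: algebra_simps)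
  then have "(\<lambda>m. \<bar>H (x + real m) - H x - (\<Sum>n<m. h (x + real n))\<bar>) \<longlonglongrightarrow> \<bar>Re (Digamma z) - H x\<bar>"
    using tendsto_rabs by fastforce
  then have "\<bar>Re (Digamma z) - H x\<bar> \<le> (pi / 2 - arctan (x / y)) / y"
    by (rule LIMSEQ_le_const2) (use sum_bound in auto)
  moreover have "H x = ln (norm z)"
    using pos[of x] by (simp add: H_def x_def y_def cmod_def ln_sqrt)
  ultimately show ?thesis by (simp add: x_def y_def)
qed

lemma Re_Digamma_ln_norm':
  fixes z :: complex
  assumes "Im z > 0"
  shows "\<bar>Re (Digamma z) - ln (norm z)\<bar> \<le> pi / Im z"
proof -
  have "(pi / 2 - arctan (Re z / Im z)) / Im z \<le> pi / Im z"
    using assms arctan_lbound[of "Re z / Im z"] by (intro divide_right_mono) auto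
  then show ?thesis using Re_Digamma_ln_norm[OF assms] by linarith
qed

lemma Re_Digamma_ln_norm_right:
  fixes z :: complex
  assumes "Im z > 0" "Re z \<ge> 0"
  shows "\<bar>Re (Digamma z) - ln (norm z)\<bar> \<le> pi / (2 * Im z)"
proof -
  have "(pi / 2 - arctan (Re z / Im z)) / Im z \<le> (pi / 2) / Im z"
    using assms zero_le_arctan_iff[of "Re z / Im z"] by (intro divide_right_mono) auto
  then show ?thesis using Re_Digamma_ln_norm[OF assms(1)] by simp
qed

text \<open>In Gauss's product the quotient becomes a factor depending on \<open>x\<close> only,
  times the quotients \<open>norm (w + i) / norm (w + x + i)\<close>. Each of them increases with
  \<open>\<bar>Im w\<bar>\<close>, because \<open>Re w \<ge> - x / 2\<close> makes the real part of
  the numerator the smaller one in absolute value. Writing \<open>rGamma\<close> keeps the quotient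
  meaningful at the poles of \<open>Gamma w\<close>.\<close>

lemma norm_Gamma_shift_mono:
  fixes w w' :: complex and x :: real
  assumes "Re w' = Re w" and "\<bar>Im w\<bar> \<le> \<bar>Im w'\<bar>" and "x \<ge> 0" and "Re w \<ge> - x / 2"
    and nz: "w + of_real x \<notin> \<int>\<^sub>\<le>\<^sub>0" "w' + of_real x \<notin> \<int>\<^sub>\<le>\<^sub>0"
  shows "norm (Gamma (w + of_real x) * rGamma w) \<le> norm (Gamma (w' + of_real x) * rGamma w')"
proof -
  define g :: "complex \<Rightarrow> nat \<Rightarrow> real" where "g = (\<lambda>w n. norm (Gamma_series (w + of_real x) n * rGamma_series w n))"
  have lim: "(\<lambda>n. g w n) \<longlonglongrightarrow> norm (Gamma (w + of_real x) * rGamma w)" for w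
    unfolding g_def by (intro tendsto_intros)
  have factor: "norm (w + of_nat i) / norm (w + of_real x + of_nat i)
      \<le> norm (w' + of_nat i) / norm (w' + of_real x + of_nat i)" for i
  proof -
    define A where "A = Re w + real i"
    have nz1: "norm (w + of_real x + of_nat i) > 0" "norm (w' + of_real x + of_nat i) > 0"
      using nz by (auto simp: add_eq_0_iff2 minus_of_nat_in_nonpos_Ints)
    have im: "(Im w)\<^sup>2 \<le> (Im w')\<^sup>2" using assms(2) by (simp add: abs_le_square_iff)
    have "A\<^sup>2 \<le> (A + x)\<^sup>2"
    proof -
      have "2 * A + x \<ge> 0" using assms(4) by (simp add: A_def)
      then have "x * (2 * A + x) \<ge> 0" using \<open>x \<ge> 0\<close> by simp
      then show ?thesis by (simp add: power2_eq_square algebra_simps)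
    qed
    \<comment> \<open>This product is the difference of the two sides of the cross-multiplied
      inequality.\<close>
    then have "((A + x)\<^sup>2 - A\<^sup>2) * ((Im w')\<^sup>2 - (Im w)\<^sup>2) \<ge> 0" using im by simp
    then have "(A\<^sup>2 + (Im w)\<^sup>2) * ((A + x)\<^sup>2 + (Im w')\<^sup>2) \<le> (A\<^sup>2 + (Im w')\<^sup>2) * ((A + x)\<^sup>2 + (Im w)\<^sup>2)"
      by (simp add: algebra_simps)
    then have "(norm (w + of_nat i) * norm (w' + of_real x + of_nat i))\<^sup>2
        \<le> (norm (w' + of_nat i) * norm (w + of_real x + of_nat i))\<^sup>2"
      by (simp add: power_mult_distrib cmod_power2 A_def assms(1) add_ac)
    then have "norm (w + of_nat i) * norm (w' + of_real x + of_nat i)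
        \<le> norm (w' + of_nat i) * norm (w + of_real x + of_nat i)"
      by (rule power2_le_imp_le) simp
    then show ?thesis using nz1 by (simp add: field_simps)
  qed
  have g_eq: "g w n = norm (exp (of_real x * of_real (ln (real n))) :: complex)
      * (\<Prod>i\<le>n. norm (w + of_nat i) / norm (w + of_real x + of_nat i))" for w n
    by (simp add: g_def Gamma_series_def rGamma_series_def pochhammer_prod norm_mult norm_divide
         prod_norm[symmetric] prod_dividef lessThan_Suc_atMost exp_add ring_distribs atLeast0AtMost
         atLeast0LessThan)
  have "g w n \<le> g w' n" for n
    unfolding g_eq by (intro mult_left_mono prod_mono conjI factor) auto
  then show ?thesis using lim[of w] lim[of w'] by (auto intro: LIMSEQ_le)
qed

text \<open>This is the mean value theorem for \<open>ln (norm (Gamma (w + u)))\<close> as a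
  function of real \<open>u\<close>, whose derivative is
  \<open>Re (Digamma (w + u))\<close>.\<close>

lemma ln_norm_Gamma_shift:
  fixes w :: complex and x :: real
  assumes y: "Im w > 0" and x: "x > 0"
  shows "\<exists>u. 0 < u \<and> u < x \<and> ln (norm (Gamma (w + of_real x) * rGamma w)) = x * Re (Digamma (w + of_real u))"
proof -
  have ni: "w + of_real u \<notin> \<int>\<^sub>\<le>\<^sub>0" for u
    using y by (auto elim!: nonpos_Ints_cases simp: complex_eq_iff)
  have "((\<lambda>u. ln (norm (Gamma (w + of_real u)))) has_real_derivative Re (Digamma (w + of_real u))) (at u)" for u :: real
  proof -
    have 1: "((\<lambda>u. Gamma (w + of_real u)) has_vector_derivative Gamma (w + of_real u) * Digamma (w + of_real u)) (at u)"
      by (rule has_vector_derivative_real_field)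
         (auto intro!: derivative_eq_intros ni)
    define F where "F = (\<lambda>u::real. Gamma (w + of_real u))"
    have nz: "F u \<noteq> 0" using ni by (simp add: F_def Gamma_eq_zero_iff)
    have 2: "(F has_derivative (\<lambda>h. h *\<^sub>R (F u * Digamma (w + of_real u)))) (at u)"
      using 1 by (simp add: F_def has_vector_derivative_def)
    have "((\<lambda>u. norm (F u)) has_derivative (\<lambda>h. (h *\<^sub>R (F u * Digamma (w + of_real u))) \<bullet> sgn (F u))) (at u)"
      using has_derivative_compose[OF 2 has_derivative_norm[OF nz]] by simp
    then have 3: "((\<lambda>u. norm (F u)) has_real_derivative ((F u * Digamma (w + of_real u)) \<bullet> sgn (F u))) (at u)"
      by (simp add: has_field_derivative_def mult.commute[of _ "inner _ _"] mult_commute_abs)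
    have 4: "(F u * Digamma (w + of_real u)) \<bullet> sgn (F u) = norm (F u) * Re (Digamma (w + of_real u))"
    proof -
      have "(F u * D) \<bullet> F u = (norm (F u))\<^sup>2 * Re D" for D
        unfolding cmod_power2 by (simp add: inner_complex_def algebra_simps power2_eq_square)
      from this[of "Digamma (w + of_real u)"] show ?thesis
        using nz by (simp add: sgn_div_norm power2_eq_square)
    qed
    show ?thesis
      using 3 nz unfolding 4 F_def[symmetric]
      by (auto intro!: derivative_eq_intros simp: F_def)
  qed
  then obtain u where u: "0 < u" "u < x" and
    eq: "ln (norm (Gamma (w + of_real x))) - ln (norm (Gamma (w + of_real 0))) = (x - 0) * Re (Digamma (w + of_real u))"
    using MVT2[of 0 x "\<lambda>u. ln (norm (Gamma (w + of_real u)))" "\<lambda>u. Re (Digamma (w + of_real u))"] x by auto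
  have "Gamma (w + of_real x) \<noteq> 0" "Gamma w \<noteq> 0"
    using ni[of x] ni[of 0] by (auto simp: Gamma_eq_zero_iff)
  then have "ln (norm (Gamma (w + of_real x) * rGamma w)) = x * Re (Digamma (w + of_real u))"
    using eq by (simp add: rGamma_inverse_Gamma norm_mult norm_inverse ln_mult ln_inverse)
  then show ?thesis using u by blast
qed

section \<open>Phragmen-Lindelof, Jensen and the variation of the argument\<close>

text \<open>The function is damped by \<open>exp (- \<delta> * cos (\<kappa> * (z - m)))\<close>,
  where \<open>m\<close> is the midpoint of the strip. The choice of \<open>\<kappa>\<close> keeps
  the real part of the angle within \<open>pi / 4\<close>, so its cosine stays above
  \<open>1 / 2\<close>. The damping factor then has modulus at most 1 on the edges and decays doubly
  exponentially in \<open>\<bar>Im z\<bar>\<close>, which beats \<open>exp (norm z powr r)\<close>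
  for every \<open>r\<close>. Finally \<open>\<delta>\<close> tends to 0.\<close>

lemma phragmen_lindelof_strip:
  fixes F :: "complex \<Rightarrow> complex" and \<alpha> \<beta> M r :: real
  assumes ab: "\<alpha> < \<beta>"
    and cont: "continuous_on {z. \<alpha> \<le> Re z \<and> Re z \<le> \<beta>} F"
    and holo: "F holomorphic_on {z. \<alpha> < Re z \<and> Re z < \<beta>}"
    and edge: "\<And>z. Re z = \<alpha> \<or> Re z = \<beta> \<Longrightarrow> norm (F z) \<le> M"
    and growth: "\<And>z. \<alpha> \<le> Re z \<Longrightarrow> Re z \<le> \<beta> \<Longrightarrow> norm z \<ge> N \<Longrightarrow> norm (F z) \<le> exp (norm z powr r)"
    and M: "M > 0"
    and z0: "\<alpha> \<le> Re z0" "Re z0 \<le> \<beta>"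
  shows "norm (F z0) \<le> M"
proof -
  define m h \<kappa> where "m = (\<alpha> + \<beta>) / 2" and "h = (\<beta> - \<alpha>) / 2" and "\<kappa> = pi / (4 * h)"
  have h: "h > 0" and \<kappa>: "\<kappa> > 0" using ab by (auto simp: h_def \<kappa>_def)
  define C :: "complex \<Rightarrow> complex" where "C = (\<lambda>z. cos (of_real \<kappa> * (z - of_real m)))"
  have ReC: "Re (C z) \<ge> cosh (\<kappa> * Im z) / 2" if "\<alpha> \<le> Re z" "Re z \<le> \<beta>" for z
  proof -
    have "Re (C z) = cos (\<kappa> * (Re z - m)) * cosh (\<kappa> * Im z)"
      by (simp add: C_def Re_cos cosh_def scaleR_conv_of_real)
    moreover have "cos (\<kappa> * (Re z - m)) \<ge> 1 / 2"
    proof -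
      have "\<bar>Re z - m\<bar> \<le> h" using that by (auto simp: m_def h_def abs_le_iff field_simps)
      then have "\<kappa> * \<bar>Re z - m\<bar> \<le> \<kappa> * h" using \<kappa> by (intro mult_left_mono) auto
      also have "\<kappa> * h = pi / 4" using h by (simp add: \<kappa>_def)
      finally have "\<kappa> * \<bar>Re z - m\<bar> \<le> pi / 3" using pi_gt_zero by linarith
      then have "\<bar>\<kappa> * (Re z - m)\<bar> \<le> pi / 3" using \<kappa> by (simp add: abs_mult)
      then have "cos (pi / 3) \<le> cos \<bar>\<kappa> * (Re z - m)\<bar>"
        using pi_gt_zero by (intro cos_monotone_0_pi_le) auto
      then show ?thesis by (simp add: cos_60)
    qed
    ultimately show ?thesis
      using mult_right_mono[of "1/2" "cos (\<kappa> * (Re z - m))" "cosh (\<kappa> * Im z)"] cosh_real_nonneg[of "\<kappa> * Im z"]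
      by simp
  qed
  have bound: "norm (F z0) * exp (- \<delta> * Re (C z0)) \<le> M" if \<delta>: "\<delta> > 0" for \<delta> :: real
  proof -
    define E where "E = (\<lambda>z. F z * exp (- of_real \<delta> * C z))"
    \<comment> \<open>A positive exponent makes the power monotone in its base, so that
      \<open>norm z\<close> may be replaced by the larger \<open>Y + K\<close>.\<close>
    define r' where "r' = max r 1"
    define K where "K = \<bar>\<alpha>\<bar> + \<bar>\<beta>\<bar>"
    have "r' > 0" "K \<ge> 0" by (auto simp: r'_def K_def)
    have "filterlim (\<lambda>y::real. (y + K) powr r' - \<delta> / 2 * cosh (\<kappa> * y)) at_bot at_top"
      using \<delta> \<kappa> \<open>r' > 0\<close> unfolding cosh_field_def by real_asymp
    then have "eventually (\<lambda>y. (y + K) powr r' - \<delta> / 2 * cosh (\<kappa> * y) \<le> ln M) at_top"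
      by (simp add: filterlim_at_bot)
    then obtain Y0 where Y0: "\<And>y. y \<ge> Y0 \<Longrightarrow> (y + K) powr r' - \<delta> / 2 * cosh (\<kappa> * y) \<le> ln M"
      by (auto simp: eventually_at_top_linorder)
    define Y where "Y = max (max Y0 N) (max 1 (\<bar>Im z0\<bar>))"
    have Y: "Y \<ge> Y0" "Y \<ge> N" "Y \<ge> 1" "Y \<ge> \<bar>Im z0\<bar>" by (auto simp: Y_def)
    define S where "S = cbox (Complex \<alpha> (-Y)) (Complex \<beta> Y)"
    have inS: "z \<in> S \<longleftrightarrow> \<alpha> \<le> Re z \<and> Re z \<le> \<beta> \<and> \<bar>Im z\<bar> \<le> Y" for z
      by (auto simp: S_def in_cbox_complex_iff abs_le_iff)
    have intS: "interior S = box (Complex \<alpha> (-Y)) (Complex \<beta> Y)"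
      by (simp add: S_def interior_cbox)
    have normE: "norm (E z) = norm (F z) * exp (- \<delta> * Re (C z))" for z
      by (simp add: E_def norm_mult)
    have "norm (E z0) \<le> M"
    proof (rule maximum_modulus_frontier[of E S])
      show "E holomorphic_on interior S"
        unfolding E_def C_def intS
        by (intro holomorphic_intros holomorphic_on_subset[OF holo]) (auto simp: in_box_complex_iff)
      show "continuous_on (closure S) E"
        unfolding E_def C_def
        by (intro continuous_intros continuous_on_subset[OF cont]) (auto simp: S_def in_cbox_complex_iff)
      show "bounded S" by (simp add: S_def)
      show "z0 \<in> S" using z0 Y by (simp add: inS)
      fix z assume "z \<in> frontier S"
      then have "z \<in> S" "z \<notin> interior S" by (auto simp: frontier_def S_def)
      then have z: "\<alpha> \<le> Re z" "Re z \<le> \<beta>" "\<bar>Im z\<bar> \<le> Y"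
        and "Re z = \<alpha> \<or> Re z = \<beta> \<or> \<bar>Im z\<bar> = Y"
        unfolding intS by (auto simp: inS in_box_complex_iff)
      then consider "Re z = \<alpha> \<or> Re z = \<beta>" | "\<bar>Im z\<bar> = Y" by blast
      then show "norm (E z) \<le> M"
      proof cases
        case 1
        have "Re (C z) \<ge> 0" using ReC[OF z(1,2)] cosh_real_nonneg[of "\<kappa> * Im z"] by linarith
        then have "exp (- \<delta> * Re (C z)) \<le> 1" using \<delta> by simp
        then have "norm (F z) * exp (- \<delta> * Re (C z)) \<le> M * 1"
          using edge[OF 1] M by (intro mult_mono) auto
        then show ?thesis by (simp add: normE)
      next
        case 2
        have nz: "norm z \<ge> Y" using 2 abs_Im_le_cmod[of z] by simp
        have "norm (F z) \<le> exp (norm z powr r)" using growth[OF z(1,2)] nz Y by simp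
        also have "\<dots> \<le> exp ((Y + K) powr r')"
        proof -
          have "norm z powr r \<le> norm z powr r'"
            using nz Y by (intro powr_mono) (auto simp: r'_def)
          also have "norm z \<le> Y + K" using cmod_le[of z] 2 z by (auto simp: K_def)
          then have "norm z powr r' \<le> (Y + K) powr r'"
            using \<open>r' > 0\<close> by (intro powr_mono2) auto
          finally show ?thesis by simp
        qed
        finally have "norm (E z) \<le> exp ((Y + K) powr r') * exp (- \<delta> * Re (C z))"
          unfolding normE by (intro mult_right_mono) auto
        also have "\<dots> \<le> exp ((Y + K) powr r') * exp (- (\<delta> / 2 * cosh (\<kappa> * Y)))"
        proof -
          have "cosh (\<kappa> * Im z) = cosh (\<kappa> * Y)"
            using 2 cosh_minus[of "\<kappa> * Im z"] by (cases "Im z \<ge> 0") auto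
          then have "cosh (\<kappa> * Y) / 2 \<le> Re (C z)"
            using ReC[OF z(1,2)] by (simp only:)
          then have "\<delta> * (cosh (\<kappa> * Y) / 2) \<le> \<delta> * Re (C z)"
            using \<delta> by (intro mult_left_mono) auto
          then show ?thesis by simp
        qed
        also have "\<dots> \<le> M"
          using Y0[OF Y(1)] M by (simp add: exp_add[symmetric] ln_ge_iff)
        finally show ?thesis .
      qed
    qed
    then show ?thesis by (simp add: normE)
  qed
  have "((\<lambda>\<delta>. norm (F z0) * exp (- \<delta> * Re (C z0))) \<longlongrightarrow> norm (F z0) * exp (- 0 * Re (C z0))) (at_right 0)"
    by (intro tendsto_intros)
  then have "norm (F z0) * exp (- 0 * Re (C z0)) \<le> M"
    by (rule tendsto_upperbound) (auto intro!: eventually_mono[OF eventually_at_right_less] bound[simplified])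
  then show ?thesis by simp
qed

text \<open>The zeros are divided out one at a time by a Blaschke factor of the disc of radius
  \<open>r2\<close>. Such a factor has modulus 1 on the boundary circle, so \<open>M\<close>
  survives, while the modulus at the centre is multiplied by \<open>r2 / dist c a\<close>, hence by
  at least \<open>r2 / r1\<close>. The points of \<open>Z\<close> are counted without
  multiplicity.\<close>

lemma jensen_zero_count:
  fixes f :: "complex \<Rightarrow> complex"
  assumes "finite Z" and "f holomorphic_on U" "open U" "cball c r2 \<subseteq> U"
    and "0 < r1" "r1 < r2"
    and "\<And>z. z \<in> Z \<Longrightarrow> f z = 0 \<and> dist c z \<le> r1"
    and "\<And>z. dist c z = r2 \<Longrightarrow> norm (f z) \<le> M"
  shows "norm (f c) * (r2 / r1) ^ card Z \<le> M"
  using assms(1,2,7,8)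
proof (induction Z arbitrary: f rule: finite_induct)
  case empty
  have "norm (f c) \<le> M"
  proof (rule maximum_modulus_frontier[of f "cball c r2"])
    show "f holomorphic_on interior (cball c r2)"
      using empty(1) by (rule holomorphic_on_subset) (use assms(4) interior_subset in blast)
    show "continuous_on (closure (cball c r2)) f"
      using holomorphic_on_imp_continuous_on[OF empty(1)] by (rule continuous_on_subset) (use assms(4) in simp)
  qed (use assms(5,6) empty in \<open>auto simp: frontier_cball\<close>)
  then show ?case by simp
next
  case (insert a Z)
  have a: "f a = 0" "dist c a \<le> r1" using insert.prems by auto
  define h where "h = (\<lambda>z. if z = a then deriv f a else (f z - f a) / (z - a))"
  \<comment> \<open>\<open>(z - a) / B z\<close> is the Blaschke factor;
    \<open>norm (B z) = norm (z - a)\<close> on the circle and \<open>B c = r2\<close>.\<close>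
  define B where "B = (\<lambda>z. (of_real (r2\<^sup>2) - cnj (a - c) * (z - c)) / of_real r2)"
  define g where "g = (\<lambda>z. h z * B z)"
  have "h holomorphic_on U" unfolding h_def by (intro pole_lemma_open insert.prems assms)
  then have holg: "g holomorphic_on U" unfolding g_def B_def by (intro holomorphic_intros) (use assms in auto)
  have g_eq: "g z = f z * B z / (z - a)" if "z \<noteq> a" for z
    using that a by (simp add: g_def h_def)
  have IH: "norm (g c) * (r2 / r1) ^ card Z \<le> M"
  proof (rule insert.IH[OF holg])
    fix z assume "z \<in> Z"
    then have "z \<noteq> a" "f z = 0" "dist c z \<le> r1" using insert.hyps insert.prems(2) by blast+
    then show "g z = 0 \<and> dist c z \<le> r1" by (simp add: g_eq)
  next
    fix z assume z: "dist c z = r2"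
    then have za: "z \<noteq> a" using a assms by auto
    have "norm (B z) = norm (z - a)"
    proof -
      have zz: "of_real (r2\<^sup>2) = (z - c) * cnj (z - c)"
        using complex_norm_square[of "z - c"] z by (simp only: dist_norm norm_minus_commute)
      have "of_real (r2\<^sup>2) - cnj (a - c) * (z - c) = (z - c) * cnj (z - a)"
        unfolding zz by (simp add: algebra_simps)
      then show ?thesis using z assms
        by (simp add: B_def norm_divide norm_mult dist_norm norm_minus_commute)
           (metis complex_cnj_diff complex_mod_cnj)
    qed
    then show "norm (g z) \<le> M"
      using za insert.prems(3)[OF z] by (simp add: g_eq norm_mult norm_divide)
  qed
  show ?case
  proof (cases "f c = 0")
    case True
    have "norm (f (c + of_real r2)) \<le> M" using assms(5,6) by (intro insert.prems(3)) (simp add: dist_norm)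
    then have "M \<ge> 0" using norm_ge_zero order_trans by blast
    with True show ?thesis by simp
  next
    case False
    then have ca: "c \<noteq> a" using a by auto
    have "norm (g c) = norm (f c) * r2 / dist c a"
      using ca assms by (simp add: g_eq B_def norm_mult norm_divide dist_norm power2_eq_square)
    also have "\<dots> \<ge> norm (f c) * r2 / r1"
      using a ca assms by (intro divide_left_mono mult_nonneg_nonneg mult_pos_pos) auto
    finally have "norm (f c) * r2 / r1 * (r2 / r1) ^ card Z \<le> norm (g c) * (r2 / r1) ^ card Z"
      using assms by (intro mult_right_mono) auto
    then show ?thesis using IH insert by (simp add: mult_ac)
  qed
qed

section \<open>Variation of the argument along a curve\<close>

lemma Im_Ln_closed_halfplane:
  assumes "z \<noteq> 0" "Re z \<ge> 0" shows "\<bar>Im (Ln z)\<bar> \<le> pi / 2"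
  using assms Re_Ln_pos_le[of z] by blast

lemma arg_variation_no_zero:
  fixes f f' :: "real \<Rightarrow> complex"
  assumes uv: "u \<le> v"
    and der: "\<And>x. x \<in> {u..v} \<Longrightarrow> (f has_vector_derivative f' x) (at x within {u..v})"
    and nz: "\<And>x. x \<in> {u..v} \<Longrightarrow> f x \<noteq> 0"
    and re: "\<And>x. x \<in> {u<..<v} \<Longrightarrow> Re (f x) \<noteq> 0"
  shows "\<bar>Im (integral {u..v} (\<lambda>x. f' x / f x))\<bar> \<le> pi"
proof (cases "u = v")
  case True then show ?thesis by simp
next
  case False
  then have uv: "u < v" using uv by simp
  have contf: "continuous_on {u..v} f"
    using der has_vector_derivative_continuous continuous_on_eq_continuous_within by blast
  define m where "m = (u + v) / 2"
  have m: "m \<in> {u<..<v}" using uv by (simp add: m_def)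
  obtain e :: complex where e: "e = 1 \<or> e = - 1" and em: "Re (e * f m) > 0"
    using re[OF m] by (metis linorder_neqE_linordered_idom mult_1 mult_minus_left neg_0_less_iff_less uminus_complex.sel(1))
  have pos_open: "Re (e * f x) > 0" if x: "x \<in> {u<..<v}" for x
  proof (rule ccontr)
    assume neg: "\<not> ?thesis"
    have cont: "continuous_on {min x m..max x m} (\<lambda>x. Re (e * f x))"
      using x m by (intro continuous_intros continuous_on_subset[OF contf]) auto
    have "\<exists>y\<in>{min x m..max x m}. Re (e * f y) = 0"
    proof (cases "x \<le> m")
      case True
      then show ?thesis
        using IVT'[of "\<lambda>x. Re (e * f x)" x 0 m] cont neg em by (auto simp: min_def max_def)
    next
      case False
      then show ?thesis
        using IVT2'[of "\<lambda>x. Re (e * f x)" x 0 m] cont neg em by (auto simp: min_def max_def)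
    qed
    then obtain y where "y \<in> {min x m..max x m}" "Re (e * f y) = 0" by blast
    then have "y \<in> {u<..<v}" "Re (f y) = 0" using x m e by auto
    then show False using re by blast
  qed
  have pos: "Re (e * f x) \<ge> 0" if x: "x \<in> {u..v}" for x
  proof -
    have "closure {u<..<v} = {u..v}" using uv by simp
    moreover have "\<forall>x\<in>closure {u<..<v}. Re (e * f x) \<ge> 0"
    proof
      fix x assume x: "x \<in> closure {u<..<v}"
      have "continuous_on (closure {u<..<v}) (\<lambda>x. Re (e * f x))"
        using uv by (auto intro!: continuous_intros contf)
      from continuous_ge_on_closure[OF this x, of 0] show "Re (e * f x) \<ge> 0"
        using pos_open by (auto intro: less_imp_le)
    qed
    ultimately show ?thesis using x by simp
  qed
  have enz: "e * f x \<noteq> 0" if "x \<in> {u..v}" for x using nz[OF that] e by auto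
  have "((\<lambda>x. f' x / f x) has_integral Ln (e * f v) - Ln (e * f u)) {u..v}"
  proof (rule fundamental_theorem_of_calculus)
    fix x assume x: "x \<in> {u..v}"
    have "e * f x \<notin> \<real>\<^sub>\<le>\<^sub>0"
    proof
      assume "e * f x \<in> \<real>\<^sub>\<le>\<^sub>0"
      then have "e * f x = 0" using pos[OF x] by (auto simp: complex_nonpos_Reals_iff complex_eq_iff)
      then show False using enz[OF x] by simp
    qed
    then have "(Ln has_field_derivative inverse (e * f x)) (at (e * f x) within (\<lambda>x. e * f x) ` {u..v})"
      by (intro has_field_derivative_at_within[OF has_field_derivative_Ln])
    moreover have "((\<lambda>x. e * f x) has_vector_derivative e * f' x) (at x within {u..v})"
      using has_vector_derivative_mult_right[OF der[OF x]] .
    ultimately have "(Ln \<circ> (\<lambda>x. e * f x) has_vector_derivative (e * f' x) * inverse (e * f x)) (at x within {u..v})"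
      by (intro field_vector_diff_chain_within)
    moreover have "e * f' x * inverse (e * f x) = f' x / f x" using e by (elim disjE) (simp_all add: divide_inverse)
    ultimately show "((\<lambda>x. Ln (e * f x)) has_vector_derivative f' x / f x) (at x within {u..v})"
      by (simp only: o_def)
  qed (use uv in simp)
  then have "integral {u..v} (\<lambda>x. f' x / f x) = Ln (e * f v) - Ln (e * f u)"
    by (rule integral_unique)
  moreover have "\<bar>Im (Ln (e * f v))\<bar> \<le> pi / 2" "\<bar>Im (Ln (e * f u))\<bar> \<le> pi / 2"
    using uv by (intro Im_Ln_closed_halfplane pos enz; simp)+
  ultimately show ?thesis by simp
qed

text \<open>The zeros of \<open>Re f\<close> cut the interval into one more piece than there are
  zeros, and each piece contributes at most \<open>pi\<close>. The induction cuts at an arbitrary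
  zero, after which both halves have strictly fewer interior zeros.\<close>

lemma arg_variation_zero_count:
  fixes f f' :: "real \<Rightarrow> complex"
  assumes "u \<le> v"
    and "\<And>x. x \<in> {u..v} \<Longrightarrow> (f has_vector_derivative f' x) (at x within {u..v})"
    and "continuous_on {u..v} f'"
    and "\<And>x. x \<in> {u..v} \<Longrightarrow> f x \<noteq> 0"
    and "finite {x\<in>{u<..<v}. Re (f x) = 0}"
  shows "\<bar>Im (integral {u..v} (\<lambda>x. f' x / f x))\<bar> \<le> pi * (real (card {x\<in>{u<..<v}. Re (f x) = 0}) + 1)"
  using assms
proof (induction "card {x\<in>{u<..<v}. Re (f x) = 0}" arbitrary: u v rule: less_induct)
  case less
  show ?case
  proof (cases "{x\<in>{u<..<v}. Re (f x) = 0} = {}")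
    case True
    then have "\<bar>Im (integral {u..v} (\<lambda>x. f' x / f x))\<bar> \<le> pi"
      using less.prems by (intro arg_variation_no_zero) auto
    then show ?thesis unfolding True by simp
  next
    case False
    then obtain z where z: "u < z" "z < v" "Re (f z) = 0" by auto
    let ?Z = "\<lambda>u v. {x\<in>{u<..<v}. Re (f x) = 0}"
    have split: "?Z u v = insert z (?Z u z \<union> ?Z z v)" using z by auto
    have fin: "finite (?Z u z)" "finite (?Z z v)"
      using z by (auto intro: finite_subset[OF _ less.prems(5)])
    have card: "card (?Z u v) = Suc (card (?Z u z) + card (?Z z v))"
      unfolding split using fin by (subst card_insert_disjoint) (auto intro!: card_Un_disjoint)
    have sub: "{u..z} \<subseteq> {u..v}" "{z..v} \<subseteq> {u..v}" using z by auto
    have 1: "\<bar>Im (integral {u..z} (\<lambda>x. f' x / f x))\<bar> \<le> pi * (real (card (?Z u z)) + 1)"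
      using less.prems z sub fin card
      by (intro less.hyps) (auto intro: has_vector_derivative_within_subset[OF _ sub(1)] continuous_on_subset)
    have 2: "\<bar>Im (integral {z..v} (\<lambda>x. f' x / f x))\<bar> \<le> pi * (real (card (?Z z v)) + 1)"
      using less.prems z sub fin card
      by (intro less.hyps) (auto intro: has_vector_derivative_within_subset[OF _ sub(2)] continuous_on_subset)
    have "continuous_on {u..v} f"
      using less.prems(2) has_vector_derivative_continuous continuous_on_eq_continuous_within by blast
    then have "(\<lambda>x. f' x / f x) integrable_on {u..v}"
      using less.prems by (intro integrable_continuous_real continuous_intros) auto
    then have "integral {u..v} (\<lambda>x. f' x / f x) = integral {u..z} (\<lambda>x. f' x / f x) + integral {z..v} (\<lambda>x. f' x / f x)"
      using z by (intro Henstock_Kurzweil_Integration.integral_combine[symmetric]) auto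
    then show ?thesis using 1 2 card by (simp add: algebra_simps)
  qed
qed

section \<open>Dirichlet series and Euler products at large abscissa\<close>

lemma norm_exp_minus_one_le:
  fixes z :: complex
  shows "norm (exp z - 1) \<le> exp (norm z) - 1"
proof -
  have sz: "(\<lambda>n. z ^ Suc n /\<^sub>R fact (Suc n)) sums (exp z - 1)"
    using sums_Suc_iff[of "\<lambda>n. z ^ n /\<^sub>R fact n" "exp z - 1"] exp_converges[of z] by simp
  have sn: "(\<lambda>n. norm z ^ Suc n /\<^sub>R fact (Suc n)) sums (exp (norm z) - 1)"
    using sums_Suc_iff[of "\<lambda>n. norm z ^ n /\<^sub>R fact n" "exp (norm z) - 1"] exp_converges[of "norm z"] by simp
  have "norm (\<Sum>n. z ^ Suc n /\<^sub>R fact (Suc n)) \<le> (\<Sum>n. norm z ^ Suc n /\<^sub>R fact (Suc n))"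
    by (rule norm_suminf_le) (use sn in \<open>auto simp: norm_power norm_mult sums_iff\<close>)
  then show ?thesis using sz sn by (simp add: sums_iff)
qed

lemma selberg_class_sums:
  assumes S: "selberg_class L coef k f Q lam mu \<omega>" and "Re s > 1"
  shows "(\<lambda>n. coef (Suc n) * of_nat (Suc n) powr (- s)) sums L s"
proof -
  have "\<forall>s. Re s > 1 \<longrightarrow> (\<lambda>n. coef (Suc n) * of_nat (Suc n) powr (- s)) sums L s"
    using S unfolding selberg_class_def by (elim conjE)
  then show ?thesis using assms(2) by blast
qed

text \<open>The bound on the coefficients costs one power of \<open>n\<close>, hence the exponent
  \<open>1 - \<sigma>\<close>; the index \<open>n + 2\<close> starts the tail at 2. The first
  coefficient stays symbolic, since its value is derived from this estimate.\<close>

lemma dirichlet_series_tail: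
  fixes coef :: "nat \<Rightarrow> complex"
  assumes "(\<lambda>n. coef (Suc n) * of_nat (Suc n) powr (- s)) sums l"
    and "\<And>n. n \<ge> 1 \<Longrightarrow> norm (coef n) \<le> a1 * real n"
    and "Re s \<ge> \<sigma>" "\<sigma> > 2"
  shows "norm (l - coef 1) \<le> (\<Sum>n. a1 * real (n + 2) powr (1 - \<sigma>))"
proof -
  have sm: "(\<lambda>n. coef (n + 2) * of_nat (n + 2) powr (- s)) sums (l - coef 1)"
    using sums_Suc_iff[of "\<lambda>n. coef (Suc n) * of_nat (Suc n) powr (- s)" "l - coef 1"] assms(1)
    by simp
  have a1: "a1 \<ge> 0" using order_trans[OF norm_ge_zero assms(2)[of 1]] by simp
  have "summable (\<lambda>n. real n powr (1 - \<sigma>))"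
    using assms(4) by (simp add: summable_real_powr_iff)
  then have "summable (\<lambda>n. real (n + 2) powr (1 - \<sigma>))" by (rule summable_ignore_initial_segment)
  then have summ: "summable (\<lambda>n. a1 * real (n + 2) powr (1 - \<sigma>))" by (rule summable_mult)
  have "norm (coef (n + 2) * of_nat (n + 2) powr (- s)) \<le> a1 * real (n + 2) powr (1 - \<sigma>)" for n
  proof -
    have "norm (of_nat (n + 2) powr (- s) :: complex) = real (n + 2) powr (- Re s)"
      using norm_powr_real_powr[of "of_nat (n + 2)" "- s"] by (simp del: of_nat_add)
    also have "\<dots> \<le> real (n + 2) powr (- \<sigma>)" using assms(3) by (intro powr_mono) auto
    finally have "norm (coef (n + 2) * of_nat (n + 2) powr (- s)) \<le> (a1 * real (n + 2)) * real (n + 2) powr (- \<sigma>)"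
      unfolding norm_mult using a1 by (intro mult_mono assms(2)) auto
    also have "\<dots> = a1 * real (n + 2) powr (1 - \<sigma>)"
      by (simp add: powr_diff powr_minus divide_inverse del: of_nat_add)
    finally show ?thesis .
  qed
  then have "norm (\<Sum>n. coef (n + 2) * of_nat (n + 2) powr (- s)) \<le> (\<Sum>n. a1 * real (n + 2) powr (1 - \<sigma>))"
    by (rule norm_suminf_le[OF _ summ])
  also have "(\<Sum>n. coef (n + 2) * of_nat (n + 2) powr (- s)) = l - coef 1"
    using sm by (rule sums_unique[symmetric])
  finally show ?thesis .
qed

text \<open>Both the Dirichlet series and the Euler product are evaluated in the limit \<open>s \<rightarrow> \<infinity>\<close>.\<close>

lemma selberg_class_coef_1:
  assumes S: "selberg_class L coef k f Q lam mu \<omega>"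
    and a1: "\<And>n. n \<ge> 1 \<Longrightarrow> norm (coef n) \<le> a1 * real n"
  shows "coef 1 = 1"
proof -
  define s where "s = (\<lambda>N::nat. complex_of_real (real N + 4))"
  define K where "K = (\<Sum>n. real n powr (- 2))"
  have summK: "summable (\<lambda>n. real n powr (- 2))" by (simp add: summable_real_powr_iff)
  have K0: "K \<ge> 0" unfolding K_def by (intro suminf_nonneg summK) auto
  \<comment> \<open>Applied with \<open>x = 1 / 2\<close> to the Euler factors and with
    \<open>x = 1\<close> to the Dirichlet coefficients: exponential decay in \<open>N\<close> is
    split off and a summable factor remains.\<close>
  have decay: "real n powr (x - (real N + 4)) \<le> 2 powr (- real N) * real n powr (- 2)"
    if "n \<ge> 2" "x \<le> 2" for n N and x :: real
  proof -
    have "real n powr (x - (real N + 4)) \<le> real n powr (- real N - 2)"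
      using that by (intro powr_mono) auto
    also have "\<dots> = real n powr (- real N) * real n powr (- 2)" by (simp add: powr_add[symmetric])
    also have "real n powr (- real N) \<le> 2 powr (- real N)"
      using that by (intro powr_mono2') auto
    finally show ?thesis by (simp add: mult_right_mono)
  qed
  have "\<exists>(\<beta> :: nat \<Rightarrow> complex) (\<theta>::real) (C::real). \<theta> < 1 / 2 \<and>
        (\<forall>p l. prime p \<and> l \<ge> 1 \<longrightarrow> norm (\<beta> (p ^ l)) \<le> C * real p powr (real l * \<theta>)) \<and>
        (\<forall>s. Re s > 1 \<longrightarrow>
           (\<lambda>n. if prime n
                then exp (\<Sum>l. \<beta> (n ^ Suc l) * of_nat n powr (- of_nat (Suc l) * s))
                else 1) has_prod L s)"
    using S unfolding selberg_class_def by (elim conjE)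
  then obtain \<beta> :: "nat \<Rightarrow> complex" and \<theta> C :: real where \<theta>: "\<theta> < 1 / 2"
    and \<beta>: "\<And>p l. prime p \<Longrightarrow> l \<ge> 1 \<Longrightarrow> norm (\<beta> (p ^ l)) \<le> C * real p powr (real l * \<theta>)"
    and ep: "\<And>s. Re s > 1 \<Longrightarrow>
           (\<lambda>n. if prime n
                then exp (\<Sum>l. \<beta> (n ^ Suc l) * of_nat n powr (- of_nat (Suc l) * s))
                else 1) has_prod L s"
    by blast
  have C0: "C \<ge> 0"
  proof -
    have "0 \<le> C * 2 powr \<theta>"
      using order_trans[OF norm_ge_zero \<beta>[of 2 1]] by simp
    then show ?thesis by (simp add: zero_le_mult_iff)
  qed
  have euler: "norm (L (s N) - 1) \<le> exp (2 * C * K * 2 powr (- real N)) - 1" for N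
  proof -
    define t where "t = real N + 4"
    define z where "z = (\<lambda>n. if prime n then \<Sum>l. \<beta> (n ^ Suc l) * of_nat n powr (- of_nat (Suc l) * s N) else 0)"
    have z: "norm (z n) \<le> 2 * C * 2 powr (- real N) * real n powr (- 2)" for n
    proof (cases "prime n")
      case True
      then have n2: "n \<ge> 2" by (simp add: prime_ge_2_nat)
      define q where "q = real n powr (1 / 2 - t)"
      have q: "0 \<le> q" "q \<le> 1 / 2"
      proof -
        have "q \<le> real n powr (- 1)" using n2 unfolding q_def t_def by (intro powr_mono) auto
        also have "\<dots> \<le> 2 powr (- 1)" using n2 by (intro powr_mono2') auto
        finally show "q \<le> 1 / 2" by (simp add: powr_minus)
      qed (simp add: q_def)
      \<comment> \<open>The condition \<open>\<theta> < 1 / 2\<close> enters here: the logarithm of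
        an Euler factor is dominated by a geometric series of ratio \<open>q \<le> 1 / 2\<close>,
        and summing it costs the factor 2.\<close>
      have trm: "norm (\<beta> (n ^ Suc l) * of_nat n powr (- of_nat (Suc l) * s N)) \<le> C * q ^ Suc l" for l
      proof -
        have "norm (of_nat n powr (- of_nat (Suc l) * s N) :: complex) = real n powr (- (real (Suc l) * t))"
          using norm_powr_real_powr[of "of_nat n" "- of_nat (Suc l) * s N"]
          by (simp add: s_def t_def algebra_simps)
        then have "norm (\<beta> (n ^ Suc l) * of_nat n powr (- of_nat (Suc l) * s N))
            \<le> (C * real n powr (real (Suc l) * \<theta>)) * real n powr (- (real (Suc l) * t))"
          unfolding norm_mult using \<beta>[OF True, of "Suc l"] by (simp add: mult_right_mono)
        also have "\<dots> = C * real n powr (real (Suc l) * (\<theta> - t))"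
          by (simp add: powr_add[symmetric] algebra_simps)
        also have "\<dots> \<le> C * real n powr (real (Suc l) * (1 / 2 - t))"
          using n2 \<theta> C0 by (intro mult_left_mono powr_mono) (auto intro!: mult_left_mono)
        also have "real n powr (real (Suc l) * (1 / 2 - t)) = q ^ Suc l"
          using n2 unfolding q_def by (subst powr_realpow[symmetric]) (auto simp: powr_powr mult.commute)
        finally show ?thesis .
      qed
      have "(\<lambda>l. q ^ l) sums (1 / (1 - q))" using q by (intro geometric_sums) auto
      then have "(\<lambda>l. (C * q) * q ^ l) sums ((C * q) * (1 / (1 - q)))" by (rule sums_mult)
      then have geo: "(\<lambda>l. C * q ^ Suc l) sums (C * q / (1 - q))" by (simp add: mult.assoc)
      have "norm (z n) \<le> (\<Sum>l. C * q ^ Suc l)"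
        unfolding z_def if_P[OF True] by (rule norm_suminf_le) (use trm geo in \<open>auto simp: sums_iff\<close>)
      also have "\<dots> = C * q / (1 - q)" using geo by (simp add: sums_iff)
      also have "\<dots> \<le> C * q / (1 / 2)" using q C0 by (intro divide_left_mono) auto
      also have "\<dots> = 2 * C * q" by simp
      also have "\<dots> \<le> 2 * C * (2 powr (- real N) * real n powr (- 2))"
        unfolding q_def t_def using n2 C0 by (intro mult_left_mono decay) auto
      finally show ?thesis by simp
    qed (use C0 in \<open>auto simp: z_def\<close>)
    have e: "(if prime n then exp (\<Sum>l. \<beta> (n ^ Suc l) * of_nat n powr (- of_nat (Suc l) * s N)) else 1) = exp (z n)" for n
      by (simp add: z_def)
    have "(\<lambda>n. exp (z n)) has_prod L (s N)" using ep[of "s N"] unfolding e by (simp add: s_def)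
    then have "(\<lambda>n. \<Prod>i\<le>n. exp (z i)) \<longlonglongrightarrow> L (s N)"
      by (auto simp: has_prod_def raw_has_prod_def)
    then have "(\<lambda>n. norm ((\<Prod>i\<le>n. exp (z i)) - 1)) \<longlonglongrightarrow> norm (L (s N) - 1)" by (intro tendsto_intros)
    moreover have "norm ((\<Prod>i\<le>n. exp (z i)) - 1) \<le> exp (2 * C * K * 2 powr (- real N)) - 1" for n
    proof -
      have "norm (\<Sum>i\<le>n. z i) \<le> (\<Sum>i\<le>n. 2 * C * 2 powr (- real N) * real i powr (- 2))"
        by (rule sum_norm_le) (rule z)
      also have "\<dots> = 2 * C * 2 powr (- real N) * (\<Sum>i\<le>n. real i powr (- 2))" by (simp add: sum_distrib_left)
      also have "\<dots> \<le> 2 * C * 2 powr (- real N) * K"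
        unfolding K_def using C0 by (intro mult_left_mono sum_le_suminf summK) auto
      finally have "norm (\<Sum>i\<le>n. z i) \<le> 2 * C * K * 2 powr (- real N)" by (simp only: mult_ac)
      then have "exp (norm (\<Sum>i\<le>n. z i)) \<le> exp (2 * C * K * 2 powr (- real N))" by (simp only: exp_le_cancel_iff)
      then show ?thesis
        using norm_exp_minus_one_le[of "\<Sum>i\<le>n. z i"] unfolding exp_sum[OF finite_atMost] by linarith
    qed
    ultimately show ?thesis by (auto intro: LIMSEQ_le_const2)
  qed
  have a10: "a1 \<ge> 0" using order_trans[OF norm_ge_zero a1[of 1]] by simp
  have dirichlet: "norm (L (s N) - coef 1) \<le> a1 * K * 2 powr (- real N)" for N
  proof -
    have "(\<lambda>n. coef (Suc n) * of_nat (Suc n) powr (- s N)) sums L (s N)"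
      by (rule selberg_class_sums[OF S]) (simp add: s_def)
    then have "norm (L (s N) - coef 1) \<le> (\<Sum>n. a1 * real (n + 2) powr (1 - (real N + 4)))"
      by (rule dirichlet_series_tail) (use a1 in \<open>auto simp: s_def\<close>)
    also have "\<dots> \<le> (\<Sum>n. a1 * 2 powr (- real N) * real (n + 2) powr (- 2))"
    proof (rule suminf_le)
      show "summable (\<lambda>n. a1 * real (n + 2) powr (1 - (real N + 4)))"
        by (intro summable_mult summable_ignore_initial_segment[where f = "\<lambda>n. real n powr _"])
           (simp add: summable_real_powr_iff)
      show "summable (\<lambda>n. a1 * 2 powr (- real N) * real (n + 2) powr (- 2))"
        by (intro summable_mult summable_ignore_initial_segment[OF summK])
      show "a1 * real (n + 2) powr (1 - (real N + 4)) \<le> a1 * 2 powr (- real N) * real (n + 2) powr (- 2)" for n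
        using mult_left_mono[OF decay[of "n + 2" 1 N] a10] by (simp add: mult_ac)
    qed
    also have "\<dots> = a1 * 2 powr (- real N) * (\<Sum>n. real (n + 2) powr (- 2))"
      by (intro suminf_mult summable_ignore_initial_segment[OF summK])
    also have "\<dots> \<le> a1 * 2 powr (- real N) * K"
    proof (intro mult_left_mono)
      have "(\<Sum>n. real (n + 2) powr (- 2)) = K - (\<Sum>i<2. real i powr (- 2))"
        unfolding K_def by (rule suminf_minus_initial_segment[OF summK])
      then show "(\<Sum>n. real (n + 2) powr (- 2)) \<le> K" by (simp add: sum_nonneg)
    qed (use a10 in auto)
    finally show ?thesis by (simp add: mult_ac)
  qed
  have "(\<lambda>N. L (s N) - coef 1) \<longlonglongrightarrow> 0"
  proof (rule Lim_null_comparison[OF always_eventually])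
    show "(\<lambda>N::nat. a1 * K * 2 powr (- real N)) \<longlonglongrightarrow> 0" by real_asymp
  qed (use dirichlet in auto)
  moreover have "(\<lambda>N. L (s N) - 1) \<longlonglongrightarrow> 0"
  proof (rule Lim_null_comparison[OF always_eventually])
    show "(\<lambda>N::nat. exp (2 * C * K * 2 powr (- real N)) - 1) \<longlonglongrightarrow> 0" by real_asymp
  qed (use euler in auto)
  ultimately have "(\<lambda>N. (L (s N) - 1) - (L (s N) - coef 1)) \<longlonglongrightarrow> 0 - 0" by (intro tendsto_diff)
  then have "(\<lambda>N::nat. coef 1 - 1) \<longlonglongrightarrow> 0" by simp
  then show ?thesis using LIMSEQ_unique[OF _ tendsto_const] by fastforce
qed

text \<open>In the sense of \<open>has_prod\<close> a product is 0 only if one of its factors is 0,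
  and here every factor is an exponential or 1.\<close>

lemma selberg_class_nonzero:
  assumes "selberg_class L coef k f Q lam mu \<omega>" and "Re s > 1"
  shows "L s \<noteq> 0"
proof -
  obtain \<beta> :: "nat \<Rightarrow> complex" where
    "(\<lambda>n. if prime n then exp (\<Sum>l. \<beta> (n ^ Suc l) * of_nat n powr (- of_nat (Suc l) * s)) else 1) has_prod L s"
    using assms unfolding selberg_class_def by blast
  then show ?thesis by (auto simp: has_prod_def raw_has_prod_def split: if_splits)
qed

text \<open>With \<open>m = min a (- b)\<close> the tail at abscissa \<open>m + 1\<close> is the sum
  of \<open>a1 * n powr (- m)\<close> over \<open>n \<ge> 2\<close>. For \<open>m = a\<close> this
  is the first hypothesis on sums. For \<open>m = - b\<close> each term is
  \<open>1 / n \<le> 1 / 2\<close> times the corresponding term of the second, whose bound 1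
  therefore becomes \<open>1 / 2\<close>.\<close>

lemma selberg_class_near_one:
  assumes S: "selberg_class L coef k f Q lam mu \<omega>"
    and a1: "\<And>n. n \<ge> 1 \<Longrightarrow> norm (coef n) \<le> a1 * real n"
    and a: "a > 2" "(\<Sum>n. a1 * real (n + 2) powr (- a)) < 1 / 2"
    and b: "b < - 3" "(\<Sum>n. a1 * real (n + 2) powr (b + 1)) < 1"
    and s: "Re s \<ge> min a (- b) + 1"
  shows "norm (L s - 1) \<le> 1 / 2"
proof -
  define m where "m = min a (- b)"
  have m: "m > 2" using a b by (simp add: m_def)
  have "(\<lambda>n. coef (Suc n) * of_nat (Suc n) powr (- s)) sums L s"
    by (rule selberg_class_sums[OF S]) (use s m m_def in linarith)
  then have "norm (L s - coef 1) \<le> (\<Sum>n. a1 * real (n + 2) powr (1 - (m + 1)))"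
    by (rule dirichlet_series_tail) (use a1 s m in \<open>auto simp: m_def\<close>)
  also have "\<dots> \<le> 1 / 2"
  proof (cases "a \<le> - b")
    case True
    then show ?thesis using a by (simp add: m_def)
  next
    case False
    have a10: "a1 \<ge> 0" using order_trans[OF norm_ge_zero a1[of 1]] by simp
    have summ: "summable (\<lambda>n. a1 * real (n + 2) powr x)" if "x < -1" for x
      using that by (intro summable_mult summable_ignore_initial_segment[where f = "\<lambda>n. real n powr _"])
           (simp add: summable_real_powr_iff)
    have "(\<Sum>n. a1 * real (n + 2) powr (1 - (m + 1))) \<le> (\<Sum>n. 1 / 2 * (a1 * real (n + 2) powr (b + 1)))"
    proof (rule suminf_le)
      fix n :: nat
      have "real (n + 2) powr (1 - (m + 1)) = real (n + 2) powr (b + 1) * (1 / real (n + 2))"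
        using False by (simp add: m_def powr_add del: of_nat_add)
      also have "\<dots> \<le> real (n + 2) powr (b + 1) * (1 / 2)"
        by (intro mult_left_mono divide_left_mono) auto
      finally have "a1 * real (n + 2) powr (1 - (m + 1)) \<le> a1 * (real (n + 2) powr (b + 1) * (1 / 2))"
        by (rule mult_left_mono[OF _ a10])
      then show "a1 * real (n + 2) powr (1 - (m + 1)) \<le> 1 / 2 * (a1 * real (n + 2) powr (b + 1))"
        by (simp only: mult_ac)
    next
      show "summable (\<lambda>n. a1 * real (n + 2) powr (1 - (m + 1)))"
        by (rule summ) (use m in simp)
      show "summable (\<lambda>n. 1 / 2 * (a1 * real (n + 2) powr (b + 1)))"
        by (rule summable_mult[OF summ]) (use b in simp)
    qed
    also have "\<dots> = 1 / 2 * (\<Sum>n. a1 * real (n + 2) powr (b + 1))"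
      using b by (intro suminf_mult summ) auto
    also have "\<dots> \<le> 1 / 2" using b by simp
    finally show ?thesis .
  qed
  finally show ?thesis using selberg_class_coef_1[OF S a1] by simp
qed

section \<open>Growth in the critical strip\<close>

lemma not_nonpos_Int_if_Im_nonzero:
  fixes z :: complex
  assumes "Im z \<noteq> 0" shows "z \<notin> \<int>\<^sub>\<le>\<^sub>0"
proof
  assume "z \<in> \<int>\<^sub>\<le>\<^sub>0"
  then show False using assms by (elim nonpos_Ints_cases) simp
qed

text \<open>These assumptions are stable under passing to \<open>cnj (L (cnj s))\<close> with
  \<open>mu\<close> and \<open>\<omega>\<close> conjugated, which carries every result over to the
  lower half plane. The Dirichlet series and the Euler product are represented by
  \<open>near_one\<close> and \<open>nonzero\<close>.\<close>

locale functional_equation =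
  fixes L :: "complex \<Rightarrow> complex" and k f :: nat and Q :: real and lam :: "nat \<Rightarrow> real"
    and mu :: "nat \<Rightarrow> complex" and \<omega> :: complex and c :: real
  assumes c: "c \<ge> 3" and Q: "Q > 0"
    and lam: "\<And>j. j \<in> {1..f} \<Longrightarrow> lam j > 0"
    and mu: "\<And>j. j \<in> {1..f} \<Longrightarrow> Re (mu j) \<ge> 0"
    and omega: "norm \<omega> = 1"
    and entire: "\<exists>G. G holomorphic_on UNIV \<and> finite_order G \<and> (\<forall>s. s \<noteq> 1 \<longrightarrow> G s = (s - 1) ^ k * L s)"
    and feq: "\<And>s. \<lbrakk>s \<noteq> 0; s \<noteq> 1; \<forall>j\<in>{1..f}. of_real (lam j) * s + mu j \<notin> \<int>\<^sub>\<le>\<^sub>0 \<and>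
                    of_real (lam j) * (1 - cnj s) + mu j \<notin> \<int>\<^sub>\<le>\<^sub>0\<rbrakk> \<Longrightarrow>
        completed_L L f Q lam mu s = \<omega> * cnj (completed_L L f Q lam mu (1 - cnj s))"
    and nonzero: "\<And>s. Re s > 1 \<Longrightarrow> L s \<noteq> 0"
    and near_one: "\<And>s. Re s \<ge> c \<Longrightarrow> norm (L s - 1) \<le> 1 / 2"
begin

text \<open>Distance from the line \<open>Re s = c\<close> to the critical line, so that
  \<open>2 * P\<close> is the width of the strip between \<open>1 - c\<close> and
  \<open>c\<close>.\<close>

definition P :: real where "P = c - 1 / 2"
definition d :: real where "d = degree_L f lam"
definition \<Lambda> :: real where "\<Lambda> = ln (lambda_L f lam * Q ^ 2)"

lemma P_ge: "P \<ge> 5 / 2" using c by (simp add: P_def)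

lemma d_nonneg: "d \<ge> 0"
  unfolding d_def degree_L_def by (intro mult_nonneg_nonneg sum_nonneg less_imp_le[OF lam]) auto

lemma \<Lambda>_eq: "\<Lambda> = (\<Sum>j\<in>{1..f}. 2 * lam j * ln (lam j)) + 2 * ln Q"
proof -
  have "(\<Prod>j\<in>{1..f}. lam j powr (2 * lam j)) = exp (\<Sum>j\<in>{1..f}. 2 * lam j * ln (lam j))"
    unfolding exp_sum[OF finite_atLeastAtMost]
    by (rule prod.cong) (use lam in \<open>fastforce simp: powr_def\<close>)+
  then have "\<Lambda> = ln (exp (\<Sum>j\<in>{1..f}. 2 * lam j * ln (lam j)) * Q ^ 2)"
    by (simp add: \<Lambda>_def lambda_L_def)
  also have "\<dots> = (\<Sum>j\<in>{1..f}. 2 * lam j * ln (lam j)) + ln (Q ^ 2)"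
    using Q by (subst ln_mult) auto
  finally show ?thesis using Q by (simp add: ln_realpow)
qed

lemma holomorphic_L: "L holomorphic_on - {1}"
proof -
  obtain G where G: "G holomorphic_on UNIV" "\<And>s. s \<noteq> 1 \<Longrightarrow> G s = (s - 1) ^ k * L s"
    using entire by blast
  have "(\<lambda>s. G s / (s - 1) ^ k) holomorphic_on - {1}"
    by (intro holomorphic_intros holomorphic_on_subset[OF G(1)]) auto
  then show ?thesis by (rule holomorphic_transform) (simp add: G(2))
qed

lemma norm_L_right: "Re s \<ge> c \<Longrightarrow> norm (L s) \<le> 3 / 2"
  using near_one[of s] norm_triangle_sub[of "L s" 1] by simp

section \<open>The size of \<open>L\<close> on the edge \<open>Re s = 1 - c\<close>\<close>

lemma norm_completed_L:
  "norm (completed_L L f Q lam mu s)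
     = norm (L s) * Q powr Re s * (\<Prod>j\<in>{1..f}. norm (Gamma (of_real (lam j) * s + mu j)))"
  using Q by (simp add: completed_L_def norm_mult prod_norm norm_powr_real_powr)

lemma reflect_eq: "Re s = 1 - c \<Longrightarrow>
    of_real (lam j) * (1 - cnj s) + mu j = (of_real (lam j) * s + mu j) + of_real (lam j * (2 * P))"
proof -
  assume "Re s = 1 - c"
  then have eq: "1 - cnj s = s + of_real (2 * P)" by (simp add: complex_eq_iff P_def)
  show ?thesis unfolding eq by (simp add: algebra_simps)
qed

lemma right_of_poles:
  assumes "j \<in> {1..f}" "Re s = 1 - c"
  shows "(of_real (lam j) * s + mu j) + of_real (lam j * (2 * P)) \<notin> \<int>\<^sub>\<le>\<^sub>0"
proof
  assume "(of_real (lam j) * s + mu j) + of_real (lam j * (2 * P)) \<in> \<int>\<^sub>\<le>\<^sub>0"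
  then have "Re ((of_real (lam j) * s + mu j) + of_real (lam j * (2 * P))) \<le> 0"
    by (elim nonpos_Ints_cases) simp
  then have "lam j * c + Re (mu j) \<le> 0" using assms by (simp add: P_def algebra_simps)
  moreover have "lam j * c > 0" using lam[OF assms(1)] c by simp
  ultimately show False using mu[OF assms(1)] by linarith
qed

text \<open>On \<open>Re s = 1 - c\<close> the reflected Gamma argument is the original one shifted
  by the positive real number \<open>lam j * (2 * P)\<close> (\<open>reflect_eq\<close>), so the
  functional equation produces exactly the quotients of \<open>norm_Gamma_shift_mono\<close>. With
  \<open>rGamma\<close> they are continuous along the whole edge.\<close>

definition gamma_ratio :: "complex \<Rightarrow> nat \<Rightarrow> real" where
  "gamma_ratio s j = norm (Gamma ((of_real (lam j) * s + mu j) + of_real (lam j * (2 * P)))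
                           * rGamma (of_real (lam j) * s + mu j))"

lemma norm_L_left_edge_generic:
  assumes s: "Re s = 1 - c"
    and np: "\<And>j. j \<in> {1..f} \<Longrightarrow> of_real (lam j) * s + mu j \<notin> \<int>\<^sub>\<le>\<^sub>0"
  shows "norm (L s) \<le> 3 / 2 * Q powr (2 * P) * (\<Prod>j\<in>{1..f}. gamma_ratio s j)"
proof -
  have "completed_L L f Q lam mu s = \<omega> * cnj (completed_L L f Q lam mu (1 - cnj s))"
    using c s np right_of_poles[OF _ s] by (intro feq) (auto simp: reflect_eq)
  then have "norm (completed_L L f Q lam mu s) = norm (completed_L L f Q lam mu (1 - cnj s))"
    using omega by (simp add: norm_mult)
  then have eq: "norm (L s) * Q powr (1 - c) * (\<Prod>j\<in>{1..f}. norm (Gamma (of_real (lam j) * s + mu j)))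
      = norm (L (1 - cnj s)) * Q powr c
        * (\<Prod>j\<in>{1..f}. norm (Gamma ((of_real (lam j) * s + mu j) + of_real (lam j * (2 * P)))))"
    using s unfolding norm_completed_L by (simp add: reflect_eq)
  have pos: "(\<Prod>j\<in>{1..f}. norm (Gamma (of_real (lam j) * s + mu j))) > 0"
    using np by (intro prod_pos) (auto simp: Gamma_eq_zero_iff)
  have ratio: "(\<Prod>j\<in>{1..f}. gamma_ratio s j)
      = (\<Prod>j\<in>{1..f}. norm (Gamma ((of_real (lam j) * s + mu j) + of_real (lam j * (2 * P)))))
        / (\<Prod>j\<in>{1..f}. norm (Gamma (of_real (lam j) * s + mu j)))"
    unfolding gamma_ratio_def by (simp add: norm_mult rGamma_inverse_Gamma norm_inverse prod_dividef divide_inverse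
        flip: prod_inversef prod.distrib)
  have cancel: "l = l' * (q / q') * (A / B)" if "l * q' * B = l' * q * A" "q' > 0" "B > 0" for l l' q q' A B :: real
    using that by (simp add: field_simps)
  have "norm (L s) = norm (L (1 - cnj s)) * (Q powr c / Q powr (1 - c)) * (\<Prod>j\<in>{1..f}. gamma_ratio s j)"
    unfolding ratio by (rule cancel[OF eq _ pos]) (use Q in simp)
  also have "Q powr c / Q powr (1 - c) = Q powr (2 * P)"
    using Q by (simp add: powr_diff[symmetric] P_def)
  also have "norm (L (1 - cnj s)) * Q powr (2 * P) * (\<Prod>j\<in>{1..f}. gamma_ratio s j)
      \<le> 3 / 2 * Q powr (2 * P) * (\<Prod>j\<in>{1..f}. gamma_ratio s j)"
    using s by (intro mult_right_mono norm_L_right prod_nonneg) (auto simp: gamma_ratio_def)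
  finally show ?thesis .
qed

text \<open>The functional equation says nothing at the poles of the Gamma factors, which are therefore
  approached along the edge.\<close>

lemma norm_L_left_edge:
  assumes s: "Re s = 1 - c"
  shows "norm (L s) \<le> 3 / 2 * Q powr (2 * P) * (\<Prod>j\<in>{1..f}. gamma_ratio s j)"
proof -
  define \<gamma> where "\<gamma> = (\<lambda>\<epsilon>::real. s + of_real \<epsilon> * \<i>)"
  have lim: "(\<gamma> \<longlongrightarrow> s) (at_right 0)" unfolding \<gamma>_def by (auto intro!: tendsto_eq_intros)
  have "isCont L s"
    using holomorphic_on_imp_continuous_on[OF holomorphic_L] s c
    by (subst (asm) continuous_on_eq_continuous_at) auto
  then have limL: "((\<lambda>\<epsilon>. norm (L (\<gamma> \<epsilon>))) \<longlongrightarrow> norm (L s)) (at_right 0)"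
    by (intro tendsto_norm isCont_tendsto_compose[OF _ lim])
  have limG: "((\<lambda>\<epsilon>. gamma_ratio (\<gamma> \<epsilon>) j) \<longlongrightarrow> gamma_ratio s j) (at_right 0)" if "j \<in> {1..f}" for j
    unfolding gamma_ratio_def
    by (intro tendsto_norm tendsto_mult isCont_tendsto_compose[OF isCont_Gamma[OF continuous_ident]]
          isCont_tendsto_compose[OF isCont_rGamma[OF continuous_ident]] tendsto_add tendsto_const lim
          right_of_poles that s)
  have ev: "eventually (\<lambda>\<epsilon>. of_real (lam j) * \<gamma> \<epsilon> + mu j \<notin> \<int>\<^sub>\<le>\<^sub>0) (at_right 0)" if "j \<in> {1..f}" for j
  proof -
    have "eventually (\<lambda>\<epsilon>. \<epsilon> \<noteq> - Im (mu j) / lam j - Im s) (at_right 0)"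
      by (rule eventually_neq_at_within)
    then show ?thesis
    proof (rule eventually_mono)
      fix \<epsilon> :: real
      assume "\<epsilon> \<noteq> - Im (mu j) / lam j - Im s"
      then have "Im (of_real (lam j) * \<gamma> \<epsilon> + mu j) \<noteq> 0"
        using lam[OF that] by (auto simp: \<gamma>_def field_simps)
      then show "of_real (lam j) * \<gamma> \<epsilon> + mu j \<notin> \<int>\<^sub>\<le>\<^sub>0" by (rule not_nonpos_Int_if_Im_nonzero)
    qed
  qed
  have "eventually (\<lambda>\<epsilon>. \<forall>j\<in>{1..f}. of_real (lam j) * \<gamma> \<epsilon> + mu j \<notin> \<int>\<^sub>\<le>\<^sub>0) (at_right 0)"
    using ev by (intro eventually_ball_finite) auto
  then have le: "eventually (\<lambda>\<epsilon>. norm (L (\<gamma> \<epsilon>)) \<le> 3 / 2 * Q powr (2 * P) * (\<Prod>j\<in>{1..f}. gamma_ratio (\<gamma> \<epsilon>) j)) (at_right 0)"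
    by (rule eventually_mono) (rule norm_L_left_edge_generic, auto simp: \<gamma>_def s)
  have "((\<lambda>\<epsilon>. 3 / 2 * Q powr (2 * P) * (\<Prod>j\<in>{1..f}. gamma_ratio (\<gamma> \<epsilon>) j))
      \<longlongrightarrow> 3 / 2 * Q powr (2 * P) * (\<Prod>j\<in>{1..f}. gamma_ratio s j)) (at_right 0)"
    by (intro tendsto_mult tendsto_const tendsto_prod limG)
  from tendsto_le[OF _ this limL le] show ?thesis by simp
qed

text \<open>The Gamma argument is lifted to the height \<open>Y \<ge> lam j * t\<close>; there the
  logarithm of the ratio is \<open>2 * P * lam j\<close> times a value of \<open>Re Digamma\<close>,
  which is at most the logarithm of a modulus plus \<open>pi / (lam j * t)\<close>. The excess
  height \<open>v\<close> is kept apart from \<open>t\<close> so that a Gaussian can absorb it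
  later.\<close>

lemma gamma_ratio_le:
  assumes j: "j \<in> {1..f}" and s: "Re s = 1 - c" and t: "\<bar>Im s\<bar> \<le> t + v" "t > 0" "v \<ge> 0"
    and mut: "2 * norm (mu j) \<le> lam j * t"
  shows "gamma_ratio s j \<le> exp (2 * P * lam j * ln (lam j) + 2 * P * lam j * ln (c + 2 * t + v) + 2 * pi * P / t)"
proof -
  define x where "x = lam j * (2 * P)"
  define w where "w = of_real (lam j) * s + mu j"
  define Y where "Y = lam j * (t + v) + norm (mu j)"
  define w' where "w' = Complex (Re w) Y"
  have l: "lam j > 0" by (rule lam[OF j])
  have x: "x > 0" using l P_ge by (simp add: x_def)
  have lt: "lam j * t > 0" using l t by simp
  have Yt: "Y \<ge> lam j * t" using l t by (simp add: Y_def algebra_simps)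
  have Y: "Y \<ge> lam j * t" "Y > 0" "lam j * t > 0" using lt Yt by linarith+
  have Rew: "Re w = lam j * (1 - c) + Re (mu j)" by (simp add: w_def s)
  have "norm (Gamma (w + of_real x) * rGamma w) \<le> norm (Gamma (w' + of_real x) * rGamma w')"
  proof (rule norm_Gamma_shift_mono)
    have "\<bar>Im w\<bar> \<le> lam j * \<bar>Im s\<bar> + norm (mu j)"
      using l abs_Im_le_cmod[of "mu j"] abs_triangle_ineq[of "lam j * Im s" "Im (mu j)"]
      by (simp add: w_def abs_mult)
    also have "\<dots> \<le> Y" using t l by (simp add: Y_def)
    finally show "\<bar>Im w\<bar> \<le> \<bar>Im w'\<bar>" by (simp add: w'_def)
    have "x / 2 = lam j * c - lam j / 2" by (simp add: x_def P_def field_simps)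
    moreover have "Re w = lam j - lam j * c + Re (mu j)" by (simp add: Rew algebra_simps)
    ultimately show "Re w \<ge> - x / 2" using mu[OF j] l by linarith
    show "w + of_real x \<notin> \<int>\<^sub>\<le>\<^sub>0" unfolding w_def x_def by (rule right_of_poles[OF j s])
    have "Im (w' + of_real x) \<noteq> 0" using Y by (simp add: w'_def)
    then show "w' + of_real x \<notin> \<int>\<^sub>\<le>\<^sub>0" by (rule not_nonpos_Int_if_Im_nonzero)
  qed (use x in \<open>auto simp: w'_def\<close>)
  also have "\<dots> \<le> exp (2 * P * lam j * ln (lam j) + 2 * P * lam j * ln (c + 2 * t + v) + 2 * pi * P / t)"
  proof -
    obtain u where u: "0 < u" "u < x"
      and eq: "ln (norm (Gamma (w' + of_real x) * rGamma w')) = x * Re (Digamma (w' + of_real u))"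
      using ln_norm_Gamma_shift[of w' x] x Y by (auto simp: w'_def)
    have "\<bar>Re (Digamma (w' + of_real u)) - ln (norm (w' + of_real u))\<bar> \<le> pi / Y"
      using Re_Digamma_ln_norm'[of "w' + of_real u"] Y by (simp add: w'_def)
    also have "\<dots> \<le> pi / (lam j * t)"
      using Y by (intro divide_left_mono) auto
    finally have 1: "Re (Digamma (w' + of_real u)) \<le> ln (norm (w' + of_real u)) + pi / (lam j * t)" by linarith
    have "norm (w' + of_real u) \<le> \<bar>Re w + u\<bar> + Y"
      using cmod_le[of "w' + of_real u"] Y by (simp add: w'_def)
    also have "\<bar>Re w + u\<bar> \<le> lam j * c + Re (mu j)"
      using u l c mu[OF j] by (simp add: Rew x_def P_def abs_le_iff algebra_simps)
    also have "Re (mu j) \<le> norm (mu j)" by (rule complex_Re_le_cmod)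
    \<comment> \<open>One \<open>norm (mu j)\<close> comes from the real part and one from
      \<open>Y\<close>; together they are paid for by the second \<open>t\<close>.\<close>
    also have "lam j * c + norm (mu j) + Y \<le> lam j * (c + 2 * t + v)"
      using mut by (simp add: Y_def algebra_simps)
    finally have "norm (w' + of_real u) \<le> lam j * (c + 2 * t + v)" by simp
    moreover have "norm (w' + of_real u) > 0" using Y by (auto simp: w'_def complex_eq_iff)
    moreover have cpos: "c + 2 * t + v > 0" using c t by simp
    ultimately have "ln (norm (w' + of_real u)) \<le> ln (lam j * (c + 2 * t + v))"
      using l by (intro ln_mono) auto
    also have "\<dots> = ln (lam j) + ln (c + 2 * t + v)" using l cpos by (simp add: ln_mult)
    finally have "ln (norm (w' + of_real u)) \<le> ln (lam j) + ln (c + 2 * t + v)" .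
    with 1 have "Re (Digamma (w' + of_real u)) \<le> ln (lam j) + ln (c + 2 * t + v) + pi / (lam j * t)" by linarith
    then have "x * Re (Digamma (w' + of_real u)) \<le> x * (ln (lam j) + ln (c + 2 * t + v) + pi / (lam j * t))"
      using x by (intro mult_left_mono) auto
    also have "\<dots> = 2 * P * lam j * ln (lam j) + 2 * P * lam j * ln (c + 2 * t + v) + 2 * pi * P / t"
      using l t by (simp add: x_def field_simps)
    finally have "ln (norm (Gamma (w' + of_real x) * rGamma w'))
        \<le> 2 * P * lam j * ln (lam j) + 2 * P * lam j * ln (c + 2 * t + v) + 2 * pi * P / t"
      unfolding eq .
    moreover have "norm (Gamma (w' + of_real x) * rGamma w') > 0"
    proof -
      have "w' + of_real x \<notin> \<int>\<^sub>\<le>\<^sub>0"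
        by (rule not_nonpos_Int_if_Im_nonzero) (use Y in \<open>simp add: w'_def\<close>)
      moreover have "w' \<notin> \<int>\<^sub>\<le>\<^sub>0"
        by (rule not_nonpos_Int_if_Im_nonzero) (use Y in \<open>simp add: w'_def\<close>)
      ultimately show ?thesis by (simp add: Gamma_eq_zero_iff rGamma_eq_zero_iff)
    qed
    ultimately show ?thesis using exp_ln exp_le_cancel_iff by (metis (no_types, lifting))
  qed
  finally show ?thesis by (simp add: gamma_ratio_def w_def x_def)
qed

lemma norm_L_left_edge_exp:
  assumes s: "Re s = 1 - c" and t: "\<bar>Im s\<bar> \<le> t + v" "t > 0" "v \<ge> 0"
    and mut: "\<And>j. j \<in> {1..f} \<Longrightarrow> 2 * norm (mu j) \<le> lam j * t"
  shows "norm (L s) \<le> 3 / 2 * exp (P * \<Lambda> + d * P * ln (c + 2 * t + v) + 2 * pi * P * real f / t)"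
proof -
  have "(\<Prod>j\<in>{1..f}. gamma_ratio s j)
      \<le> (\<Prod>j\<in>{1..f}. exp (2 * P * lam j * ln (lam j) + 2 * P * lam j * ln (c + 2 * t + v) + 2 * pi * P / t))"
    by (intro prod_mono conjI gamma_ratio_le s t mut) (auto simp: gamma_ratio_def)
  also have "\<dots> = exp (\<Sum>j\<in>{1..f}. 2 * P * lam j * ln (lam j) + 2 * P * lam j * ln (c + 2 * t + v) + 2 * pi * P / t)"
    by (simp add: exp_sum)
  also have "(\<Sum>j\<in>{1..f}. 2 * P * lam j * ln (lam j) + 2 * P * lam j * ln (c + 2 * t + v) + 2 * pi * P / t)
      = P * (\<Sum>j\<in>{1..f}. 2 * lam j * ln (lam j)) + d * P * ln (c + 2 * t + v) + 2 * pi * P * real f / t"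
    by (simp add: sum.distrib d_def degree_L_def sum_distrib_left sum_distrib_right mult_ac)
  finally have "norm (L s) \<le> 3 / 2 * Q powr (2 * P) * exp (P * (\<Sum>j\<in>{1..f}. 2 * lam j * ln (lam j))
      + d * P * ln (c + 2 * t + v) + 2 * pi * P * real f / t)"
    by (intro order_trans[OF norm_L_left_edge[OF s]] mult_left_mono) auto
  also have "\<dots> = 3 / 2 * exp (P * \<Lambda> + d * P * ln (c + 2 * t + v) + 2 * pi * P * real f / t)"
    using Q by (simp add: \<Lambda>_eq powr_def exp_add[symmetric] algebra_simps)
  finally show ?thesis .
qed

text \<open>The first \<open>d * P\<close> is the price of the Gaussian: one half bounds its size
  across the strip, the other comes from completing a square. The remainder is the exponent of the
  left edge at \<open>v = 0\<close>, with the positive part of \<open>\<Lambda>\<close> so that the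
  right edge is covered too.\<close>

definition growth :: "real \<Rightarrow> real" where
  "growth t = d * P + P * max 0 \<Lambda> + d * P * ln (c + 2 * t) + 2 * pi * P * real f / t"

text \<open>Phragmen-Lindelof for \<open>((s - 1) / (s - p)) ^ k * L s\<close> with \<open>p = 2 * c - 1\<close>, damped by a Gaussian
  centred at the point of interest, so that the edges matter only near the height of that point.
  The rate \<open>d / (8 * P)\<close> of the Gaussian keeps the loss linear in the degree.\<close>

lemma norm_L_strip:
  assumes s0: "1 - c \<le> Re s0" "Re s0 \<le> c" "Im s0 \<ge> 2 * (c - 1)"
    and mut: "\<And>j. j \<in> {1..f} \<Longrightarrow> 2 * norm (mu j) \<le> lam j * Im s0"
  shows "norm (L s0) \<le> 3 / 2 * 2 ^ k * exp (growth (Im s0))"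
proof -
  define t where "t = Im s0"
  \<comment> \<open>The mirror image of 1 in the line \<open>Re s = c\<close>; hence
    \<open>norm (z - 1) \<le> norm (z - p)\<close> throughout the strip, and removing the pole does
    not enlarge the edge bounds.\<close>
  define p where "p = complex_of_real (2 * c - 1)"
  define \<epsilon> where "\<epsilon> = d / (8 * P)"
  define M where "M = 3 / 2 * exp (growth t)"
  have t: "t \<ge> 4" using s0 c by (simp add: t_def)
  have \<epsilon>: "\<epsilon> \<ge> 0" using d_nonneg P_ge by (simp add: \<epsilon>_def)
  have \<epsilon>P: "\<epsilon> * (2 * P)\<^sup>2 = d * P / 2" using P_ge by (simp add: \<epsilon>_def power2_eq_square)
  obtain G where G: "G holomorphic_on UNIV" "finite_order G" "\<And>s. s \<noteq> 1 \<Longrightarrow> G s = (s - 1) ^ k * L s"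
    using entire by blast
  define F where "F = (\<lambda>z. G z / (z - p) ^ k * exp (of_real \<epsilon> * (z - s0)\<^sup>2))"
  have p_far: "norm (z - p) \<ge> c - 1" if "Re z \<le> c" for z
    using that c abs_Re_le_cmod[of "z - p"] by (simp add: p_def)
  have norm_exp: "norm (exp (of_real \<epsilon> * (z - s0)\<^sup>2)) \<le> exp (d * P / 2 - \<epsilon> * (Im z - t)\<^sup>2)"
    if "1 - c \<le> Re z" "Re z \<le> c" for z
  proof -
    have "(Re z - Re s0)\<^sup>2 \<le> (2 * P)\<^sup>2"
      using that s0 by (intro abs_le_square_iff[THEN iffD1]) (auto simp: P_def abs_le_iff)
    then have "\<epsilon> * (Re z - Re s0)\<^sup>2 \<le> d * P / 2"
      using \<epsilon> mult_left_mono unfolding \<epsilon>P[symmetric] by blast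
    then show ?thesis by (simp add: t_def Re_power2 algebra_simps)
  qed
  have norm_F: "norm (F z) \<le> norm (L z) * norm (exp (of_real \<epsilon> * (z - s0)\<^sup>2))"
    if "Re z \<le> c" "z \<noteq> 1" for z
  proof -
    have zp: "norm (z - p) > 0" using p_far[OF that(1)] c by linarith
    have "(norm (z - 1))\<^sup>2 \<le> (norm (z - p))\<^sup>2"
    proof -
      have "0 \<le> (c - Re z) * (4 * (c - 1))" using that c by simp
      then have "(Re z - 1)\<^sup>2 \<le> (Re z - (2 * c - 1))\<^sup>2" by (simp add: power2_eq_square algebra_simps)
      then show ?thesis by (simp add: cmod_power2 p_def)
    qed
    then have "norm (z - 1) \<le> norm (z - p)" by (rule power2_le_imp_le) simp
    then have "(norm (z - 1) / norm (z - p)) ^ k \<le> 1 ^ k"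
      using zp by (intro power_mono) auto
    then have "norm (L z) * (norm (z - 1) / norm (z - p)) ^ k \<le> norm (L z) * 1"
      by (intro mult_left_mono) auto
    then have "norm (G z / (z - p) ^ k) \<le> norm (L z)"
      by (simp add: G(3)[OF that(2)] norm_mult norm_divide norm_power power_divide mult.commute)
    then show ?thesis unfolding F_def norm_mult by (rule mult_right_mono) simp
  qed
  have ln_nonneg: "ln (c + 2 * t) \<ge> 0" using c t by simp
  obtain r0 N0 where growth_G: "\<And>z. norm z \<ge> N0 \<Longrightarrow> norm (G z) \<le> exp (norm z powr r0)"
    using G(2) by (auto simp: finite_order_def eventually_at_infinity)
  have "norm (F s0) \<le> M"
  proof (rule phragmen_lindelof_strip[where F = F and ?z0.0 = s0 and \<alpha> = "1 - c" and \<beta> = c and r = "max r0 1 + 1"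
        and N = "max N0 (1 + d * P / 2)"])
    have zp: "z \<noteq> p" if "Re z \<le> c" for z using p_far[OF that] c by auto
    have "F holomorphic_on {z. Re z \<le> c}"
      unfolding F_def by (intro holomorphic_intros holomorphic_on_subset[OF G(1)]) (use zp in auto)
    then show "F holomorphic_on {z. 1 - c < Re z \<and> Re z < c}"
      and "continuous_on {z. 1 - c \<le> Re z \<and> Re z \<le> c} F"
      by (auto intro: holomorphic_on_subset continuous_on_subset[OF holomorphic_on_imp_continuous_on])
    show "M > 0" by (simp add: M_def)
  next
    fix z :: complex assume z: "Re z = 1 - c \<or> Re z = c"
    then have z': "Re z \<le> c" "1 - c \<le> Re z" "z \<noteq> 1" using c by auto
    show "norm (F z) \<le> M"
    proof (cases "Re z = c")
      case True
      have "norm (F z) \<le> 3 / 2 * exp (d * P / 2 - \<epsilon> * (Im z - t)\<^sup>2)"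
        by (rule order_trans[OF norm_F[OF z'(1,3)]], intro mult_mono norm_L_right norm_exp z')
           (use True in auto)
      also have "\<dots> \<le> 3 / 2 * exp (growth t)"
      proof -
        have "0 \<le> \<epsilon> * (Im z - t)\<^sup>2" "0 \<le> d * P" "0 \<le> P * max 0 \<Lambda>" "0 \<le> d * P * ln (c + 2 * t)" "0 \<le> 2 * pi * P * real f / t"
          using \<epsilon> d_nonneg P_ge ln_nonneg t by auto
        then show ?thesis by (simp add: growth_def)
      qed
      finally show ?thesis by (simp add: M_def)
    next
      case False
      then have zl: "Re z = 1 - c" using z by simp
      define v where "v = \<bar>Im z - t\<bar>"
      have v: "v \<ge> 0" "\<bar>Im z\<bar> \<le> t + v" using t by (auto simp: v_def)
      have "norm (L z) \<le> 3 / 2 * exp (P * \<Lambda> + d * P * ln (c + 2 * t + v) + 2 * pi * P * real f / t)"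
        using zl v t mut by (intro norm_L_left_edge_exp) (auto simp: t_def)
      then have "norm (F z) \<le> 3 / 2 * exp (P * \<Lambda> + d * P * ln (c + 2 * t + v) + 2 * pi * P * real f / t)
          * exp (d * P / 2 - \<epsilon> * (Im z - t)\<^sup>2)"
        by (intro order_trans[OF norm_F[OF z'(1,3)]] mult_mono norm_exp z') auto
      also have "\<dots> = 3 / 2 * exp (P * \<Lambda> + d * P * ln (c + 2 * t + v) + 2 * pi * P * real f / t
          + (d * P / 2 - \<epsilon> * v\<^sup>2))"
        by (simp add: exp_add v_def)
      also have "\<dots> \<le> M"
      proof -
        define B where "B = c + 2 * t"
        have B: "B \<ge> 2 * P" "B > 0" using c s0 by (auto simp: B_def P_def t_def)
        have "B + v = B * (1 + v / B)" using B by (simp add: field_simps)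
        moreover have "1 + v / B > 0" using B v by (simp add: add_pos_nonneg)
        ultimately have "ln (B + v) = ln B + ln (1 + v / B)" using B by (simp add: ln_mult)
        also have "ln (1 + v / B) \<le> v / B" using B v by (intro ln_add_one_self_le_self) auto
        also have "v / B \<le> v / (2 * P)" using B v P_ge by (intro divide_left_mono) auto
        finally have "d * P * ln (B + v) \<le> d * P * (ln B + v / (2 * P))"
          using d_nonneg P_ge by (intro mult_left_mono) auto
        also have "\<dots> = d * P * ln B + d * v / 2" using P_ge by (simp add: field_simps)
        finally have 1: "d * P * ln (B + v) \<le> d * P * ln B + d * v / 2" .
        \<comment> \<open>The Gaussian exponent \<open>\<epsilon> * v\<^sup>2\<close> beats the
          linear term \<open>d * v / 2\<close>, which arose from
          \<open>ln (B + v) \<le> ln B + v / (2 * P)\<close>.\<close>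
        have "0 \<le> d * ((v - 2 * P)\<^sup>2 / (8 * P))" using d_nonneg P_ge by simp
        also have "\<dots> = \<epsilon> * v\<^sup>2 - d * v / 2 + d * P / 2"
          using P_ge by (simp add: \<epsilon>_def field_simps power2_eq_square)
        finally have 2: "d * v / 2 \<le> \<epsilon> * v\<^sup>2 + d * P / 2" by simp
        have "P * \<Lambda> \<le> P * max 0 \<Lambda>" using P_ge by (intro mult_left_mono) auto
        with 1 2 show ?thesis unfolding M_def growth_def B_def by simp
      qed
      finally show ?thesis .
    qed
  next
    fix z :: complex
    assume z: "1 - c \<le> Re z" "Re z \<le> c" "norm z \<ge> max N0 (1 + d * P / 2)"
    define n where "n = norm z"
    have n1: "n \<ge> 1" using z d_nonneg P_ge by (auto simp: n_def intro: order_trans[rotated])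
    have "norm (F z) \<le> exp (n powr r0) * exp (d * P / 2)"
    proof -
      have "norm (G z / (z - p) ^ k) \<le> norm (G z)"
      proof -
        have "1 ^ k \<le> norm (z - p) ^ k" using p_far[OF z(2)] c by (intro power_mono) auto
        then show ?thesis
          using divide_left_mono[of 1 "norm (z - p) ^ k" "norm (G z)"] by (simp add: norm_divide norm_power)
      qed
      also have "\<dots> \<le> exp (n powr r0)" using growth_G[of z] z by (simp add: n_def)
      finally have 1: "norm (G z / (z - p) ^ k) \<le> exp (n powr r0)" .
      have "exp (d * P / 2 - \<epsilon> * (Im z - t)\<^sup>2) \<le> exp (d * P / 2)" using \<epsilon> by simp
      then have 2: "norm (exp (of_real \<epsilon> * (z - s0)\<^sup>2)) \<le> exp (d * P / 2)"
        using norm_exp[OF z(1,2)] by linarith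
      show ?thesis unfolding F_def norm_mult by (intro mult_mono 1 2) auto
    qed
    also have "\<dots> \<le> exp (n powr (max r0 1 + 1))"
    proof -
      \<comment> \<open>One additional power of \<open>n \<ge> 1 + d * P / 2\<close> absorbs the
        constant \<open>exp (d * P / 2)\<close>.\<close>
      have "n powr r0 + d * P / 2 \<le> n powr max r0 1 + n powr max r0 1 * (d * P / 2)"
      proof (intro add_mono)
        show "n powr r0 \<le> n powr max r0 1" using n1 by (intro powr_mono) auto
        have "1 \<le> n powr max r0 1" using n1 by (intro ge_one_powr_ge_zero) auto
        then show "d * P / 2 \<le> n powr max r0 1 * (d * P / 2)"
          using d_nonneg P_ge mult_right_mono[of 1 "n powr max r0 1" "d * P / 2"] by simp
      qed
      also have "\<dots> = n powr max r0 1 * (1 + d * P / 2)" by (simp add: algebra_simps)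
      also have "\<dots> \<le> n powr max r0 1 * n" using z by (intro mult_left_mono) (auto simp: n_def)
      also have "\<dots> = n powr (max r0 1 + 1)" using n1 by (simp add: powr_add)
      finally show ?thesis by (simp add: exp_add[symmetric])
    qed
    finally show "norm (F z) \<le> exp (norm z powr (max r0 1 + 1))" by (simp add: n_def)
  qed (use s0 c in auto)
  have s1: "s0 \<noteq> 1" using t by (auto simp: t_def)
  have n1: "norm (s0 - 1) \<ge> t" using abs_Im_le_cmod[of "s0 - 1"] t by (simp add: t_def)
  then have n1': "norm (s0 - 1) > 0" using t by linarith
  have sp: "norm (s0 - p) > 0" using p_far[OF s0(2)] c by linarith
  \<comment> \<open>Since \<open>norm (1 - p) = 2 * (c - 1)\<close> is at most the height of
    \<open>s0\<close>, undoing the pole factor costs at most 2 for each of the \<open>k\<close>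
    powers.\<close>
  have "norm (s0 - p) \<le> norm (s0 - 1) + norm (1 - p)"
    using norm_triangle_ineq[of "s0 - 1" "1 - p"] by simp
  also have "norm (1 - p) = 2 * (c - 1)"
  proof -
    have "1 - p = of_real (- (2 * (c - 1)))" by (simp add: p_def)
    then have "norm (1 - p) = \<bar>- (2 * (c - 1))\<bar>" by (simp only: norm_of_real)
    then show ?thesis using c by simp
  qed
  finally have "norm (s0 - p) / norm (s0 - 1) \<le> 2"
    using n1 n1' s0(3) by (simp add: t_def divide_le_eq)
  then have pk: "(norm (s0 - p) / norm (s0 - 1)) ^ k \<le> 2 ^ k" by (intro power_mono) auto
  have "norm (L s0) = norm (F s0) * (norm (s0 - p) / norm (s0 - 1)) ^ k"
    using n1' sp by (simp add: F_def G(3)[OF s1] norm_mult norm_divide norm_power power_divide)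
  also have "\<dots> \<le> M * 2 ^ k" using \<open>norm (F s0) \<le> M\<close> pk by (intro mult_mono) (auto simp: M_def)
  finally show ?thesis by (simp add: M_def t_def mult_ac)
qed

end

section \<open>Argument variation along horizontal lines\<close>

lemma vector_derivative_along_linepath:
  fixes g :: "complex \<Rightarrow> complex"
  assumes "g holomorphic_on S" "open S" "closed_segment p q \<subseteq> S" "x \<in> {0..1}"
  shows "((\<lambda>x. g (linepath p q x)) has_vector_derivative deriv g (linepath p q x) * (q - p)) (at x within {0..1})"
proof -
  have "linepath p q x \<in> S" using assms(3,4) by (auto simp: linepath_in_path[THEN subsetD[OF assms(3)]])
  then have "(g has_field_derivative deriv g (linepath p q x)) (at (linepath p q x) within linepath p q ` {0..1})"
    using holomorphic_derivI[OF assms(1,2)] by (auto intro: has_field_derivative_at_within)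
  from field_vector_diff_chain_within[OF has_vector_derivative_linepath_within this]
  show ?thesis by (simp add: o_def mult.commute)
qed

lemma Im_contour_integral_logderiv:
  fixes g :: "complex \<Rightarrow> complex"
  assumes g: "g holomorphic_on S" "open S" "closed_segment p q \<subseteq> S"
    and nz: "\<And>z. z \<in> closed_segment p q \<Longrightarrow> g z \<noteq> 0"
    and fin: "finite {x\<in>{0<..<1}. Re (g (linepath p q x)) = 0}"
  shows "\<bar>Im (contour_integral (linepath p q) (\<lambda>z. deriv g z / g z))\<bar>
           \<le> pi * (real (card {x\<in>{0<..<1}. Re (g (linepath p q x)) = 0}) + 1)"
proof -
  have "contour_integral (linepath p q) (\<lambda>z. deriv g z / g z)
      = integral {0..1} (\<lambda>x. (deriv g (linepath p q x) * (q - p)) / g (linepath p q x))"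
    by (simp add: contour_integral_integral)
  moreover have "\<bar>Im (integral {0..1} (\<lambda>x. (deriv g (linepath p q x) * (q - p)) / g (linepath p q x)))\<bar>
      \<le> pi * (real (card {x\<in>{0<..<1}. Re (g (linepath p q x)) = 0}) + 1)"
  proof (rule arg_variation_zero_count)
    show "((\<lambda>x. g (linepath p q x)) has_vector_derivative deriv g (linepath p q x) * (q - p)) (at x within {0..1})"
      if "x \<in> {0..1}" for x using vector_derivative_along_linepath[OF g that] .
    have "continuous_on (closed_segment p q) (deriv g)"
      using holomorphic_on_imp_continuous_on[OF holomorphic_deriv[OF g(1,2)]] g(3) by (rule continuous_on_subset)
    then have "continuous_on {0..1} (\<lambda>x. deriv g (linepath p q x))"
      by (rule continuous_on_compose2) (auto intro: continuous_on_linepath linepath_in_path)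
    then show "continuous_on {0..1} (\<lambda>x. deriv g (linepath p q x) * (q - p))"
      by (intro continuous_intros)
    show "g (linepath p q x) \<noteq> 0" if "x \<in> {0..1}" for x
      by (rule nz) (rule linepath_in_path[OF that])
  qed (use fin in auto)
  ultimately show ?thesis by simp
qed

context functional_equation
begin

text \<open>Logarithm of a bound for \<open>2 * norm (L w)\<close> on the disc of radius
  \<open>2 * P\<close> about \<open>c + i T\<close>: it takes the worst case of
  \<open>growth\<close> over the heights from \<open>T - 2 * P \<ge> (T - 1) / 2\<close> to
  \<open>T + 2 * P\<close>. The factor 2 offsets the lower bound \<open>1 / 2\<close> at the centre
  in Jensen's inequality.\<close>

definition horizontal_bound :: "real \<Rightarrow> real" where
  "horizontal_bound T = ln 3 + real k * ln 2 + d * P + P * max 0 \<Lambda> + d * P * ln (4 * T) + 4 * pi * P * real f / (T - 1)"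

lemma norm_L_disc:
  assumes T: "T \<ge> 4 * P - 1" and mut: "\<And>j. j \<in> {1..f} \<Longrightarrow> 2 * norm (mu j) \<le> lam j * (T - 2 * P)"
    and w: "1 - c \<le> Re w" "\<bar>Im w - T\<bar> \<le> 2 * P"
  shows "norm (L w) \<le> exp (horizontal_bound T) / 2"
proof -
  have pos: "0 \<le> d * P" "0 \<le> P * max 0 \<Lambda>" "0 \<le> d * P * ln (4 * T)" "0 \<le> 4 * pi * P * real f / (T - 1)"
    using d_nonneg P_ge T by auto
  have hb: "3 / 2 * 2 ^ k * exp x \<le> exp (horizontal_bound T) / 2"
    if "x \<le> d * P + P * max 0 \<Lambda> + d * P * ln (4 * T) + 4 * pi * P * real f / (T - 1)" for x
  proof -
    have "3 * 2 ^ k * exp x = exp (ln 3 + real k * ln 2 + x)"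
      by (simp add: exp_add exp_of_nat_mult)
    also have "\<dots> \<le> exp (horizontal_bound T)" using that by (simp add: horizontal_bound_def)
    finally show ?thesis by (simp add: mult_ac)
  qed
  show ?thesis
  proof (cases "Re w \<ge> c")
    case True
    have "norm (L w) \<le> 3 / 2" by (rule norm_L_right[OF True])
    also have "\<dots> \<le> 3 / 2 * 2 ^ k * exp 0" by simp
    also have "\<dots> \<le> exp (horizontal_bound T) / 2" by (rule hb) (use pos in linarith)
    finally show ?thesis .
  next
    case False
    have t: "Im w \<ge> T - 2 * P" "Im w \<le> T + 2 * P" using w(2) by linarith+
    have "norm (L w) \<le> 3 / 2 * 2 ^ k * exp (growth (Im w))"
    proof (rule norm_L_strip)
      show "Im w \<ge> 2 * (c - 1)" using t(1) T by (simp add: P_def)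
      show "2 * norm (mu j) \<le> lam j * Im w" if "j \<in> {1..f}" for j
        using mut[OF that] mult_left_mono[OF t(1), of "lam j"] lam[OF that] by linarith
    qed (use w False in auto)
    also have "\<dots> \<le> exp (horizontal_bound T) / 2"
    proof (rule hb)
      have "T - 2 * P \<ge> (T - 1) / 2" using T by (simp add: field_simps)
      then have t': "Im w \<ge> (T - 1) / 2" using t(1) by (rule order_trans)
      have T9: "T \<ge> 9" using T P_ge by linarith
      have "(T - 1) / 2 > 0" using T9 by simp
      then have t0: "Im w > 0" using t' by (rule less_le_trans)
      have c': "c = P + 1 / 2" by (simp add: P_def)
      have "c + 2 * Im w \<le> 4 * T" using t(2) T P_ge c' by linarith
      moreover have "c + 2 * Im w > 0" using c t0 by linarith
      ultimately have "ln (c + 2 * Im w) \<le> ln (4 * T)" by (intro ln_mono) auto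
      then have 1: "d * P * ln (c + 2 * Im w) \<le> d * P * ln (4 * T)"
        using pos by (intro mult_left_mono) auto
      have "2 * pi * P * real f / Im w \<le> 2 * pi * P * real f / ((T - 1) / 2)"
        using t' T9 t0 P_ge by (intro divide_left_mono) auto
      also have "\<dots> = 4 * pi * P * real f / (T - 1)" by simp
      finally show "growth (Im w) \<le> d * P + P * max 0 \<Lambda> + d * P * ln (4 * T) + 4 * pi * P * real f / (T - 1)"
        using 1 by (simp add: growth_def)
    qed
    finally show ?thesis .
  qed
qed

text \<open>Backlund's device: on the line \<open>Im s = T\<close> the function \<open>Re L\<close> is the restriction of a
  holomorphic function, whose zeros are counted by Jensen's inequality on the disc of radius \<open>2 * P\<close>
  about \<open>c\<close>.\<close>

lemma Re_L_zeros:
  fixes T :: real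
  defines "Z \<equiv> {x\<in>{1/2<..<c}. Re (L (Complex x T)) = 0}"
  assumes T: "T \<ge> 4 * P - 1" and mut: "\<And>j. j \<in> {1..f} \<Longrightarrow> 2 * norm (mu j) \<le> lam j * (T - 2 * P)"
  shows "finite Z" and "real (card Z) * ln 2 \<le> horizontal_bound T"
proof -
  \<comment> \<open>In the coordinate shifted by \<open>i T\<close> the possible pole sits at
    \<open>1 - i T\<close>, just outside this strip, which is symmetric in the real axis as
    conjugation requires.\<close>
  define U where "U = {z. \<bar>Im z\<bar> < T}"
  define H where "H = (\<lambda>z. L (z + of_real T * \<i>))"
  define g where "g = (\<lambda>z. (H z + (cnj \<circ> H \<circ> cnj) z) / 2)"
  have T9: "T \<ge> 9" using T P_ge by linarith
  have U_eq: "U = {z. Im z > - T} \<inter> {z. Im z < T}" by (auto simp: U_def abs_less_iff)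
  have U: "open U" "convex U" "connected U"
    unfolding U_eq by (auto intro!: open_Int convex_Int open_halfspace_Im_gt open_halfspace_Im_lt
        convex_halfspace_Im_gt convex_halfspace_Im_lt convex_connected)
  have cnjU: "cnj ` U = U" unfolding image_cnj_conv_vimage_cnj by (auto simp: U_def)
  have "H holomorphic_on U"
  proof -
    have "(L \<circ> (\<lambda>z. z + of_real T * \<i>)) holomorphic_on U"
      by (intro holomorphic_on_compose holomorphic_intros holomorphic_on_subset[OF holomorphic_L])
         (auto simp: U_def complex_eq_iff)
    then show ?thesis by (simp add: H_def o_def)
  qed
  moreover from this have "(cnj \<circ> H \<circ> cnj) holomorphic_on U"
    by (intro holomorphic_on_compose_cnj_cnj U) (simp add: cnjU)
  ultimately have holg: "g holomorphic_on U" unfolding g_def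
    by (intro holomorphic_on_divide holomorphic_on_add holomorphic_on_const) (assumption | simp)+
  have g_real: "g (of_real x) = of_real (Re (L (Complex x T)))" for x
    by (simp add: g_def H_def complex_eq_iff Complex_eq mult.commute)
  have gc: "norm (g (of_real c)) \<ge> 1 / 2"
    using near_one[of "Complex c T"] abs_Re_le_cmod[of "L (Complex c T) - 1"] unfolding g_real by auto
  have Zg: "of_real ` Z \<subseteq> {z\<in>cball (of_real c) P. g z = 0}"
    by (auto simp: Z_def g_real dist_norm P_def simp flip: of_real_diff)
  have cball_U: "cball (of_real c) (2 * P) \<subseteq> U"
  proof
    fix z :: complex assume "z \<in> cball (of_real c) (2 * P)"
    then have "\<bar>Im (z - of_real c)\<bar> \<le> 2 * P"
      using abs_Im_le_cmod[of "z - of_real c"] by (simp add: dist_norm norm_minus_commute)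
    then show "z \<in> U" using T P_ge by (simp add: U_def)
  qed
  have finZ': "finite (complex_of_real ` Z)"
  proof (cases "g constant_on U")
    case True
    have "of_real x \<in> U" for x using T9 by (simp add: U_def)
    then have "g (of_real x) \<noteq> 0" for x using True gc by (force simp: constant_on_def)
    then show ?thesis using Zg by (metis (mono_tags, lifting) empty_iff finite.emptyI image_subset_iff mem_Collect_eq subsetI subset_antisym)
  next
    case False
    have "finite {z\<in>cball (of_real c) P. g z = 0}"
      using cball_U P_ge by (intro holomorphic_compact_finite_zeros[OF holg U(1,3) _ _ False])
        (auto intro: subset_trans[rotated] subset_cball)
    then show ?thesis by (rule finite_subset[OF Zg])
  qed
  then show "finite Z" by (rule finite_imageD) (auto intro: inj_onI)
  have "norm (g (of_real c)) * (2 * P / P) ^ card (complex_of_real ` Z) \<le> exp (horizontal_bound T) / 2"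
  proof (rule jensen_zero_count[OF finZ' holg U(1) cball_U])
    show "0 < P" "P < 2 * P" using P_ge by auto
    show "g z = 0 \<and> dist (of_real c) z \<le> P" if "z \<in> of_real ` Z" for z using that Zg by auto
  next
    fix z :: complex assume "dist (of_real c) z = 2 * P"
    then have z: "norm (z - of_real c) = 2 * P" by (simp add: dist_norm norm_minus_commute)
    have b: "norm (L w) \<le> exp (horizontal_bound T) / 2" if "Re w = Re z" "\<bar>Im w - T\<bar> = \<bar>Im z\<bar>" for w
    proof (rule norm_L_disc[OF T mut])
      have "\<bar>Re z - c\<bar> \<le> 2 * P" using abs_Re_le_cmod[of "z - of_real c"] z by simp
      then show "1 - c \<le> Re w" using that by (simp add: P_def)
      show "\<bar>Im w - T\<bar> \<le> 2 * P" using abs_Im_le_cmod[of "z - of_real c"] z that by simp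
    qed
    have "norm (H z + cnj (H (cnj z))) \<le> norm (H z) + norm (H (cnj z))"
      using norm_triangle_ineq[of "H z" "cnj (H (cnj z))"] by simp
    also have "\<dots> \<le> exp (horizontal_bound T) / 2 + exp (horizontal_bound T) / 2"
      unfolding H_def by (intro add_mono b) auto
    finally show "norm (g z) \<le> exp (horizontal_bound T) / 2" by (simp add: g_def norm_divide)
  qed
  also have "card (complex_of_real ` Z) = card Z" by (intro card_image) (auto intro: inj_onI)
  finally have "norm (g (of_real c)) * 2 ^ card Z \<le> exp (horizontal_bound T) / 2" using P_ge by simp
  moreover have "1 / 2 * 2 ^ card Z \<le> norm (g (of_real c)) * 2 ^ card Z"
    using gc by (intro mult_right_mono) auto
  ultimately have "2 ^ card Z \<le> exp (horizontal_bound T)" by linarith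
  then have "exp (real (card Z) * ln 2) \<le> exp (horizontal_bound T)" by (simp add: exp_of_nat_mult)
  then show "real (card Z) * ln 2 \<le> horizontal_bound T" by simp
qed

lemma Im_horizontal_integral:
  assumes T: "T \<ge> 4 * P - 1" and mut: "\<And>j. j \<in> {1..f} \<Longrightarrow> 2 * norm (mu j) \<le> lam j * (T - 2 * P)"
    and nz: "\<And>z. Im z = T \<Longrightarrow> L z \<noteq> 0"
  shows "\<bar>Im (contour_integral (linepath (Complex (1/2) T) (Complex c T)) (\<lambda>z. deriv L z / L z))\<bar>
           \<le> pi * (horizontal_bound T / ln 2 + 1)"
proof -
  let ?p = "Complex (1/2) T" and ?q = "Complex c T"
  define Z where "Z = {x\<in>{1/2<..<c}. Re (L (Complex x T)) = 0}"
  define Z' where "Z' = {x\<in>{0<..<1}. Re (L (linepath ?p ?q x)) = 0}"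
  define \<phi> where "\<phi> = (\<lambda>x::real. 1 / 2 + x * P)"
  have T9: "T \<ge> 9" using T P_ge by linarith
  have lp: "linepath ?p ?q x = Complex (\<phi> x) T" for x
    by (simp add: linepath_def \<phi>_def P_def complex_eq_iff algebra_simps)
  have seg: "closed_segment ?p ?q \<subseteq> {z. Im z = T}" by (auto simp: closed_segment_same_Im)
  have inj: "inj_on \<phi> Z'" using P_ge by (auto intro: inj_onI simp: \<phi>_def)
  have img: "\<phi> ` Z' \<subseteq> Z"
  proof
    fix y assume "y \<in> \<phi> ` Z'"
    then obtain x where x: "0 < x" "x < 1" "Re (L (Complex (\<phi> x) T)) = 0" "y = \<phi> x"
      by (auto simp: Z'_def lp)
    have "0 < x * P" "x * P < P" using x P_ge by auto
    then show "y \<in> Z" using x by (auto simp: Z_def \<phi>_def P_def)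
  qed
  have finZ: "finite Z" and card: "real (card Z) * ln 2 \<le> horizontal_bound T"
    unfolding Z_def using Re_L_zeros[OF T mut] by auto
  have finZ': "finite Z'" by (rule inj_on_finite[OF inj img finZ])
  have "card Z' \<le> card Z" by (rule card_inj_on_le[OF inj img finZ])
  moreover have "real (card Z) \<le> horizontal_bound T / ln 2" using card by (simp add: field_simps)
  moreover have "\<bar>Im (contour_integral (linepath ?p ?q) (\<lambda>z. deriv L z / L z))\<bar> \<le> pi * (real (card Z') + 1)"
    unfolding Z'_def
  proof (rule Im_contour_integral_logderiv[OF holomorphic_L])
    show "closed_segment ?p ?q \<subseteq> - {1}" using seg T9 by force
    show "open (- {1::complex})" by auto
    show "L z \<noteq> 0" if "z \<in> closed_segment ?p ?q" for z using that seg nz by blast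
  qed (use finZ' in \<open>auto simp: Z'_def\<close>)
  ultimately show ?thesis
    by (elim order_trans) (intro mult_left_mono, auto)
qed

text \<open>On \<open>Re s = c\<close> the values of \<open>L\<close> lie within
  \<open>1 / 2\<close> of 1, so the real part has no zero.\<close>

lemma Im_vertical_integral:
  assumes "T\<^sub>0 > 0" "T > 0"
  shows "\<bar>Im (contour_integral (linepath (Complex c T\<^sub>0) (Complex c T)) (\<lambda>z. deriv L z / L z))\<bar> \<le> pi"
proof -
  let ?p = "Complex c T\<^sub>0" and ?q = "Complex c T"
  have seg: "Re z = c" if "z \<in> closed_segment ?p ?q" for z using that by (auto simp: closed_segment_same_Re)
  have pos: "Re (L z) > 0" if "z \<in> closed_segment ?p ?q" for z
    using near_one[of z] abs_Re_le_cmod[of "L z - 1"] seg[OF that] by auto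
  have empty: "{x\<in>{0<..<1}. Re (L (linepath ?p ?q x)) = 0} = {}"
  proof -
    have "Re (L (linepath ?p ?q x)) \<noteq> 0" if "x \<in> {0<..<1}" for x
      using pos[OF linepath_in_path, of x] that by simp
    then show ?thesis by blast
  qed
  have "\<bar>Im (contour_integral (linepath ?p ?q) (\<lambda>z. deriv L z / L z))\<bar>
      \<le> pi * (real (card {x\<in>{0<..<1}. Re (L (linepath ?p ?q x)) = 0}) + 1)"
  proof (rule Im_contour_integral_logderiv[OF holomorphic_L])
    show "closed_segment ?p ?q \<subseteq> - {1}" using seg c by force
    show "open (- {1::complex})" by auto
    show "L z \<noteq> 0" if "z \<in> closed_segment ?p ?q" for z using pos[OF that] by auto
    show "finite {x\<in>{0<..<1}. Re (L (linepath ?p ?q x)) = 0}" unfolding empty by simp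
  qed
  then show ?thesis unfolding empty by simp
qed

end

section \<open>Functional equation for the logarithmic derivative\<close>

context functional_equation
begin

definition gamma_logderiv :: "complex \<Rightarrow> complex" where
  "gamma_logderiv s = of_real (ln Q) + (\<Sum>j\<in>{1..f}. of_real (lam j) * Digamma (of_real (lam j) * s + mu j))"

text \<open>Above height \<open>h\<close> every Gamma argument has positive imaginary part; there
  \<open>completed_L\<close> has no poles and vanishes exactly where \<open>L\<close> does.\<close>

definition gamma_free :: "real \<Rightarrow> bool" where
  "gamma_free h \<longleftrightarrow> h \<ge> 0 \<and> (\<forall>j\<in>{1..f}. norm (mu j) \<le> lam j * h)"

lemma gamma_arg_Im_pos:
  assumes "gamma_free h" "Im s > h" "j \<in> {1..f}"
  shows "Im (of_real (lam j) * s + mu j) > 0"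
proof -
  have "norm (mu j) \<le> lam j * h" using assms by (simp add: gamma_free_def)
  also have "\<dots> < lam j * Im s" using assms lam by simp
  finally show ?thesis using abs_Im_le_cmod[of "mu j"] by simp
qed

lemma gamma_arg_not_pole:
  assumes "gamma_free h" "Im s > h" "j \<in> {1..f}"
  shows "of_real (lam j) * s + mu j \<notin> \<int>\<^sub>\<le>\<^sub>0"
  using gamma_arg_Im_pos[OF assms] by (intro not_nonpos_Int_if_Im_nonzero) simp

lemma holomorphic_gamma_logderiv:
  assumes "gamma_free h" shows "gamma_logderiv holomorphic_on {s. Im s > h}"
proof -
  have "(\<lambda>s. Digamma (of_real (lam j) * s + mu j)) holomorphic_on {s. Im s > h}" if "j \<in> {1..f}" for j
  proof -
    have "(Digamma \<circ> (\<lambda>s. of_real (lam j) * s + mu j)) holomorphic_on {s. Im s > h}"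
      by (intro holomorphic_on_compose holomorphic_on_Polygamma holomorphic_intros)
         (use gamma_arg_not_pole[OF assms _ that] in auto)
    then show ?thesis by (simp add: o_def)
  qed
  then show ?thesis unfolding gamma_logderiv_def by (intro holomorphic_intros)
qed

lemma completed_L_reflect:
  assumes "gamma_free h" "Im s > h"
  shows "completed_L L f Q lam mu s = \<omega> * cnj (completed_L L f Q lam mu (1 - cnj s))"
proof (rule feq)
  have "Im s > 0" using assms by (simp add: gamma_free_def)
  then show "s \<noteq> 0" "s \<noteq> 1" by auto
qed (use gamma_arg_not_pole[OF assms(1), of s] gamma_arg_not_pole[OF assms(1), of "1 - cnj s"] assms(2) in auto)

lemma completed_L_eq_0_iff:
  assumes "gamma_free h" "Im s > h"
  shows "completed_L L f Q lam mu s = 0 \<longleftrightarrow> L s = 0"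
  using gamma_arg_not_pole[OF assms] Q by (auto simp: completed_L_def Gamma_eq_zero_iff)

lemma completed_L_derivative:
  assumes "gamma_free h" "Im s > h" "L s \<noteq> 0"
  shows "(completed_L L f Q lam mu has_field_derivative
           completed_L L f Q lam mu s * (deriv L s / L s + gamma_logderiv s)) (at s)"
proof -
  have s0: "Im s > 0" using assms by (simp add: gamma_free_def)
  define \<Gamma>p where "\<Gamma>p = (\<lambda>s. \<Prod>j\<in>{1..f}. Gamma (of_real (lam j) * s + mu j))"
  have 1: "(L has_field_derivative deriv L s) (at s)"
    by (rule holomorphic_derivI[OF holomorphic_L]) (use s0 in auto)
  have 2: "((\<lambda>s. of_real Q powr s) has_field_derivative of_real (ln Q) * of_real Q powr s) (at s)"
    using has_field_derivative_powr_right[of "of_real Q" s] Q by (simp add: Ln_of_real)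
  have 3: "(\<Gamma>p has_field_derivative \<Gamma>p s * (\<Sum>j\<in>{1..f}. of_real (lam j) * Digamma (of_real (lam j) * s + mu j))) (at s)"
  proof -
    have g: "((\<lambda>s. Gamma (of_real (lam j) * s + mu j)) has_field_derivative
        Gamma (of_real (lam j) * s + mu j) * Digamma (of_real (lam j) * s + mu j) * of_real (lam j)) (at s)"
      if "j \<in> {1..f}" for j
    proof (rule DERIV_chain2[OF has_field_derivative_Gamma])
      show "of_real (lam j) * s + mu j \<notin> \<int>\<^sub>\<le>\<^sub>0" by (rule gamma_arg_not_pole[OF assms(1,2) that])
      show "((\<lambda>s. of_real (lam j) * s + mu j) has_field_derivative of_real (lam j)) (at s)"
        by (auto intro!: derivative_eq_intros)
    qed
    have nz: "Gamma (of_real (lam j) * s + mu j) \<noteq> 0" if "j \<in> {1..f}" for j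
      using gamma_arg_not_pole[OF assms(1,2) that] by (simp add: Gamma_eq_zero_iff)
    have "(\<Gamma>p has_field_derivative \<Gamma>p s * (\<Sum>j\<in>{1..f}. Gamma (of_real (lam j) * s + mu j)
        * Digamma (of_real (lam j) * s + mu j) * of_real (lam j) / Gamma (of_real (lam j) * s + mu j))) (at s)"
      unfolding \<Gamma>p_def by (rule has_field_derivative_prod'[OF nz g])
    also have "(\<Sum>j\<in>{1..f}. Gamma (of_real (lam j) * s + mu j)
        * Digamma (of_real (lam j) * s + mu j) * of_real (lam j) / Gamma (of_real (lam j) * s + mu j))
        = (\<Sum>j\<in>{1..f}. of_real (lam j) * Digamma (of_real (lam j) * s + mu j))"
      by (rule sum.cong) (use nz in auto)
    finally show ?thesis .
  qed
  have "((\<lambda>s. L s * of_real Q powr s * \<Gamma>p s) has_field_derivative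
      L s * of_real Q powr s * \<Gamma>p s * (deriv L s / L s + gamma_logderiv s)) (at s)"
    by (rule derivative_eq_intros 1 2 3 refl)+
       (use assms(3) in \<open>simp add: gamma_logderiv_def field_simps\<close>)
  then show ?thesis unfolding \<Gamma>p_def completed_L_def .
qed

text \<open>Obtained by differentiating the functional equation: conjugating both the argument and
  the value preserves holomorphy, the map \<open>1 - w\<close> contributes the sign, and
  \<open>\<omega>\<close> cancels on division by \<open>completed_L\<close>.\<close>

lemma logderiv_reflect:
  assumes h: "gamma_free h" and s: "Im s > h" "L s \<noteq> 0"
  shows "deriv L (1 - cnj s) / L (1 - cnj s) + gamma_logderiv (1 - cnj s)
           = - cnj (deriv L s / L s + gamma_logderiv s)"
proof -
  define H where "H = completed_L L f Q lam mu"
  define Z where "Z = (\<lambda>s. deriv L s / L s + gamma_logderiv s)"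
  have s': "Im (1 - cnj s) > h" using s by simp
  have H0: "H s \<noteq> 0" using completed_L_eq_0_iff[OF h s(1)] s by (simp add: H_def)
  have refl: "H z = \<omega> * cnj (H (1 - cnj z))" if "Im z > h" for z
    using completed_L_reflect[OF h that] by (simp add: H_def)
  have Ls': "L (1 - cnj s) \<noteq> 0"
    using refl[OF s(1)] H0 completed_L_eq_0_iff[OF h s'] by (auto simp: H_def)
  have D: "(H has_field_derivative H s * Z s) (at s)"
    unfolding H_def Z_def by (rule completed_L_derivative[OF h s])
  have D': "(H has_field_derivative H (1 - cnj s) * Z (1 - cnj s)) (at (1 - cnj s))"
    unfolding H_def Z_def by (rule completed_L_derivative[OF h s' Ls'])
  have "((\<lambda>w. H (1 - w)) has_field_derivative - (H (1 - cnj s) * Z (1 - cnj s))) (at (cnj s))"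
    using DERIV_chain2[of H _ "\<lambda>w. 1 - w", OF D' DERIV_diff[OF DERIV_const DERIV_ident]] by simp
  then have "((cnj \<circ> (\<lambda>w. H (1 - w)) \<circ> cnj) has_field_derivative cnj (- (H (1 - cnj s) * Z (1 - cnj s)))) (at s)"
    by (rule has_field_derivative_cnj_cnj)
  then have "((\<lambda>z. \<omega> * cnj (H (1 - cnj z))) has_field_derivative \<omega> * cnj (- (H (1 - cnj s) * Z (1 - cnj s)))) (at s)"
    unfolding o_def by (rule DERIV_cmult)
  then have "(H has_field_derivative \<omega> * cnj (- (H (1 - cnj s) * Z (1 - cnj s)))) (at s)"
    by (rule has_field_derivative_transform_within_open[where S = "{z. Im z > h}"])
       (use s in \<open>simp_all only: mem_Collect_eq refl[symmetric] open_halfspace_Im_gt\<close>)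
  from DERIV_unique[OF D this] have "H s * Z s = \<omega> * cnj (- (H (1 - cnj s) * Z (1 - cnj s)))" .
  also have "\<dots> = - (\<omega> * cnj (H (1 - cnj s))) * cnj (Z (1 - cnj s))"
    by (simp only: complex_cnj_minus complex_cnj_mult mult_minus_left mult_minus_right mult.assoc)
  also have "\<dots> = - H s * cnj (Z (1 - cnj s))" by (simp only: refl[OF s(1), symmetric])
  finally have "H s * Z s = H s * (- cnj (Z (1 - cnj s)))" by simp
  then have "Z s = - cnj (Z (1 - cnj s))" using H0 by (simp only: mult_cancel_left) simp
  then have "Z (1 - cnj s) = - cnj (Z s)" by simp
  then show ?thesis unfolding Z_def .
qed

text \<open>To the right of 1 this is the nonvanishing of the Euler product; the functional equation
  reflects it to the left of 0, and trivial zeros do not reach above \<open>h\<close>.\<close>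

lemma zeros_in_strip:
  assumes h: "gamma_free h" and s: "Im s > h" "L s = 0"
  shows "0 \<le> Re s" "Re s \<le> 1"
proof -
  show "Re s \<le> 1" using nonzero[of s] s by force
  have s': "Im (1 - cnj s) > h" using s by simp
  have "completed_L L f Q lam mu (1 - cnj s) = 0"
    using completed_L_reflect[OF h s'] completed_L_eq_0_iff[OF h s(1)] s(2) by simp
  then have "L (1 - cnj s) = 0" using completed_L_eq_0_iff[OF h s'] by simp
  then show "0 \<le> Re s" using nonzero[of "1 - cnj s"] by force
qed

section \<open>The argument principle on the rectangle\<close>

lemma finite_zeros:
  assumes "compact A" "A \<subseteq> {s. Im s > 0}"
  shows "finite {s\<in>A. L s = 0}"
proof (cases "L constant_on {s. Im s > 0}")
  case True
  have "L (Complex 2 1) \<noteq> 0" by (rule nonzero) simp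
  then have "L s \<noteq> 0" if "Im s > 0" for s using True that unfolding constant_on_def by force
  then have empty: "{s\<in>A. L s = 0} = {}" using assms by auto
  show ?thesis unfolding empty by simp
next
  case False
  show ?thesis
    by (rule holomorphic_compact_finite_zeros[OF holomorphic_on_subset[OF holomorphic_L] _ _ assms False])
       (auto simp: open_halfspace_Im_gt convex_halfspace_Im_gt convex_connected)
qed

text \<open>All zeros above \<open>h\<close> have real part between 0 and 1, away from the vertical
  sides. If the heights \<open>T\<^sub>0\<close> and \<open>T\<close> carry no zero, the contour
  avoids all zeros, and those it encloses are exactly those counted by
  \<open>N_plus\<close>.\<close>

lemma argument_principle_rectangle:
  assumes h: "gamma_free h" and T: "h < T\<^sub>0" "T\<^sub>0 < T"
    and nz: "\<And>z. Im z = T\<^sub>0 \<Longrightarrow> L z \<noteq> 0" "\<And>z. Im z = T \<Longrightarrow> L z \<noteq> 0"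
  shows "contour_integral (rectpath (Complex (1 - c) T\<^sub>0) (Complex c T)) (\<lambda>z. deriv L z / L z)
           = 2 * pi * \<i> * of_nat (N_plus L T\<^sub>0 T)"
proof -
  let ?a1 = "Complex (1 - c) T\<^sub>0" and ?a3 = "Complex c T"
  have T0: "T\<^sub>0 > 0" using T h by (simp add: gamma_free_def)
  have h0: "h \<ge> 0" using h by (simp add: gamma_free_def)
  \<comment> \<open>An open neighbourhood of the rectangle whose closure \<open>A\<close> is compact
    and still above \<open>h\<close>, so that it contains only finitely many zeros.\<close>
  define S where "S = box (Complex (- c) ((h + T\<^sub>0) / 2)) (Complex (c + 1) (T + 1))"
  define A where "A = cbox (Complex (- c) ((h + T\<^sub>0) / 2)) (Complex (c + 1) (T + 1))"
  have SA: "S \<subseteq> A" by (simp add: S_def A_def box_subset_cbox)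
  have A_Im: "Im s > h" "Im s > 0" if "s \<in> A" for s
    using that T h0 by (auto simp: A_def in_cbox_complex_iff)
  define pz where "pz = {w\<in>S. L w = 0 \<or> w \<in> {}}"
  define zs where "zs = {\<rho>. \<rho> \<in> nontrivial_zeros L \<and> T\<^sub>0 < Im \<rho> \<and> Im \<rho> \<le> T}"
  have "finite {s\<in>A. L s = 0}" by (rule finite_zeros) (use A_Im in \<open>auto simp: A_def\<close>)
  then have fin: "finite pz" by (rule finite_subset[rotated]) (use SA in \<open>auto simp: pz_def\<close>)
  have img: "path_image (rectpath ?a1 ?a3) = cbox ?a1 ?a3 - box ?a1 ?a3"
    using T c by (intro path_image_rectpath_cbox_minus_box) auto
  have cS: "cbox ?a1 ?a3 \<subseteq> S"
    using T h0 c by (auto simp: S_def in_box_complex_iff in_cbox_complex_iff)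
  have zs_box: "zs = pz \<inter> box ?a1 ?a3"
  proof (intro set_eqI iffI)
    fix \<rho> assume \<rho>: "\<rho> \<in> zs"
    then have "Im \<rho> \<noteq> T" using nz(2)[of \<rho>] by (auto simp: zs_def nontrivial_zeros_def)
    then have "\<rho> \<in> box ?a1 ?a3" using \<rho> c by (auto simp: zs_def nontrivial_zeros_def in_box_complex_iff)
    moreover from this have "\<rho> \<in> S" using cS box_subset_cbox by blast
    ultimately show "\<rho> \<in> pz \<inter> box ?a1 ?a3" using \<rho> by (auto simp: pz_def zs_def nontrivial_zeros_def)
  next
    fix \<rho> assume \<rho>: "\<rho> \<in> pz \<inter> box ?a1 ?a3"
    then have "L \<rho> = 0" "T\<^sub>0 < Im \<rho>" "Im \<rho> < T" by (auto simp: pz_def in_box_complex_iff)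
    moreover from this have "0 \<le> Re \<rho>" "Re \<rho> \<le> 1" using zeros_in_strip[OF h, of \<rho>] T by auto
    ultimately show "\<rho> \<in> zs" by (auto simp: zs_def nontrivial_zeros_def)
  qed
  have "contour_integral (rectpath ?a1 ?a3) (\<lambda>x. deriv L x * 1 / L x)
      = 2 * pi * \<i> * (\<Sum>p\<in>pz. winding_number (rectpath ?a1 ?a3) p * 1 * zorder L p)"
    unfolding pz_def
  proof (rule argument_principle)
    show "open S" "connected S" by (auto simp: S_def convex_connected convex_box)
    show "L holomorphic_on S - {}"
      by (rule holomorphic_on_subset[OF holomorphic_L]) (use A_Im SA in force)
    show "path_image (rectpath ?a1 ?a3) \<subseteq> S - {w\<in>S. L w = 0 \<or> w \<in> {}}"
    proof
      fix z assume "z \<in> path_image (rectpath ?a1 ?a3)"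
      then have z: "z \<in> cbox ?a1 ?a3" "z \<notin> box ?a1 ?a3" by (auto simp: img)
      have "L z \<noteq> 0"
      proof
        assume 0: "L z = 0"
        have "Im z \<ge> T\<^sub>0" using z by (auto simp: in_cbox_complex_iff)
        then have "0 \<le> Re z" "Re z \<le> 1" using zeros_in_strip[OF h _ 0] T by auto
        moreover have "Im z \<noteq> T\<^sub>0" "Im z \<noteq> T" using nz 0 by auto
        ultimately show False using z c by (auto simp: in_cbox_complex_iff in_box_complex_iff)
      qed
      then show "z \<in> S - {w\<in>S. L w = 0 \<or> w \<in> {}}" using z cS by auto
    qed
    show "\<forall>z. z \<notin> S \<longrightarrow> winding_number (rectpath ?a1 ?a3) z = 0"
      using cS T c by (auto intro!: winding_number_rectpath_outside)
    show "finite {w\<in>S. L w = 0 \<or> w \<in> {}}" using fin by (simp add: pz_def)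
  qed (auto intro: holomorphic_intros)
  also have "(\<Sum>p\<in>pz. winding_number (rectpath ?a1 ?a3) p * 1 * zorder L p) = (\<Sum>p\<in>zs. of_nat (nat (zorder L p)))"
  proof (rule sum.mono_neutral_cong_right[OF fin])
    show "zs \<subseteq> pz" by (auto simp: zs_box)
    show "\<forall>p\<in>pz - zs. winding_number (rectpath ?a1 ?a3) p * 1 * zorder L p = 0"
    proof
      fix p assume p: "p \<in> pz - zs"
      have "p \<notin> cbox ?a1 ?a3"
      proof
        assume pc: "p \<in> cbox ?a1 ?a3"
        have 0: "L p = 0" using p by (simp add: pz_def)
        have "Im p \<ge> T\<^sub>0" using pc by (auto simp: in_cbox_complex_iff)
        then have "0 \<le> Re p" "Re p \<le> 1" using zeros_in_strip[OF h _ 0] T by auto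
        moreover have "Im p \<noteq> T\<^sub>0" "Im p \<noteq> T" using nz 0 by auto
        ultimately have "p \<in> zs" using pc 0 by (auto simp: in_cbox_complex_iff zs_def nontrivial_zeros_def)
        then show False using p by simp
      qed
      then have "winding_number (rectpath ?a1 ?a3) p = 0"
        using T c by (intro winding_number_rectpath_outside) auto
      then show "winding_number (rectpath ?a1 ?a3) p * 1 * zorder L p = 0" by simp
    qed
    fix p assume p: "p \<in> zs"
    then have "winding_number (rectpath ?a1 ?a3) p = 1"
      unfolding zs_box by (intro winding_number_rectpath) auto
    \<comment> \<open>Needed because \<open>N_plus\<close> truncates the order with
      \<open>nat\<close>.\<close>
    moreover have "zorder L p \<ge> 0"
    proof -
      have pI: "Im p > 0" using p T0 by (simp add: zs_def)
      have "L (Complex 2 1) \<noteq> 0" by (rule nonzero) simp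
      then have "\<exists>w\<in>{s. Im s > 0}. L w \<noteq> 0" by (intro bexI[of _ "Complex 2 1"]) auto
      from zorder_exist_zero[OF holomorphic_on_subset[OF holomorphic_L] open_halfspace_Im_gt _ _ this, of p] pI
      show ?thesis by (auto simp: convex_halfspace_Im_gt convex_connected split: if_splits)
    qed
    ultimately show "winding_number (rectpath ?a1 ?a3) p * 1 * zorder L p = of_nat (nat (zorder L p))" by simp
  qed
  also have "\<dots> = of_nat (N_plus L T\<^sub>0 T)" by (simp add: N_plus_def zs_def)
  finally show ?thesis by simp
qed

end

section \<open>Counting zeros by the argument principle\<close>

lemma contour_integral_rectpath:
  assumes "continuous_on (path_image (rectpath a1 a3)) g" "Re a1 \<le> Re a3" "Im a1 \<le> Im a3"
  defines "a2 \<equiv> Complex (Re a3) (Im a1)" and "a4 \<equiv> Complex (Re a1) (Im a3)"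
  shows "contour_integral (rectpath a1 a3) g = contour_integral (linepath a1 a2) g
           + contour_integral (linepath a2 a3) g + contour_integral (linepath a3 a4) g
           + contour_integral (linepath a4 a1) g"
proof -
  have img: "path_image (rectpath a1 a3)
      = closed_segment a1 a2 \<union> closed_segment a2 a3 \<union> closed_segment a3 a4 \<union> closed_segment a4 a1"
    by (auto simp: rectpath_def Let_def a2_def a4_def path_image_join)
  have "g contour_integrable_on linepath a1 a2" "g contour_integrable_on linepath a2 a3"
    "g contour_integrable_on linepath a3 a4" "g contour_integrable_on linepath a4 a1"
    by (intro contour_integrable_continuous_linepath continuous_on_subset[OF assms(1)]; auto simp: img)+
  then show ?thesis
    unfolding rectpath_def Let_def a2_def[symmetric] a4_def[symmetric]
    by (simp add: contour_integral_join contour_integrable_joinI valid_path_join add.assoc)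
qed

text \<open>The reflection replaces the direction of the path, like the integrand, by minus its
  conjugate, and the two signs cancel.\<close>

lemma contour_integral_reflect:
  assumes "\<And>z. z \<in> closed_segment p q \<Longrightarrow> g (1 - cnj z) = - cnj (g z)"
  shows "contour_integral (linepath (1 - cnj p) (1 - cnj q)) g = cnj (contour_integral (linepath p q) g)"
proof -
  have lp: "linepath (1 - cnj p) (1 - cnj q) x = 1 - cnj (linepath p q x)" for x
    by (simp add: linepath_def scaleR_conv_of_real algebra_simps)
  have "contour_integral (linepath (1 - cnj p) (1 - cnj q)) g
      = integral {0..1} (\<lambda>x. g (1 - cnj (linepath p q x)) * (cnj p - cnj q))"
    by (simp add: contour_integral_integral lp)
  also have "\<dots> = integral {0..1} (\<lambda>x. cnj (g (linepath p q x) * (q - p)))"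
    by (rule integral_cong) (simp add: assms[OF linepath_in_path] algebra_simps)
  also have "\<dots> = cnj (contour_integral (linepath p q) g)"
    by (simp add: contour_integral_integral integral_cnj)
  finally show ?thesis .
qed

context functional_equation
begin

text \<open>By the functional equation the logarithmic derivative of \<open>completed_L\<close> changes sign under the
  reflection in the critical line, so the right half of the rectangle carries half of the argument
  variation; there the contribution of the Gamma factors can be moved to the critical line.\<close>

lemma N_plus_identity:
  assumes h: "gamma_free h" and T: "h < T\<^sub>0" "T\<^sub>0 < T"
    and nz: "\<And>z. Im z = T\<^sub>0 \<Longrightarrow> L z \<noteq> 0" "\<And>z. Im z = T \<Longrightarrow> L z \<noteq> 0"
  shows "pi * real (N_plus L T\<^sub>0 T) =
     Im (contour_integral (linepath (Complex (1/2) T\<^sub>0) (Complex c T\<^sub>0)) (\<lambda>z. deriv L z / L z))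
     + Im (contour_integral (linepath (Complex c T\<^sub>0) (Complex c T)) (\<lambda>z. deriv L z / L z))
     - Im (contour_integral (linepath (Complex (1/2) T) (Complex c T)) (\<lambda>z. deriv L z / L z))
     + integral {T\<^sub>0..T} (\<lambda>t. Re (gamma_logderiv (Complex (1/2) t)))"
proof -
  \<comment> \<open>The corners \<open>a1\<close>, \<open>a2\<close>, \<open>a3\<close>,
    \<open>a4\<close> run counterclockwise from the lower left; \<open>m0\<close> and
    \<open>m1\<close> are the midpoints of the bottom and the top, fixed by the reflection.\<close>
  define a1 m0 a2 a3 m1 a4 where pts: "a1 = Complex (1 - c) T\<^sub>0" "m0 = Complex (1/2) T\<^sub>0"
    "a2 = Complex c T\<^sub>0" "a3 = Complex c T" "m1 = Complex (1/2) T" "a4 = Complex (1 - c) T"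
  define F where "F = (\<lambda>z. deriv L z / L z)"
  define Z where "Z = (\<lambda>z. F z + gamma_logderiv z)"
  define IF IK IZ where I_defs: "IF = (\<lambda>p q. contour_integral (linepath p q) F)"
    "IK = (\<lambda>p q. contour_integral (linepath p q) gamma_logderiv)"
    "IZ = (\<lambda>p q. contour_integral (linepath p q) Z)"
  define V where "V = {z. T\<^sub>0 \<le> Im z \<and> Im z \<le> T \<and> (Im z = T\<^sub>0 \<or> Im z = T \<or> Re z = c \<or> Re z = 1 - c)}"
  have T0: "T\<^sub>0 > 0" using T h by (simp add: gamma_free_def)
  have V_Im: "Im z > h" if "z \<in> V" for z using that T by (auto simp: V_def)
  have V_nz: "L z \<noteq> 0" if "z \<in> V" for z
  proof
    assume 0: "L z = 0"
    have "0 \<le> Re z" "Re z \<le> 1" using zeros_in_strip[OF h V_Im[OF that] 0] by auto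
    then show False using that 0 nz c by (auto simp: V_def)
  qed
  have "V \<subseteq> - {1}" using V_Im T h by (force simp: gamma_free_def)
  then have contF: "continuous_on V F"
    unfolding F_def using V_nz
    by (intro continuous_on_divide holomorphic_on_imp_continuous_on holomorphic_on_subset[OF holomorphic_L]
        holomorphic_on_subset[OF holomorphic_deriv[OF holomorphic_L]]) auto
  have contK: "continuous_on {z. Im z > h} gamma_logderiv"
    by (rule holomorphic_on_imp_continuous_on[OF holomorphic_gamma_logderiv[OF h]])
  have contKV: "continuous_on V gamma_logderiv" by (rule continuous_on_subset[OF contK]) (use V_Im in auto)
  have contZ: "continuous_on V Z" unfolding Z_def by (intro continuous_intros contF contKV)
  have segs: "closed_segment p q \<subseteq> V"
    if "(p, q) \<in> {(a1, a2), (a1, m0), (m0, a1), (m0, a2), (a2, a3), (a3, a2), (a3, a4), (a3, m1), (m1, a3), (m1, a4), (a4, a1)}" for p q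
    using that T c by (auto simp: pts V_def closed_segment_same_Re closed_segment_same_Im closed_segment_eq_real_ivl)
  have rect_img: "path_image (rectpath a1 a3) \<subseteq> V"
    using T c by (auto simp: path_image_rectpath pts V_def)
  have IZ_eq: "IZ p q = IF p q + IK p q" if "closed_segment p q \<subseteq> V" for p q
    unfolding I_defs Z_def
    by (intro contour_integral_add contour_integrable_continuous_linepath continuous_on_subset[OF contF]
        continuous_on_subset[OF contKV] that)
  have rev: "IZ p q = - IZ q p" if "closed_segment p q \<subseteq> V" for p q
    unfolding I_defs by (intro contour_integral_reverse_linepath continuous_on_subset[OF contZ] that)
  have revF: "IF p q = - IF q p" if "closed_segment p q \<subseteq> V" for p q
    unfolding I_defs by (intro contour_integral_reverse_linepath continuous_on_subset[OF contF] that)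
  have refl: "IZ (1 - cnj p) (1 - cnj q) = cnj (IZ p q)" if "closed_segment p q \<subseteq> V" for p q
    unfolding I_defs
  proof (rule contour_integral_reflect)
    fix z assume "z \<in> closed_segment p q"
    then have "z \<in> V" using that by auto
    then show "Z (1 - cnj z) = - cnj (Z z)"
      unfolding Z_def F_def by (intro logderiv_reflect[OF h] V_Im V_nz)
  qed
  have rect: "contour_integral (rectpath a1 a3) g = contour_integral (linepath a1 a2) g
      + contour_integral (linepath a2 a3) g + contour_integral (linepath a3 a4) g + contour_integral (linepath a4 a1) g"
    if "continuous_on V g" for g
    using contour_integral_rectpath[OF continuous_on_subset[OF that rect_img]] T c by (simp add: pts)
  have NF: "2 * pi * \<i> * of_nat (N_plus L T\<^sub>0 T) = IF a1 a2 + IF a2 a3 + IF a3 a4 + IF a4 a1"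
    using argument_principle_rectangle[OF h T nz] rect[OF contF] by (simp add: F_def I_defs pts)
  have K0: "contour_integral (rectpath p q) gamma_logderiv = 0"
    if "Im p > h" "Im q > h" "Re p \<le> Re q" "Im p \<le> Im q" for p q
  proof (rule contour_integral_unique[OF Cauchy_theorem_convex_simple[OF holomorphic_gamma_logderiv[OF h]]])
    show "path_image (rectpath p q) \<subseteq> {s. Im s > h}"
      using path_image_rectpath_subset_cbox[OF that(3,4)] that by (force simp: in_cbox_complex_iff)
  qed (auto simp: convex_halfspace_Im_gt)
  have K_full: "0 = IK a1 a2 + IK a2 a3 + IK a3 a4 + IK a4 a1"
    using rect[OF contKV] K0[of a1 a3] T c by (simp add: I_defs pts)
  \<comment> \<open>Cauchy's theorem on the right half of the rectangle:
    \<open>gamma_logderiv\<close> is holomorphic there, so its path from \<open>m0\<close> to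
    \<open>m1\<close> may be deformed to the critical line.\<close>
  have K_half: "0 = IK m0 a2 + IK a2 a3 + IK a3 m1 + IK m1 m0"
  proof -
    have "path_image (rectpath m0 a3) \<subseteq> {s. Im s > h}"
      using T c by (subst path_image_rectpath) (auto simp: pts)
    from contour_integral_rectpath[OF continuous_on_subset[OF contK this]] K0[of m0 a3] T c
    show ?thesis by (simp add: I_defs pts)
  qed
  have K_rev: "IK m1 m0 = - IK m0 m1"
    unfolding I_defs
    by (intro contour_integral_reverse_linepath continuous_on_subset[OF contK])
       (use T in \<open>auto simp: pts closed_segment_same_Re closed_segment_eq_real_ivl\<close>)
  have split: "IZ a1 a2 = IZ a1 m0 + IZ m0 a2" "IZ a3 a4 = IZ a3 m1 + IZ m1 a4"
    unfolding I_defs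
    by (intro contour_integral_split_linepath continuous_on_subset[OF contZ] segs;
        use c in \<open>simp add: pts closed_segment_same_Im closed_segment_eq_real_ivl\<close>)+
  have R: "1 - cnj m0 = m0" "1 - cnj m1 = m1" "1 - cnj a2 = a1" "1 - cnj a3 = a4"
    by (simp_all add: pts complex_eq_iff)
  have refls: "IZ m0 a1 = cnj (IZ m0 a2)" "IZ m1 a4 = cnj (IZ m1 a3)" "IZ a4 a1 = cnj (IZ a3 a2)"
    using refl[OF segs[of m0 a2]] refl[OF segs[of m1 a3]] refl[OF segs[of a3 a2]] by (simp_all add: R)
  have revs: "IZ a1 m0 = - IZ m0 a1" "IZ m1 a3 = - IZ a3 m1" "IZ a3 a2 = - IZ a2 a3"
    by (rule rev[OF segs], simp)+
  define X where "X = IZ m0 a2 + IZ a2 a3 + IZ a3 m1"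
  have "2 * pi * \<i> * of_nat (N_plus L T\<^sub>0 T) = IZ a1 a2 + IZ a2 a3 + IZ a3 a4 + IZ a4 a1"
    using NF K_full IZ_eq[OF segs[of a1 a2]] IZ_eq[OF segs[of a2 a3]] IZ_eq[OF segs[of a3 a4]]
      IZ_eq[OF segs[of a4 a1]] by (simp add: algebra_simps)
  \<comment> \<open>The left half of the boundary contributes \<open>- cnj X\<close>, so only
    \<open>2 * i * Im X\<close> remains.\<close>
  also have "\<dots> = X - cnj X"
    by (simp add: X_def split refls revs algebra_simps)
  finally have "Im (2 * pi * \<i> * of_nat (N_plus L T\<^sub>0 T)) = Im (X - cnj X)" by simp
  then have N: "pi * real (N_plus L T\<^sub>0 T) = Im X" by simp
  have "X = IF m0 a2 + IF a2 a3 + IF a3 m1 + IK m0 m1"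
    using K_half K_rev IZ_eq[OF segs[of m0 a2]] IZ_eq[OF segs[of a2 a3]] IZ_eq[OF segs[of a3 m1]]
    by (simp add: X_def algebra_simps add_eq_0_iff)
  also have "IF a3 m1 = - IF m1 a3" by (rule revF[OF segs]) simp
  finally have X: "Im X = Im (IF m0 a2) + Im (IF a2 a3) - Im (IF m1 a3) + Im (IK m0 m1)" by simp
  have "IK m0 m1 = \<i> * integral {T\<^sub>0..T} (\<lambda>t. gamma_logderiv (Complex (1/2) t))"
    unfolding I_defs using T by (intro contour_integral_linepath_same_Re) (auto simp: pts)
  then have "Im (IK m0 m1) = Re (integral {T\<^sub>0..T} (\<lambda>t. gamma_logderiv (Complex (1/2) t)))" by simp
  also have "\<dots> = integral {T\<^sub>0..T} (\<lambda>t. Re (gamma_logderiv (Complex (1/2) t)))"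
  proof -
    have "continuous_on {T\<^sub>0..T} (\<lambda>t. gamma_logderiv (Complex (1/2) t))"
      by (rule continuous_on_compose2[OF contK]) (use T in \<open>auto simp: Complex_eq intro!: continuous_intros\<close>)
    then have "(\<lambda>t. gamma_logderiv (Complex (1/2) t)) integrable_on {T\<^sub>0..T}"
      by (rule integrable_continuous_real)
    then show ?thesis by (rule integral_linear[OF _ bounded_linear_Re, unfolded o_def, symmetric])
  qed
  finally show ?thesis using N X by (simp add: I_defs F_def pts)
qed

text \<open>An antiderivative of \<open>d / 2 * ln t + \<Lambda> / 2\<close>, equal to
  \<open>pi\<close> times the main term of the theorem.\<close>

definition gamma_main :: "real \<Rightarrow> real" where
  "gamma_main t = d / 2 * t * ln (t / exp 1) + \<Lambda> / 2 * t"

text \<open>For each \<open>j\<close>, \<open>pi\<close> comes from the digamma estimate and the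
  norm from replacing the modulus of the Gamma argument by \<open>lam j * t\<close>.\<close>

definition gamma_error :: real where
  "gamma_error = (\<Sum>j\<in>{1..f}. pi + 2 * norm (of_real (lam j) + cnj (mu j)))"

lemma gamma_logderiv_critical_line:
  assumes t: "t > 0"
    and mut: "\<And>j. j \<in> {1..f} \<Longrightarrow> 2 * norm (mu j) \<le> lam j * t"
      "\<And>j. j \<in> {1..f} \<Longrightarrow> 2 * norm (of_real (lam j) + cnj (mu j)) \<le> lam j * t"
  shows "\<bar>Re (gamma_logderiv (Complex (1/2) t)) - (d / 2 * ln t + \<Lambda> / 2)\<bar> \<le> gamma_error / t"
proof -
  define w where "w = (\<lambda>j. of_real (lam j) * Complex (1/2) t + mu j)"
  have "\<bar>lam j * Re (Digamma (w j)) - lam j * ln (lam j * t)\<bar>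
      \<le> (pi + 2 * norm (of_real (lam j) + cnj (mu j))) / t" if j: "j \<in> {1..f}" for j
  proof -
    define E r where "E = norm (of_real (lam j) + cnj (mu j))" and "r = lam j * t"
    have l: "lam j > 0" by (rule lam[OF j])
    have r: "r > 0" using l t by (simp add: r_def)
    have E: "E \<ge> 0" "2 * E \<le> r" using mut(2)[OF j] by (auto simp: E_def r_def)
    have "Im (w j) = r + Im (mu j)" "2 * norm (mu j) \<le> r"
      using mut(1)[OF j] by (simp_all add: w_def r_def)
    then have Im: "Im (w j) \<ge> r / 2" using abs_Im_le_cmod[of "mu j"] by linarith
    have "\<bar>Re (Digamma (w j)) - ln (norm (w j))\<bar> \<le> pi / (2 * Im (w j))"
      using Im r l mu[OF j] by (intro Re_Digamma_ln_norm_right) (auto simp: w_def)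
    also have "\<dots> \<le> pi / (2 * (r / 2))" using Im r by (intro divide_left_mono) auto
    finally have 1: "\<bar>Re (Digamma (w j)) - ln (norm (w j))\<bar> \<le> pi / r" by simp
    have 2: "\<bar>ln (norm (w j)) - ln r\<bar> \<le> 2 * E / r"
    proof -
      have "norm (w j - of_real r * \<i>) = norm (of_real (lam j / 2) + mu j)"
        by (simp add: w_def r_def Complex_eq algebra_simps)
      \<comment> \<open>Doubling \<open>lam j / 2\<close> only enlarges the modulus as
        \<open>Re (mu j) \<ge> 0\<close>, and it yields the quantity that occurs in
        \<open>E_L\<close> and in the condition on \<open>T\<^sub>0\<close>.\<close>
      also have "\<dots> \<le> E"
      proof -
        have "(lam j / 2 + Re (mu j))\<^sup>2 \<le> (lam j + Re (mu j))\<^sup>2"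
          using l mu[OF j] by (intro power_mono) auto
        then show ?thesis by (simp add: E_def cmod_def)
      qed
      finally have we: "norm (w j - of_real r * \<i>) \<le> E" .
      have nr: "norm (of_real r * \<i>) = r" using r by (simp add: norm_mult)
      have up: "norm (w j) \<le> r + E" using norm_triangle_sub[of "w j" "of_real r * \<i>"] we nr by linarith
      have lo: "norm (w j) \<ge> r - E"
        using norm_triangle_sub[of "of_real r * \<i>" "w j"] we nr by (simp add: norm_minus_commute)
      have wpos: "norm (w j) > 0" using lo E r by linarith
      have "ln (norm (w j)) - ln r = ln (norm (w j) / r)" using wpos r by (subst ln_div) auto
      also have "\<dots> \<le> norm (w j) / r - 1" using wpos r by (intro ln_le_minus_one) auto
      also have "\<dots> \<le> (r + E) / r - 1" using up r by (simp add: divide_right_mono)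
      also have "\<dots> = E / r" using r by (simp add: field_simps)
      also have "\<dots> \<le> 2 * E / r" using E r by (intro divide_right_mono) auto
      finally have a: "ln (norm (w j)) - ln r \<le> 2 * E / r" .
      have "ln r - ln (norm (w j)) = ln (r / norm (w j))" using wpos r by (subst ln_div) auto
      also have "\<dots> \<le> r / norm (w j) - 1" using wpos r by (intro ln_le_minus_one) auto
      also have "\<dots> = (r - norm (w j)) / norm (w j)" using wpos by (simp add: diff_divide_distrib)
      also have "\<dots> \<le> E / norm (w j)" using lo wpos by (intro divide_right_mono) auto
      also have "\<dots> \<le> E / (r / 2)" using lo E r wpos by (intro divide_left_mono) auto
      finally have b: "ln r - ln (norm (w j)) \<le> 2 * E / r" by (simp add: mult.commute)
      from a b show ?thesis by linarith
    qed
    have "\<bar>Re (Digamma (w j)) - ln r\<bar> \<le> (pi + 2 * E) / r" using 1 2 by (simp add: add_divide_distrib)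
    then have "lam j * \<bar>Re (Digamma (w j)) - ln r\<bar> \<le> lam j * ((pi + 2 * E) / r)"
      using l by (intro mult_left_mono) auto
    moreover have "lam j * ((pi + 2 * E) / r) = (pi + 2 * E) / t" using l by (simp add: r_def)
    moreover have "lam j * \<bar>Re (Digamma (w j)) - ln r\<bar> = \<bar>lam j * Re (Digamma (w j)) - lam j * ln r\<bar>"
      using l by (simp add: abs_mult_pos' right_diff_distrib[symmetric])
    ultimately show ?thesis by (simp add: E_def r_def)
  qed
  then have "(\<Sum>j\<in>{1..f}. \<bar>lam j * Re (Digamma (w j)) - lam j * ln (lam j * t)\<bar>) \<le> gamma_error / t"
    unfolding gamma_error_def sum_divide_distrib by (rule sum_mono)
  then have "\<bar>\<Sum>j\<in>{1..f}. lam j * Re (Digamma (w j)) - lam j * ln (lam j * t)\<bar> \<le> gamma_error / t"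
    by (rule order_trans[OF sum_abs])
  also have "(\<Sum>j\<in>{1..f}. lam j * Re (Digamma (w j)) - lam j * ln (lam j * t))
      = Re (gamma_logderiv (Complex (1/2) t)) - (d / 2 * ln t + \<Lambda> / 2)"
  proof -
    have "(\<Sum>j\<in>{1..f}. lam j * ln (lam j * t)) = (\<Sum>j\<in>{1..f}. lam j * ln (lam j) + lam j * ln t)"
      by (rule sum.cong) (use lam t in \<open>auto simp: ln_mult ring_distribs\<close>)
    also have "\<dots> = (\<Sum>j\<in>{1..f}. lam j * ln (lam j)) + d / 2 * ln t"
      by (simp add: sum.distrib d_def degree_L_def sum_distrib_right)
    also have "(\<Sum>j\<in>{1..f}. lam j * ln (lam j)) = \<Lambda> / 2 - ln Q"
    proof -
      have "(\<Sum>j\<in>{1..f}. 2 * lam j * ln (lam j)) = 2 * (\<Sum>j\<in>{1..f}. lam j * ln (lam j))"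
        unfolding sum_distrib_left by (simp only: mult.assoc)
      then show ?thesis unfolding \<Lambda>_eq by (simp add: add_divide_distrib)
    qed
    finally show ?thesis by (simp add: sum_subtractf gamma_logderiv_def w_def)
  qed
  finally show ?thesis .
qed

lemma gamma_integral:
  assumes T: "0 < T\<^sub>0" "T\<^sub>0 < T"
    and mut: "\<And>j. j \<in> {1..f} \<Longrightarrow> 2 * norm (mu j) \<le> lam j * T\<^sub>0"
      "\<And>j. j \<in> {1..f} \<Longrightarrow> 2 * norm (of_real (lam j) + cnj (mu j)) \<le> lam j * T\<^sub>0"
  shows "\<bar>integral {T\<^sub>0..T} (\<lambda>t. Re (gamma_logderiv (Complex (1/2) t))) - (gamma_main T - gamma_main T\<^sub>0)\<bar>
           \<le> gamma_error * ln (T / T\<^sub>0)"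
proof -
  define \<kappa> where "\<kappa> = (\<lambda>t. Re (gamma_logderiv (Complex (1/2) t)))"
  define g where "g = (\<lambda>t. d / 2 * ln t + \<Lambda> / 2)"
  have free: "gamma_free (T\<^sub>0 / 2)" using mut(1) T by (simp add: gamma_free_def field_simps)
  have "continuous_on {T\<^sub>0..T} (\<lambda>t. gamma_logderiv (Complex (1/2) t))"
    by (rule continuous_on_compose2[OF holomorphic_on_imp_continuous_on[OF holomorphic_gamma_logderiv[OF free]]])
       (use T in \<open>auto simp: Complex_eq intro!: continuous_intros\<close>)
  then have int1: "\<kappa> integrable_on {T\<^sub>0..T}"
    unfolding \<kappa>_def by (intro integrable_continuous_real continuous_intros)
  have int2: "(g has_integral (gamma_main T - gamma_main T\<^sub>0)) {T\<^sub>0..T}"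
  proof (rule fundamental_theorem_of_calculus)
    fix t assume t: "t \<in> {T\<^sub>0..T}"
    have tpos: "t > 0" using t T by simp
    have "((\<lambda>t. ln (t / exp 1)) has_real_derivative 1 / t) (at t)"
      using tpos by (auto intro!: derivative_eq_intros simp: field_simps)
    from DERIV_add[OF DERIV_mult[OF DERIV_cmult[OF DERIV_ident, of "d / 2"] this]
        DERIV_cmult[OF DERIV_ident, of "\<Lambda> / 2"]]
    have "(gamma_main has_real_derivative d / 2 * 1 * ln (t / exp 1) + 1 / t * (d / 2 * t) + \<Lambda> / 2 * 1) (at t)"
      unfolding gamma_main_def[abs_def] .
    moreover have "d / 2 * 1 * ln (t / exp 1) + 1 / t * (d / 2 * t) + \<Lambda> / 2 * 1 = g t"
      using tpos by (simp add: g_def ln_div algebra_simps diff_divide_distrib)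
    ultimately have "(gamma_main has_real_derivative g t) (at t)" by simp
    then show "(gamma_main has_vector_derivative g t) (at t within {T\<^sub>0..T})"
      by (simp add: has_real_derivative_iff_has_vector_derivative has_vector_derivative_at_within)
  qed (use T in simp)
  have int3: "((\<lambda>t. gamma_error / t) has_integral (gamma_error * ln T - gamma_error * ln T\<^sub>0)) {T\<^sub>0..T}"
  proof (rule fundamental_theorem_of_calculus)
    fix t assume t: "t \<in> {T\<^sub>0..T}"
    have "((\<lambda>t. gamma_error * ln t) has_real_derivative gamma_error / t) (at t)"
      using t T by (auto intro!: derivative_eq_intros)
    then show "((\<lambda>t. gamma_error * ln t) has_vector_derivative gamma_error / t) (at t within {T\<^sub>0..T})"
      by (simp add: has_real_derivative_iff_has_vector_derivative has_vector_derivative_at_within)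
  qed (use T in simp)
  have "integral {T\<^sub>0..T} \<kappa> - (gamma_main T - gamma_main T\<^sub>0) = integral {T\<^sub>0..T} (\<lambda>t. \<kappa> t - g t)"
    using int1 int2 by (simp add: Henstock_Kurzweil_Integration.integral_diff has_integral_iff)
  also have "norm \<dots> \<le> integral {T\<^sub>0..T} (\<lambda>t. gamma_error / t)"
  proof (rule Henstock_Kurzweil_Integration.integral_norm_bound_integral)
    show "(\<lambda>t. \<kappa> t - g t) integrable_on {T\<^sub>0..T}"
      using int1 int2 by (auto intro: integrable_diff)
    show "(\<lambda>t. gamma_error / t) integrable_on {T\<^sub>0..T}" using int3 by auto
    fix t assume t: "t \<in> {T\<^sub>0..T}"
    have mono: "lam j * T\<^sub>0 \<le> lam j * t" if "j \<in> {1..f}" for j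
      using t lam[OF that] by (intro mult_left_mono) auto
    show "norm (\<kappa> t - g t) \<le> gamma_error / t"
      unfolding \<kappa>_def g_def real_norm_def
      by (rule gamma_logderiv_critical_line)
         (use t T in \<open>auto intro!: order_trans[OF mut(1) mono] order_trans[OF mut(2) mono]\<close>)
  qed
  also have "\<dots> = gamma_error * ln (T / T\<^sub>0)"
    using int3 T by (simp add: has_integral_iff ln_div algebra_simps)
  finally show ?thesis by (simp add: \<kappa>_def)
qed

text \<open>The 3 collects one \<open>pi\<close> from each of the two horizontal sides and one from
  the vertical side.\<close>

lemma N_plus_bound_generic:
  assumes T: "T\<^sub>0 \<ge> 4 * P - 1" "T\<^sub>0 < T"
    and mut: "\<And>j. j \<in> {1..f} \<Longrightarrow> 2 * norm (mu j) \<le> lam j * (T\<^sub>0 - 2 * P)"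
      "\<And>j. j \<in> {1..f} \<Longrightarrow> 2 * norm (of_real (lam j) + cnj (mu j)) \<le> lam j * T\<^sub>0"
    and nz: "\<And>z. Im z = T\<^sub>0 \<Longrightarrow> L z \<noteq> 0" "\<And>z. Im z = T \<Longrightarrow> L z \<noteq> 0"
  shows "\<bar>pi * real (N_plus L T\<^sub>0 T) - (gamma_main T - gamma_main T\<^sub>0)\<bar>
     \<le> pi * (3 + (horizontal_bound T + horizontal_bound T\<^sub>0) / ln 2) + gamma_error * ln (T / T\<^sub>0)"
proof -
  have T0: "T\<^sub>0 \<ge> 9" "T\<^sub>0 - 2 * P \<ge> 4" using T P_ge by linarith+
  have free: "gamma_free ((T\<^sub>0 - 2 * P) / 2)" using mut(1) T0 by (simp add: gamma_free_def field_simps)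
  have mutT: "2 * norm (mu j) \<le> lam j * (T - 2 * P)" if "j \<in> {1..f}" for j
  proof -
    have "lam j * (T\<^sub>0 - 2 * P) \<le> lam j * (T - 2 * P)" using lam[OF that] T by (intro mult_left_mono) auto
    then show ?thesis using mut(1)[OF that] by linarith
  qed
  have mut0: "2 * norm (mu j) \<le> lam j * T\<^sub>0" if "j \<in> {1..f}" for j
  proof -
    have "lam j * (T\<^sub>0 - 2 * P) \<le> lam j * T\<^sub>0" using lam[OF that] P_ge by (intro mult_left_mono) auto
    then show ?thesis using mut(1)[OF that] by linarith
  qed
  have hT: "(T\<^sub>0 - 2 * P) / 2 < T\<^sub>0"
  proof -
    have "0 < T\<^sub>0 + 2 * P" using T0 P_ge by linarith
    then show ?thesis by simp
  qed
  note N_plus_identity[OF free hT T(2) nz]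
  moreover note Im_horizontal_integral[OF T(1) mut(1) nz(1)]
  moreover have "T \<ge> 4 * P - 1" using T by linarith
  note Im_horizontal_integral[OF this mutT nz(2)]
  moreover have "T\<^sub>0 > 0" "T > 0" using T0 T by linarith+
  note Im_vertical_integral[OF this]
  moreover note gamma_integral[OF \<open>T\<^sub>0 > 0\<close> T(2) mut0 mut(2)]
  moreover have "pi * (3 + (horizontal_bound T + horizontal_bound T\<^sub>0) / ln 2)
      = pi * (horizontal_bound T / ln 2 + 1) + pi * (horizontal_bound T\<^sub>0 / ln 2 + 1) + pi"
    by (simp add: algebra_simps add_divide_distrib)
  ultimately show ?thesis by linarith
qed

end

section \<open>Zeros on the boundary and zeros in the lower half plane\<close>

lemma zorder_cnj:
  assumes f: "f holomorphic_on S" "open S" "connected S" "z \<in> S" "\<exists>w\<in>S. f w \<noteq> 0"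
  shows "zorder (\<lambda>w. cnj (f (cnj w))) (cnj z) = zorder f z"
proof -
  define n where "n = zorder f z"
  define g where "g = zor_poly f z"
  have ex: "(if f z = 0 then n > 0 else n = 0) \<and> (\<exists>r. r > 0 \<and> cball z r \<subseteq> S \<and> g holomorphic_on cball z r
      \<and> (\<forall>w\<in>cball z r. f w = g w * (w - z) ^ nat n \<and> g w \<noteq> 0))"
    unfolding n_def g_def by (rule zorder_exist_zero[OF f])
  have n: "n \<ge> 0" using conjunct1[OF ex] by (cases "f z = 0") simp_all
  obtain r where r: "r > 0" "g holomorphic_on cball z r"
    and eq: "\<And>w. w \<in> cball z r \<Longrightarrow> f w = g w * (w - z) ^ nat n \<and> g w \<noteq> 0"
    using conjunct2[OF ex] by blast
  have ball: "cnj w \<in> ball z r" if "w \<in> ball (cnj z) r" for w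
    using that by (simp add: dist_norm flip: complex_cnj_diff) (metis complex_cnj_cnj complex_cnj_diff complex_mod_cnj)
  have "zorder (\<lambda>w. cnj (f (cnj w))) (cnj z) = n"
  proof (rule zorder_eqI)
    have "cnj ` ball (cnj z) r \<subseteq> cball z r" using ball ball_subset_cball by blast
    then have "(cnj \<circ> g \<circ> cnj) holomorphic_on ball (cnj z) r"
      by (intro holomorphic_on_compose_cnj_cnj holomorphic_on_subset[OF r(2)]) auto
    then show "(\<lambda>w. cnj (g (cnj w))) holomorphic_on ball (cnj z) r" by (simp add: o_def)
    show "cnj (g (cnj (cnj z))) \<noteq> 0" using eq[of z] r by simp
    fix w assume w: "w \<in> ball (cnj z) r"
    then have "cnj w \<in> cball z r" using ball ball_subset_cball by blast
    from eq[OF this] have "cnj (f (cnj w)) = cnj (g (cnj w)) * (w - cnj z) ^ nat n" by simp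
    also have "(w - cnj z) ^ nat n = (w - cnj z) powi n" using n by (simp add: power_int_def)
    finally show "cnj (f (cnj w)) = cnj (g (cnj w)) * (w - cnj z) powi n" .
  qed (use r in auto)
  then show ?thesis by (simp add: n_def)
qed

lemma cnj_in_nonpos_Ints_iff: "cnj z \<in> \<int>\<^sub>\<le>\<^sub>0 \<longleftrightarrow> z \<in> \<int>\<^sub>\<le>\<^sub>0"
proof -
  have *: "cnj z \<in> \<int>\<^sub>\<le>\<^sub>0" if "z \<in> \<int>\<^sub>\<le>\<^sub>0" for z :: complex
    using that by (auto elim!: nonpos_Ints_cases intro!: nonpos_Ints_of_int)
  from *[of z] *[of "cnj z"] show ?thesis by auto
qed

lemma completed_L_cnj:
  assumes "Q > 0"
  shows "completed_L (\<lambda>s. cnj (L (cnj s))) f Q lam (\<lambda>j. cnj (mu j)) s = cnj (completed_L L f Q lam mu (cnj s))"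
proof -
  have "cnj (of_real Q powr cnj s) = of_real Q powr s"
    using assms by (simp add: powr_def Ln_of_real exp_cnj)
  then show ?thesis by (simp add: completed_L_def cnj_Gamma)
qed

context functional_equation
begin

text \<open>Conjugation changes only \<open>mu\<close> and \<open>\<omega>\<close>, and the bounds
  depend on these through norms alone, so they carry over literally.\<close>

lemma cnj_functional_equation:
  "functional_equation (\<lambda>s. cnj (L (cnj s))) k f Q lam (\<lambda>j. cnj (mu j)) (cnj \<omega>) c"
proof
  show "\<exists>G. G holomorphic_on UNIV \<and> finite_order G \<and> (\<forall>s. s \<noteq> 1 \<longrightarrow> G s = (s - 1) ^ k * cnj (L (cnj s)))"
  proof -
    obtain G where G: "G holomorphic_on UNIV" "finite_order G" "\<And>s. s \<noteq> 1 \<Longrightarrow> G s = (s - 1) ^ k * L s"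
      using entire by blast
    have "(cnj \<circ> G \<circ> cnj) holomorphic_on UNIV"
      by (intro holomorphic_on_compose_cnj_cnj holomorphic_on_subset[OF G(1)]) auto
    then have "(\<lambda>s. cnj (G (cnj s))) holomorphic_on UNIV" by (simp add: o_def)
    moreover have "finite_order (\<lambda>s. cnj (G (cnj s)))"
    proof -
      obtain r b where "\<And>z. norm z \<ge> b \<Longrightarrow> norm (G z) \<le> exp (norm z powr r)"
        using G(2) by (auto simp: finite_order_def eventually_at_infinity)
      then have "\<forall>z. b \<le> norm z \<longrightarrow> norm (cnj (G (cnj z))) \<le> exp (norm z powr r)"
        using complex_mod_cnj by metis
      then show ?thesis unfolding finite_order_def eventually_at_infinity by blast
    qed
    moreover have "cnj (G (cnj s)) = (s - 1) ^ k * cnj (L (cnj s))" if "s \<noteq> 1" for s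
      using G(3)[of "cnj s"] that by (auto simp: complex_cnj_one_iff)
    ultimately show ?thesis by blast
  qed
  fix s
  assume s: "s \<noteq> 0" "s \<noteq> 1" "\<forall>j\<in>{1..f}. of_real (lam j) * s + cnj (mu j) \<notin> \<int>\<^sub>\<le>\<^sub>0 \<and>
      of_real (lam j) * (1 - cnj s) + cnj (mu j) \<notin> \<int>\<^sub>\<le>\<^sub>0"
  have "completed_L L f Q lam mu (cnj s) = \<omega> * cnj (completed_L L f Q lam mu (1 - cnj (cnj s)))"
  proof (rule feq)
    show "cnj s \<noteq> 0" "cnj s \<noteq> 1" using s by auto
    show "\<forall>j\<in>{1..f}. of_real (lam j) * cnj s + mu j \<notin> \<int>\<^sub>\<le>\<^sub>0 \<and>
        of_real (lam j) * (1 - cnj (cnj s)) + mu j \<notin> \<int>\<^sub>\<le>\<^sub>0"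
      using s(3) cnj_in_nonpos_Ints_iff[of "of_real (lam _) * cnj s + mu _"]
        cnj_in_nonpos_Ints_iff[of "of_real (lam _) * (1 - s) + mu _"] by simp
  qed
  then show "completed_L (\<lambda>s. cnj (L (cnj s))) f Q lam (\<lambda>j. cnj (mu j)) s
      = cnj \<omega> * cnj (completed_L (\<lambda>s. cnj (L (cnj s))) f Q lam (\<lambda>j. cnj (mu j)) (1 - cnj s))"
    unfolding completed_L_cnj[OF Q] by simp
next
  fix s :: complex assume "Re s \<ge> c"
  then show "norm (cnj (L (cnj s)) - 1) \<le> 1 / 2"
    using near_one[of "cnj s"] by (metis complex_cnj_diff complex_cnj_one complex_mod_cnj complex_cnj_cnj cnj.simps(1))
qed (use c Q lam mu omega nonzero in auto)

lemma N_minus_eq: "T\<^sub>0 \<ge> 0 \<Longrightarrow> N_minus L T\<^sub>0 T = N_plus (\<lambda>s. cnj (L (cnj s))) T\<^sub>0 T"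
  unfolding N_minus_def N_plus_def
proof (rule sum.reindex_bij_witness[of _ cnj cnj])
  fix \<rho> assume T0: "T\<^sub>0 \<ge> 0" and \<rho>: "\<rho> \<in> {\<rho> \<in> nontrivial_zeros L. - T \<le> Im \<rho> \<and> Im \<rho> < - T\<^sub>0}"
  have "L (Complex 2 (-1)) \<noteq> 0" by (rule nonzero) simp
  then have "\<exists>w\<in>{s. Im s < 0}. L w \<noteq> 0" by (intro bexI[of _ "Complex 2 (-1)"]) auto
  from zorder_cnj[OF holomorphic_on_subset[OF holomorphic_L] open_halfspace_Im_lt _ _ this, of \<rho>]
  show "nat (zorder (\<lambda>s. cnj (L (cnj s))) (cnj \<rho>)) = nat (zorder L \<rho>)"
    using \<rho> T0 by (auto simp: convex_halfspace_Im_lt convex_connected)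
qed (auto simp: nontrivial_zeros_def)

lemma gamma_error_cnj: "functional_equation.gamma_error f lam (\<lambda>j. cnj (mu j)) = gamma_error"
proof -
  have "norm (of_real (lam j) + mu j) = norm (of_real (lam j) + cnj (mu j))" for j
    by (metis complex_cnj_add complex_cnj_complex_of_real complex_mod_cnj)
  then show ?thesis
    by (simp add: gamma_error_def functional_equation.gamma_error_def[OF cnj_functional_equation])
qed

text \<open>Zeros at the heights \<open>T\<^sub>0\<close> and \<open>T\<close> are now allowed. The
  heights of zeros near the range form a finite set, so raising both ends by a small
  \<open>\<epsilon> > 0\<close> makes the horizontal lines free of zeros; since the lower end is
  excluded and the upper end included, the count does not change. All other terms are continuous in
  the end points.\<close>

lemma N_plus_bound:
  assumes T: "T\<^sub>0 \<ge> 4 * P - 1" "T\<^sub>0 < T"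
    and mut: "\<And>j. j \<in> {1..f} \<Longrightarrow> 2 * norm (mu j) \<le> lam j * (T\<^sub>0 - 2 * P)"
      "\<And>j. j \<in> {1..f} \<Longrightarrow> 2 * norm (of_real (lam j) + cnj (mu j)) \<le> lam j * T\<^sub>0"
  shows "\<bar>pi * real (N_plus L T\<^sub>0 T) - (gamma_main T - gamma_main T\<^sub>0)\<bar>
     \<le> pi * (3 + (horizontal_bound T + horizontal_bound T\<^sub>0) / ln 2) + gamma_error * ln (T / T\<^sub>0)"
proof -
  have T0: "T\<^sub>0 \<ge> 9" "T\<^sub>0 - 2 * P \<ge> 4" "T > 1" using T P_ge by linarith+
  have free: "gamma_free ((T\<^sub>0 - 2 * P) / 2)" using mut(1) T0 by (simp add: gamma_free_def field_simps)
  have free_less: "(T\<^sub>0 - 2 * P) / 2 < T\<^sub>0"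
  proof -
    have "0 < T\<^sub>0 + 2 * P" using T0 P_ge by linarith
    then show ?thesis by simp
  qed
  define A where "A = cbox (Complex 0 T\<^sub>0) (Complex 1 (T + 1))"
  define V where "V = Im ` {s\<in>A. L s = 0}"
  have "finite {s\<in>A. L s = 0}"
    by (rule finite_zeros) (use T0 in \<open>auto simp: A_def in_cbox_complex_iff\<close>)
  then have finV: "finite V" by (simp add: V_def)
  have inV: "Im \<rho> \<in> V" if "L \<rho> = 0" "T\<^sub>0 \<le> Im \<rho>" "Im \<rho> \<le> T + 1" for \<rho>
  proof -
    have "0 \<le> Re \<rho>" "Re \<rho> \<le> 1" using zeros_in_strip[OF free _ that(1)] free_less that(2) by auto
    then show ?thesis using that by (auto simp: V_def A_def in_cbox_complex_iff)
  qed
  have gap: "eventually (\<lambda>\<epsilon>. x < v \<longrightarrow> x + \<epsilon> < v) (at_right 0)" for x v :: real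
  proof (cases "x < v")
    case True
    have "((\<lambda>\<epsilon>. x + \<epsilon>) \<longlongrightarrow> x + 0) (at_right 0)" by (intro tendsto_intros)
    then have "eventually (\<lambda>\<epsilon>. x + \<epsilon> < v) (at_right 0)" using order_tendstoD(2)[of _ "x + 0"] True by simp
    then show ?thesis by (rule eventually_mono) simp
  qed simp
  \<comment> \<open>The conjunct with 0 and 1 says \<open>\<epsilon> < 1\<close>, phrased as an
    instance of \<open>gap\<close>; it keeps the shifted lines inside the box \<open>A\<close>,
    which ends at height \<open>T + 1\<close>.\<close>
  have "eventually (\<lambda>\<epsilon>. (\<forall>v\<in>V. (T\<^sub>0 < v \<longrightarrow> T\<^sub>0 + \<epsilon> < v) \<and> (T < v \<longrightarrow> T + \<epsilon> < v))
      \<and> (0 < (1::real) \<longrightarrow> 0 + \<epsilon> < 1) \<and> 0 < \<epsilon>) (at_right 0)"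
    by (intro eventually_conj eventually_ball_finite finV ballI gap eventually_at_right_less)
  then have ev: "eventually (\<lambda>\<epsilon>. \<bar>pi * real (N_plus L T\<^sub>0 T) - (gamma_main (T + \<epsilon>) - gamma_main (T\<^sub>0 + \<epsilon>))\<bar>
     \<le> pi * (3 + (horizontal_bound (T + \<epsilon>) + horizontal_bound (T\<^sub>0 + \<epsilon>)) / ln 2)
       + gamma_error * ln ((T + \<epsilon>) / (T\<^sub>0 + \<epsilon>))) (at_right 0)"
  proof (rule eventually_mono)
    fix \<epsilon> :: real
    assume "(\<forall>v\<in>V. (T\<^sub>0 < v \<longrightarrow> T\<^sub>0 + \<epsilon> < v) \<and> (T < v \<longrightarrow> T + \<epsilon> < v))
      \<and> (0 < (1::real) \<longrightarrow> 0 + \<epsilon> < 1) \<and> 0 < \<epsilon>"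
    then have gap0: "\<And>v. v \<in> V \<Longrightarrow> T\<^sub>0 < v \<Longrightarrow> T\<^sub>0 + \<epsilon> < v" and gap1: "\<And>v. v \<in> V \<Longrightarrow> T < v \<Longrightarrow> T + \<epsilon> < v"
      and \<epsilon>: "0 < \<epsilon>" "\<epsilon> < 1" by auto
    have "{\<rho>. \<rho> \<in> nontrivial_zeros L \<and> T\<^sub>0 + \<epsilon> < Im \<rho> \<and> Im \<rho> \<le> T + \<epsilon>}
        = {\<rho>. \<rho> \<in> nontrivial_zeros L \<and> T\<^sub>0 < Im \<rho> \<and> Im \<rho> \<le> T}"
    proof (rule Collect_cong, rule conj_cong[OF refl])
      fix \<rho> assume "\<rho> \<in> nontrivial_zeros L"
      then have 0: "L \<rho> = 0" by (simp add: nontrivial_zeros_def)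
      show "(T\<^sub>0 + \<epsilon> < Im \<rho> \<and> Im \<rho> \<le> T + \<epsilon>) = (T\<^sub>0 < Im \<rho> \<and> Im \<rho> \<le> T)"
        using inV[OF 0] gap0[of "Im \<rho>"] gap1[of "Im \<rho>"] \<epsilon> T(2) by (smt (verit))
    qed
    then have N: "N_plus L (T\<^sub>0 + \<epsilon>) (T + \<epsilon>) = N_plus L T\<^sub>0 T" unfolding N_plus_def by simp
    have scale: "x \<le> lam j * t'" if "x \<le> lam j * t" "t \<le> t'" "j \<in> {1..f}" for x t t' j
      using that mult_left_mono[OF that(2), of "lam j"] lam[OF that(3)] by linarith
    show "\<bar>pi * real (N_plus L T\<^sub>0 T) - (gamma_main (T + \<epsilon>) - gamma_main (T\<^sub>0 + \<epsilon>))\<bar>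
     \<le> pi * (3 + (horizontal_bound (T + \<epsilon>) + horizontal_bound (T\<^sub>0 + \<epsilon>)) / ln 2)
       + gamma_error * ln ((T + \<epsilon>) / (T\<^sub>0 + \<epsilon>))"
      unfolding N[symmetric]
    proof (rule N_plus_bound_generic)
      show "2 * norm (mu j) \<le> lam j * (T\<^sub>0 + \<epsilon> - 2 * P)" if "j \<in> {1..f}" for j
        using scale[OF mut(1)[OF that] _ that, of "T\<^sub>0 + \<epsilon> - 2 * P"] \<epsilon> by simp
      show "2 * norm (of_real (lam j) + cnj (mu j)) \<le> lam j * (T\<^sub>0 + \<epsilon>)" if "j \<in> {1..f}" for j
        using scale[OF mut(2)[OF that] _ that, of "T\<^sub>0 + \<epsilon>"] \<epsilon> by simp
      show "L z \<noteq> 0" if "Im z = T\<^sub>0 + \<epsilon>" for z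
        using inV[of z] gap0[of "Im z"] that \<epsilon> T(2) by auto
      show "L z \<noteq> 0" if "Im z = T + \<epsilon>" for z
        using inV[of z] gap1[of "Im z"] that \<epsilon> T(2) by auto
    qed (use T \<epsilon> in auto)
  qed
  have shift: "((\<lambda>\<epsilon>. g (x + \<epsilon>)) \<longlongrightarrow> g x) (at_right 0)" if "isCont g x" for g :: "real \<Rightarrow> real" and x
  proof (rule isCont_tendsto_compose[OF that])
    have "((\<lambda>\<epsilon>. x + \<epsilon>) \<longlongrightarrow> x + 0) (at_right 0)" by (intro tendsto_intros)
    then show "((\<lambda>\<epsilon>. x + \<epsilon>) \<longlongrightarrow> x) (at_right 0)" by simp
  qed
  have contH: "isCont horizontal_bound x" if "x > 1" for x
    unfolding horizontal_bound_def[abs_def] using that by (intro continuous_intros) auto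
  have contM: "isCont gamma_main x" if "x > 1" for x
    unfolding gamma_main_def[abs_def] using that by (intro continuous_intros) auto
  have limlog: "((\<lambda>\<epsilon>. ln ((T + \<epsilon>) / (T\<^sub>0 + \<epsilon>))) \<longlongrightarrow> ln (T / T\<^sub>0)) (at_right 0)"
    using T0 by (intro tendsto_ln tendsto_divide shift[where g = "\<lambda>x. x"]) auto
  have "((\<lambda>\<epsilon>. \<bar>pi * real (N_plus L T\<^sub>0 T) - (gamma_main (T + \<epsilon>) - gamma_main (T\<^sub>0 + \<epsilon>))\<bar>)
      \<longlongrightarrow> \<bar>pi * real (N_plus L T\<^sub>0 T) - (gamma_main T - gamma_main T\<^sub>0)\<bar>) (at_right 0)"
    using T0 by (intro tendsto_intros shift contM) auto
  moreover have "((\<lambda>\<epsilon>. pi * (3 + (horizontal_bound (T + \<epsilon>) + horizontal_bound (T\<^sub>0 + \<epsilon>)) / ln 2)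
       + gamma_error * ln ((T + \<epsilon>) / (T\<^sub>0 + \<epsilon>)))
      \<longlongrightarrow> pi * (3 + (horizontal_bound T + horizontal_bound T\<^sub>0) / ln 2) + gamma_error * ln (T / T\<^sub>0)) (at_right 0)"
    using T0 by (intro tendsto_intros shift contH limlog) auto
  ultimately show ?thesis using ev by (intro tendsto_le[OF trivial_limit_at_right_real])
qed

lemma N_minus_bound:
  assumes T: "T\<^sub>0 \<ge> 4 * P - 1" "T\<^sub>0 < T"
    and mut: "\<And>j. j \<in> {1..f} \<Longrightarrow> 2 * norm (mu j) \<le> lam j * (T\<^sub>0 - 2 * P)"
      "\<And>j. j \<in> {1..f} \<Longrightarrow> 2 * norm (of_real (lam j) + cnj (mu j)) \<le> lam j * T\<^sub>0"
  shows "\<bar>pi * real (N_minus L T\<^sub>0 T) - (gamma_main T - gamma_main T\<^sub>0)\<bar>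
     \<le> pi * (3 + (horizontal_bound T + horizontal_bound T\<^sub>0) / ln 2) + gamma_error * ln (T / T\<^sub>0)"
proof -
  interpret conj: functional_equation "\<lambda>s. cnj (L (cnj s))" k f Q lam "\<lambda>j. cnj (mu j)" "cnj \<omega>" c
    by (rule cnj_functional_equation)
  have nrm: "norm (of_real (lam j) + mu j) = norm (of_real (lam j) + cnj (mu j))" for j
    by (metis complex_cnj_add complex_cnj_complex_of_real complex_mod_cnj)
  have "T\<^sub>0 \<ge> 0" using T P_ge by linarith
  then have "N_minus L T\<^sub>0 T = N_plus (\<lambda>s. cnj (L (cnj s))) T\<^sub>0 T" by (rule N_minus_eq)
  then show ?thesis
    using conj.N_plus_bound[OF T] mut by (simp add: nrm gamma_error_cnj)
qed

end

section \<open>Comparison with the explicit error term\<close>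

lemma Theta_L_ge: "Theta_L f lam mu j x \<ge> 2"
  by (simp add: Theta_L_def)

lemma E_L_ge: "E_L lam mu j \<ge> (norm (of_real (lam j) + cnj (mu j)))\<^sup>2"
  by (simp add: E_L_def Let_def)

lemma E_L_nonneg: "E_L lam mu j \<ge> 0"
  using order_trans[OF zero_le_power2 E_L_ge] .

context functional_equation
begin

text \<open>For \<open>b < - 3\<close> the three multiples of \<open>ln (T / T\<^sub>0)\<close> in
  \<open>R1_L\<close> are at least \<open>35 / 2 * d\<close>, \<open>6 * d\<close> and
  \<open>2 * d\<close>, in total \<open>51 / 2 * d\<close>, that is \<open>51 * lam j\<close> for
  each \<open>j\<close>. In \<open>S_L\<close> the two \<open>Theta_L\<close> terms give at least
  \<open>1 / 6\<close>. The contributions of order \<open>lam j\<close> and \<open>1 / lam j\<close>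
  then dominate \<open>gamma_error\<close> termwise.\<close>

lemma gamma_error_le_R1_L:
  assumes T: "0 < T\<^sub>0" "T\<^sub>0 < T" and b: "b < - 3"
  shows "2 * gamma_error * ln (T / T\<^sub>0) \<le> R1_L f lam mu T\<^sub>0 T b"
proof -
  define l where "l = ln (T / T\<^sub>0)"
  have l: "l \<ge> 0" using T by (simp add: l_def)
  have term_le: "2 * (pi + 2 * norm (of_real (lam j) + cnj (mu j)))
      \<le> 51 * lam j + 2 / lam j * (E_L lam mu j + 1 / 6)" if j: "j \<in> {1..f}" for j
  proof -
    define x w where "x = lam j" and "w = norm (of_real (lam j) + cnj (mu j))"
    have x: "x > 0" using lam[OF j] by (simp add: x_def)
    have "x * (2 * (pi + 2 * w)) \<le> x * (8 + 4 * w)" using x pi_less_4 by (intro mult_left_mono) auto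
    also have "\<dots> \<le> 51 * x\<^sup>2 + 2 * (w\<^sup>2 + 1 / 6)"
    proof -
      \<comment> \<open>\<open>51 = 2 + 49\<close>: the first square pays for
        \<open>4 * x * w\<close>, the second for \<open>8 * x\<close>, leaving
        \<open>16 / 49 < 1 / 3\<close>.\<close>
      have "0 \<le> 2 * (x - w)\<^sup>2" "0 \<le> 49 * (x - 4 / 49)\<^sup>2" by simp_all
      then show ?thesis by (simp add: power2_eq_square algebra_simps)
    qed
    also have "\<dots> \<le> 51 * x\<^sup>2 + 2 * (E_L lam mu j + 1 / 6)"
      using E_L_ge[of lam j mu] by (simp add: w_def)
    also have "\<dots> = x * (51 * x + 2 / x * (E_L lam mu j + 1 / 6))"
      using x by (simp add: field_simps power2_eq_square)
    finally show ?thesis using x by (simp add: x_def w_def)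
  qed
  have "2 * gamma_error = (\<Sum>j\<in>{1..f}. 2 * (pi + 2 * norm (of_real (lam j) + cnj (mu j))))"
    by (simp add: gamma_error_def sum_distrib_left)
  also have "\<dots> \<le> (\<Sum>j\<in>{1..f}. 51 * lam j + 2 / lam j * (E_L lam mu j + 1 / 6))"
    by (rule sum_mono) (rule term_le)
  also have "\<dots> = 51 / 2 * d + (\<Sum>j\<in>{1..f}. 2 / lam j * (E_L lam mu j + 1 / 6))"
    by (simp add: sum.distrib d_def degree_L_def sum_distrib_left)
  finally have "2 * gamma_error * l \<le> (51 / 2 * d + (\<Sum>j\<in>{1..f}. 2 / lam j * (E_L lam mu j + 1 / 6))) * l"
    using l by (rule mult_right_mono)
  also have "\<dots> = l * (51 / 2 * d) + (\<Sum>j\<in>{1..f}. 2 / lam j * l * (E_L lam mu j + 1 / 6))"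
    unfolding distrib_right sum_distrib_right by (simp only: mult_ac)
  also have "(\<Sum>j\<in>{1..f}. 2 / lam j * l * (E_L lam mu j + 1 / 6)) \<le> S_L f lam mu T\<^sub>0 T b"
    unfolding S_L_def l_def[symmetric]
  proof (rule sum_mono)
    fix j assume j: "j \<in> {1..f}"
    have "E_L lam mu j + 1 / 6 \<le> E_L lam mu j + \<bar>B2\<bar> / 4 * Theta_L f lam mu j (- b) + \<bar>B2\<bar> / 4 * Theta_L f lam mu j (- b - 1)"
      using Theta_L_ge[of f lam mu j "- b"] Theta_L_ge[of f lam mu j "- b - 1"] by (simp add: B2_def)
    then show "2 / lam j * l * (E_L lam mu j + 1 / 6)
        \<le> 2 / lam j * l * (E_L lam mu j + \<bar>B2\<bar> / 4 * Theta_L f lam mu j (- b) + \<bar>B2\<bar> / 4 * Theta_L f lam mu j (- b - 1))"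
      using l lam[OF j] by (intro mult_left_mono) auto
  qed
  also have "l * (51 / 2 * d) \<le> l * (- (7 * d / 2) * (2 * b + 1)
           + 2 * norm (- of_real d * of_real b + of_real (Im (mu_L f mu)) * \<i> / 2) + 2 * d)"
  proof (rule mult_left_mono[OF _ l])
    have "- (7 / 2) * (2 * b + 1) = - 7 * b - 7 / 2" by (simp add: algebra_simps)
    then have "35 / 2 \<le> - (7 / 2) * (2 * b + 1)" using b by linarith
    then have "d * (35 / 2) \<le> d * (- (7 / 2) * (2 * b + 1))" using d_nonneg by (rule mult_left_mono)
    also have "d * (- (7 / 2) * (2 * b + 1)) = - (7 * d / 2) * (2 * b + 1)" by simp
    finally have "d * (35 / 2) \<le> - (7 * d / 2) * (2 * b + 1)" .
    moreover have "d * 3 \<le> d * (- b)" using b d_nonneg by (intro mult_left_mono) auto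
    moreover have "d * (- b) \<le> norm (- of_real d * of_real b + of_real (Im (mu_L f mu)) * \<i> / 2)"
      using complex_Re_le_cmod[of "- of_real d * of_real b + of_real (Im (mu_L f mu)) * \<i> / 2"] by simp
    ultimately show "51 / 2 * d \<le> - (7 * d / 2) * (2 * b + 1)
           + 2 * norm (- of_real d * of_real b + of_real (Im (mu_L f mu)) * \<i> / 2) + 2 * d" by linarith
  qed
  finally have main: "2 * gamma_error * l \<le> l * (- (7 * d / 2) * (2 * b + 1)
           + 2 * norm (- of_real d * of_real b + of_real (Im (mu_L f mu)) * \<i> / 2) + 2 * d) + S_L f lam mu T\<^sub>0 T b"
    by simp
  have "0 \<le> 3 * d * (b\<^sup>2 + b) / T\<^sub>0"
  proof -
    have "0 \<le> (- b) * (- b - 1)" using b by (intro mult_nonneg_nonneg) auto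
    then have "0 \<le> b\<^sup>2 + b" by (simp add: power2_eq_square algebra_simps)
    then show ?thesis using d_nonneg T by simp
  qed
  with main show ?thesis
    unfolding R1_L_def Let_def l_def[symmetric] d_def[symmetric] by linarith
qed

text \<open>The factor \<open>9 / 2\<close> is the lower bound for \<open>a - b - 1 / 2\<close>. The
  terms with \<open>d * P\<close> are paid for by \<open>d * q * l\<close>, the pole and conductor
  terms by \<open>max u v\<close>, and the term with \<open>f\<close> partly by
  \<open>d * q * l\<close> and partly by \<open>Vstar_L\<close>; \<open>ln 3\<close> is left for the
  additive constants of \<open>R_L\<close>.\<close>

lemma horizontal_bound_le_R2_L:
  assumes ab: "a > 2" "b < - 3" "c = min a (- b) + 1" and a1: "a1 \<ge> 1" and T: "T \<ge> 2 * (a - b) + 1"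
  shows "horizontal_bound T \<le> 9 / 2 * (ln 2 * R2_L k f Q lam mu a1 a b T) + ln 3"
    and "0 \<le> R2_L k f Q lam mu a1 a b T"
proof -
  define q where "q = 1 / 2 - a + 2 * (a - b)"
  define l where "l = ln (2 * T)"
  define V where "V = Vstar_L f lam mu a b T"
  define u where "u = max (5 / 2 * \<Lambda>) (q * \<Lambda>) - 2 * d
               + norm (1 - of_real (a + 2 * (a - b)) * \<i> / of_real (T - 2 * (a - b))) * d * q
               + d * (a + 2 * (a - b)) + (a + 2 * (a - b)) / (T - 2 * (a - b)) * \<bar>Im (mu_L f mu) / 2\<bar>"
  define v where "v = (5 / 2 * d + 1) * ln 2 + real k * ln 3
               + max 0 (5 / 2 * \<Lambda> + 5 * sqrt 5 / 2 * d + \<bar>Im (mu_L f mu)\<bar>)"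
  have lamQ: "\<bar>lambda_L f lam * Q\<^sup>2\<bar> = lambda_L f lam * Q\<^sup>2"
    by (simp add: lambda_L_def prod_nonneg)
  have r2: "ln 2 * R2_L k f Q lam mu a1 a b T = d * q * l + ln (a1 * pi\<^sup>2 / 6) + V + max u v"
    unfolding R2_L_def Let_def lamQ \<Lambda>_def[symmetric] d_def[symmetric] q_def[symmetric] l_def[symmetric]
      V_def[symmetric] u_def[symmetric] v_def[symmetric] by simp
  have "2 * (a - b) \<ge> 10" using ab(1,2) by simp
  then have T11: "T \<ge> 11" using T by linarith
  have "c - 1 \<le> a" "c - 1 \<le> - b" unfolding ab(3) by auto
  moreover have "4 * P - 1 = 4 * c - 3" by (simp add: P_def)
  moreover have "2 * a - 2 * b + 1 \<le> T" using T by simp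
  ultimately have TP: "T \<ge> 4 * P - 1" by linarith
  have TR: "T - 2 * (a - b) \<ge> 1" using T by simp
  have "c - 1 \<le> a" "c - 1 \<le> - b" unfolding ab(3) by auto
  moreover have "3 * P - 1 = 3 * c - 5 / 2" "q = 1 / 2 + a - 2 * b" by (simp_all add: P_def q_def)
  ultimately have q: "q \<ge> 3 * P - 1" by linarith
  have l3: "l \<ge> 3"
  proof -
    have "exp (3::real) = exp 1 ^ 3" by (simp add: exp_of_nat_mult[symmetric])
    also have "\<dots> \<le> 2.75 ^ 3" using e_less_272 by (intro power_mono) auto
    also have "\<dots> \<le> 2 * T" using T11 by (simp add: power3_eq_cube)
    finally show ?thesis using T11 by (simp add: l_def ln_ge_iff)
  qed
  have a1_nonneg: "ln (a1 * pi\<^sup>2 / 6) \<ge> 0"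
  proof -
    have "3\<^sup>2 \<le> pi\<^sup>2" using pi_gt3 by (intro power_mono) auto
    then have "1 * 9 \<le> a1 * pi\<^sup>2" using a1 by (intro mult_mono) auto
    then show ?thesis by simp
  qed
  have u: "u \<ge> P * max 0 \<Lambda> \<or> \<Lambda> < 0"
  proof (cases "\<Lambda> < 0")
    case False
    have "P * max 0 \<Lambda> \<le> q * \<Lambda>" using False q P_ge by (simp add: max_def mult_right_mono)
    moreover have "2 * d \<le> d * (a + 2 * (a - b))" using d_nonneg ab mult_left_mono[of 2 "a + 2 * (a - b)" d] by simp
    moreover have "0 \<le> norm (1 - of_real (a + 2 * (a - b)) * \<i> / of_real (T - 2 * (a - b))) * d * q"
      using d_nonneg q P_ge by simp
    moreover have "0 \<le> (a + 2 * (a - b)) / (T - 2 * (a - b)) * \<bar>Im (mu_L f mu) / 2\<bar>"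
      using ab TR by (intro mult_nonneg_nonneg divide_nonneg_nonneg) auto
    ultimately show ?thesis unfolding u_def by linarith
  qed simp
  have v: "v \<ge> real k * ln 2"
  proof -
    have "real k * ln 2 \<le> real k * ln 3" by (intro mult_left_mono) auto
    moreover have "0 \<le> (5 / 2 * d + 1) * ln 2" using d_nonneg by simp
    ultimately show ?thesis unfolding v_def by linarith
  qed
  have k0: "real k * ln 2 \<ge> 0" by simp
  \<comment> \<open>\<open>v\<close> covers the pole term and, for \<open>\<Lambda> \<ge> 0\<close>,
    \<open>u\<close> the other one; a multiple of the maximum by at least 2 covers their
    sum.\<close>
  have uv: "real k * ln 2 + P * max 0 \<Lambda> \<le> 9 / 2 * max u v"
  proof (cases "\<Lambda> < 0")
    case True
    then have "P * max 0 \<Lambda> = 0" by simp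
    then show ?thesis using v k0 by linarith
  next
    case False
    then have "u \<ge> P * max 0 \<Lambda>" using u by simp
    then show ?thesis using v k0 by linarith
  qed
  have V: "(\<Sum>j\<in>{1..f}. 1 / (6 * lam j * T)) \<le> V"
  proof -
    have "(\<Sum>j\<in>{1..f}. 1 / (6 * lam j * T)) = 1 / T * (\<Sum>j\<in>{1..f}. 1 / lam j * (1 / 6))"
      by (simp add: sum_distrib_left mult_ac)
    also have "\<dots> \<le> 1 / (T - 2 * (a - b)) * (\<Sum>j\<in>{1..f}. 1 / lam j * (E_L lam mu j + \<bar>B2\<bar> / 2 * Theta_L f lam mu j (- a - 2 * (a - b))))"
    proof (rule mult_mono[OF _ sum_mono])
      show "1 / T \<le> 1 / (T - 2 * (a - b))" using TR ab by (intro divide_left_mono) auto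
    next
      fix j assume j: "j \<in> {1..f}"
      have "1 / 6 \<le> E_L lam mu j + \<bar>B2\<bar> / 2 * Theta_L f lam mu j (- a - 2 * (a - b))"
        using E_L_nonneg[of lam mu j] Theta_L_ge[of f lam mu j "- a - 2 * (a - b)"] by (simp add: B2_def)
      then show "1 / lam j * (1 / 6) \<le> 1 / lam j * (E_L lam mu j + \<bar>B2\<bar> / 2 * Theta_L f lam mu j (- a - 2 * (a - b)))"
        using lam[OF j] by (intro mult_left_mono) auto
    next
      show "0 \<le> (\<Sum>j\<in>{1..f}. 1 / lam j * (1 / 6))"
        by (rule sum_nonneg) (use lam in \<open>auto simp: less_imp_le\<close>)
    qed (use TR in auto)
    finally show ?thesis by (simp add: V_def Vstar_L_def Let_def)
  qed
  have V0: "V \<ge> 0"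
    by (rule order_trans[OF _ V]) (use lam T11 in \<open>force intro!: sum_nonneg simp: less_imp_le\<close>)
  \<comment> \<open>The left side does not involve \<open>lam j\<close>, so each summand is split
    between a multiple of \<open>lam j\<close> (from the degree), which is good for large
    \<open>lam j\<close>, and one of \<open>1 / (lam j * T)\<close> (from \<open>Vstar_L\<close>),
    good for small \<open>lam j\<close>.\<close>
  have D: "4 * pi * P * real f / (T - 1) \<le> 10 * d * P * l + 9 / 2 * V"
  proof -
    have term_le: "4 * pi * P / (T - 1) \<le> 60 * lam j * P + 9 / 2 * (1 / (6 * lam j * T))" if j: "j \<in> {1..f}" for j
    proof -
      define x where "x = lam j"
      have x: "x > 0" using lam[OF j] by (simp add: x_def)
      have "4 * pi * P / (T - 1) \<le> 16 * P / (T - 1)"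
        using pi_less_4 P_ge T11 by (intro divide_right_mono mult_right_mono) auto
      also have "\<dots> \<le> 18 * P / T"
      proof -
        have "16 * P * T \<le> 18 * P * (T - 1)" using P_ge T11 mult_left_mono[of "16 * T" "18 * (T - 1)" P] by (simp add: mult_ac)
        then show ?thesis using T11 by (simp add: divide_le_eq le_divide_eq pos_divide_le_eq frac_le_eq field_simps)
      qed
      also have "\<dots> \<le> 60 * x * P + 9 / 2 * (1 / (6 * x * T))"
      proof -
        define y where "y = x * P"
        have y: "y > 0" using x P_ge by (simp add: y_def)
        have "T \<ge> 3 * P" using TP P_ge by linarith
        then have "240 * x * y * (3 * P) \<le> 240 * x * y * T" using x y by (intro mult_left_mono) auto
        then have "720 * y\<^sup>2 \<le> 240 * x * y * T" by (simp add: y_def power2_eq_square mult_ac)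
        moreover have "0 \<le> 720 * (y - 1 / 20)\<^sup>2" by simp
        then have "72 * y \<le> 720 * y\<^sup>2 + 9 / 5" by (simp add: power2_eq_square algebra_simps)
        ultimately have "72 * y \<le> 240 * x * y * T + 3" by linarith
        then have "18 * P * (4 * x * T) / (4 * x * T) / T \<le> (240 * x * y * T + 3) / (4 * x * T)"
          using x T11 by (simp add: y_def field_simps)
        moreover have "(240 * x * y * T + 3) / (4 * x * T) = 60 * x * P + 9 / 2 * (1 / (6 * x * T))"
          using x T11 by (simp add: y_def field_simps)
        ultimately show ?thesis using x T11 by simp
      qed
      finally show ?thesis by (simp add: x_def)
    qed
    have "4 * pi * P * real f / (T - 1) = (\<Sum>j\<in>{1..f}. 4 * pi * P / (T - 1))" by simp
    also have "\<dots> \<le> (\<Sum>j\<in>{1..f}. 60 * lam j * P + 9 / 2 * (1 / (6 * lam j * T)))"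
      by (rule sum_mono) (rule term_le)
    also have "\<dots> = 30 * d * P + 9 / 2 * (\<Sum>j\<in>{1..f}. 1 / (6 * lam j * T))"
      by (simp add: sum.distrib sum_distrib_left sum_distrib_right d_def degree_L_def)
    also have "30 * d * P \<le> 10 * d * P * l" using l3 d_nonneg P_ge mult_left_mono[of 3 l "10 * d * P"] by simp
    also have "9 / 2 * (\<Sum>j\<in>{1..f}. 1 / (6 * lam j * T)) \<le> 9 / 2 * V" using V by simp
    finally show ?thesis by simp
  qed
  have A: "d * P + d * P * ln (4 * T) + 10 * d * P * l \<le> 9 / 2 * (d * q * l)"
  proof -
    have dP: "d * P \<ge> 0" using d_nonneg P_ge by simp
    have "ln (4 * T) = ln 2 + l" using T11 ln_mult[of 2 "2 * T"] by (simp add: l_def)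
    moreover have "ln 2 \<le> (1::real)" using ln_le_minus_one[of "2::real"] by simp
    \<comment> \<open>The constant \<open>117 / 10\<close> is the largest for which
      \<open>117 / 10 * P \<le> 9 / 2 * (3 * P - 1)\<close> holds for all
      \<open>P \<ge> 5 / 2\<close>.\<close>
    ultimately have "1 + ln (4 * T) + 10 * l \<le> 117 / 10 * l" using l3 by linarith
    then have "d * P * (1 + ln (4 * T) + 10 * l) \<le> d * P * (117 / 10 * l)" using dP by (rule mult_left_mono)
    also have "\<dots> = d * l * (117 / 10 * P)" by simp
    also have "\<dots> \<le> d * l * (9 / 2 * q)" using q P_ge d_nonneg l3 by (intro mult_left_mono) auto
    finally show ?thesis by (simp add: algebra_simps)
  qed
  show "horizontal_bound T \<le> 9 / 2 * (ln 2 * R2_L k f Q lam mu a1 a b T) + ln 3"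
    using A D uv a1_nonneg unfolding r2 horizontal_bound_def distrib_left[of "9 / 2"] by linarith
  have "0 \<le> d * q * l" using d_nonneg q P_ge l3 by simp
  then have "0 \<le> ln 2 * R2_L k f Q lam mu a1 a b T"
    using a1_nonneg V0 v k0 unfolding r2 by linarith
  then show "0 \<le> R2_L k f Q lam mu a1 a b T" by (simp add: zero_le_mult_iff)
qed

text \<open>Each horizontal side takes half of the constant 3. From
  \<open>ln 3 \<le> 2 * ln 2\<close> the left side is at most \<open>9 / 2 * (r + 2)\<close>, and
  \<open>r \<ge> 0\<close> allows \<open>9 / 2\<close> to be replaced by
  \<open>a - b - 1 / 2\<close>.\<close>

lemma horizontal_terms_le:
  assumes ab: "a > 2" "b < - 3" "c = min a (- b) + 1" and a1: "a1 \<ge> 1" and T: "T \<ge> 2 * (a - b) + 1"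
  shows "horizontal_bound T / ln 2 + 3 / 2 \<le> (a - b - 1 / 2) * (R2_L k f Q lam mu a1 a b T + 2)"
proof -
  define r where "r = R2_L k f Q lam mu a1 a b T"
  have r: "r \<ge> 0" "horizontal_bound T \<le> 9 / 2 * (ln 2 * r) + ln 3"
    using horizontal_bound_le_R2_L[OF assms] by (simp_all add: r_def)
  have "ln 3 \<le> ln ((2::real) ^ 2)" by (intro ln_mono) auto
  also have "ln ((2::real) ^ 2) = 2 * ln 2" by (subst ln_realpow) auto
  finally have "ln 3 \<le> 2 * ln (2::real)" .
  then have "horizontal_bound T \<le> (9 / 2 * r + 2) * ln 2" using r(2) by (simp add: algebra_simps)
  then have "horizontal_bound T / ln 2 \<le> 9 / 2 * r + 2" by (simp add: divide_le_eq)
  moreover have "9 / 2 * (r + 2) \<le> (a - b - 1 / 2) * (r + 2)"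
    using ab r(1) by (intro mult_right_mono) auto
  ultimately show ?thesis by (simp add: r_def)
qed

text \<open>Stated for a real \<open>N\<close> to serve both signs. The first two terms of
  \<open>R_L\<close> absorb \<open>gamma_main\<close> at \<open>T\<^sub>0\<close>,
  \<open>R1_L\<close> the digamma error and the \<open>R2_L\<close> terms the sides of the
  rectangle; the inequality is strict because of \<open>pi / (3 * ln 2)\<close>.\<close>

lemma zero_count_within_R_L:
  fixes N :: real
  assumes ab: "a > 2" "b < - 3" "c = min a (- b) + 1" and a1: "a1 \<ge> 1" and f: "f \<ge> 1"
    and T: "T\<^sub>0 \<ge> 2 * (a - b) + 1" "T > T\<^sub>0"
    and N: "\<bar>pi * N - (gamma_main T - gamma_main T\<^sub>0)\<bar>
      \<le> pi * (3 + (horizontal_bound T + horizontal_bound T\<^sub>0) / ln 2) + gamma_error * ln (T / T\<^sub>0)"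
  shows "\<bar>N - degree_L f lam / (2 * pi) * T * ln (T / exp 1) - T / (2 * pi) * ln (lambda_L f lam * Q ^ 2)\<bar>
           < R_L k f Q lam mu a1 a b T\<^sub>0 T"
proof -
  have "2 * (a - b) \<ge> 10" using ab(1,2) by simp
  then have T11: "T\<^sub>0 \<ge> 11" using T by linarith
  define rest where "rest = real f * (\<bar>(b + 1) * (MAX j\<in>{1..f}. lam j) + (MIN j\<in>{1..f}. Re (mu j))\<bar>
      - b * (MAX j\<in>{1..f}. lam j) + (b + 1) * (MIN j\<in>{1..f}. lam j)
      - (MIN j\<in>{1..f}. Re (mu j)) + (MAX j\<in>{1..f}. Re (mu j)))"
  have rest: "rest \<ge> 0"
  proof -
    have ne: "finite {1..f}" "{1..f} \<noteq> {}" using f by auto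
    have in1: "1 \<in> {1..f}" using f by simp
    have 1: "(MIN j\<in>{1..f}. lam j) \<le> (MAX j\<in>{1..f}. lam j)" "(MIN j\<in>{1..f}. Re (mu j)) \<le> (MAX j\<in>{1..f}. Re (mu j))"
      using in1 by (meson Max_ge Min_le finite_imageI finite_atLeastAtMost imageI order_trans)+
    have 2: "(MIN j\<in>{1..f}. lam j) \<ge> 0"
      using ne lam by (intro Min.boundedI) (auto simp: less_imp_le)
    have "(- b) * (MIN j\<in>{1..f}. lam j) \<le> (- b) * (MAX j\<in>{1..f}. lam j)"
      using 1 ab by (intro mult_left_mono) auto
    then have "0 \<le> - b * (MAX j\<in>{1..f}. lam j) + (b + 1) * (MIN j\<in>{1..f}. lam j)"
      using 2 by (simp add: algebra_simps)
    then show ?thesis unfolding rest_def using 1 by (intro mult_nonneg_nonneg) auto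
  qed
  have R: "R_L k f Q lam mu a1 a b T\<^sub>0 T
      = d / (2 * pi) * T\<^sub>0 * ln (T\<^sub>0 / exp 1) + T\<^sub>0 / (2 * pi) * \<bar>\<Lambda>\<bar> + R1_L f lam mu T\<^sub>0 T b / (2 * pi)
        + pi / (3 * ln 2) + (a - b - 1 / 2) * (R2_L k f Q lam mu a1 a b T\<^sub>0 + R2_L k f Q lam mu a1 a b T + 4) + rest"
    by (simp add: R_L_def Let_def d_def \<Lambda>_def rest_def)
  have main: "degree_L f lam / (2 * pi) * t * ln (t / exp 1) + t / (2 * pi) * ln (lambda_L f lam * Q ^ 2)
      = gamma_main t / pi" for t
    by (simp add: gamma_main_def d_def \<Lambda>_def field_simps)
  have main0: "\<bar>gamma_main T\<^sub>0\<bar> / pi \<le> d / (2 * pi) * T\<^sub>0 * ln (T\<^sub>0 / exp 1) + T\<^sub>0 / (2 * pi) * \<bar>\<Lambda>\<bar>"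
  proof -
    have "exp 1 \<le> T\<^sub>0" using e_less_272 T11 by linarith
    then have "0 \<le> ln (T\<^sub>0 / exp 1)" by simp
    then have "0 \<le> d / 2 * T\<^sub>0 * ln (T\<^sub>0 / exp 1)" using d_nonneg T11 by simp
    moreover have "\<bar>\<Lambda> / 2 * T\<^sub>0\<bar> = T\<^sub>0 / 2 * \<bar>\<Lambda>\<bar>" using T11 by (simp add: abs_mult)
    ultimately have "\<bar>gamma_main T\<^sub>0\<bar> \<le> d / 2 * T\<^sub>0 * ln (T\<^sub>0 / exp 1) + T\<^sub>0 / 2 * \<bar>\<Lambda>\<bar>"
      unfolding gamma_main_def by linarith
    then have "\<bar>gamma_main T\<^sub>0\<bar> / pi \<le> (d / 2 * T\<^sub>0 * ln (T\<^sub>0 / exp 1) + T\<^sub>0 / 2 * \<bar>\<Lambda>\<bar>) / pi"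
      by (rule divide_right_mono) simp
    then show ?thesis by (simp add: add_divide_distrib)
  qed
  have err: "gamma_error * ln (T / T\<^sub>0) / pi \<le> R1_L f lam mu T\<^sub>0 T b / (2 * pi)"
    using gamma_error_le_R1_L[of T\<^sub>0 T b] T T11 ab by (simp add: field_simps)
  have hor: "3 + (horizontal_bound T + horizontal_bound T\<^sub>0) / ln 2
      \<le> (a - b - 1 / 2) * (R2_L k f Q lam mu a1 a b T\<^sub>0 + R2_L k f Q lam mu a1 a b T + 4)"
  proof -
    have "T \<ge> 2 * (a - b) + 1" using T by linarith
    from horizontal_terms_le[OF ab a1 this] horizontal_terms_le[OF ab a1 T(1)]
    have "horizontal_bound T / ln 2 + 3 / 2 + (horizontal_bound T\<^sub>0 / ln 2 + 3 / 2)
        \<le> (a - b - 1 / 2) * (R2_L k f Q lam mu a1 a b T + 2) + (a - b - 1 / 2) * (R2_L k f Q lam mu a1 a b T\<^sub>0 + 2)"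
      by (rule add_mono)
    also have "\<dots> = (a - b - 1 / 2) * (R2_L k f Q lam mu a1 a b T\<^sub>0 + R2_L k f Q lam mu a1 a b T + 4)"
      by (simp add: algebra_simps)
    finally show ?thesis by (simp add: add_divide_distrib)
  qed
  have "\<bar>pi * N - (gamma_main T - gamma_main T\<^sub>0)\<bar> / pi
      \<le> (pi * (3 + (horizontal_bound T + horizontal_bound T\<^sub>0) / ln 2) + gamma_error * ln (T / T\<^sub>0)) / pi"
    using N by (rule divide_right_mono) simp
  also have "\<dots> = 3 + (horizontal_bound T + horizontal_bound T\<^sub>0) / ln 2 + gamma_error * ln (T / T\<^sub>0) / pi"
    by (simp add: add_divide_distrib)
  also have "\<bar>pi * N - (gamma_main T - gamma_main T\<^sub>0)\<bar> / pi
      = \<bar>(pi * N - (gamma_main T - gamma_main T\<^sub>0)) / pi\<bar>" by simp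
  also have "(pi * N - (gamma_main T - gamma_main T\<^sub>0)) / pi = N - gamma_main T / pi + gamma_main T\<^sub>0 / pi"
    by (simp add: diff_divide_distrib add_divide_distrib)
  finally have "\<bar>N - gamma_main T / pi\<bar> \<le> 3 + (horizontal_bound T + horizontal_bound T\<^sub>0) / ln 2
      + gamma_error * ln (T / T\<^sub>0) / pi + \<bar>gamma_main T\<^sub>0 / pi\<bar>" by linarith
  also have "\<bar>gamma_main T\<^sub>0 / pi\<bar> = \<bar>gamma_main T\<^sub>0\<bar> / pi" by simp
  also have "3 + (horizontal_bound T + horizontal_bound T\<^sub>0) / ln 2 + gamma_error * ln (T / T\<^sub>0) / pi + \<bar>gamma_main T\<^sub>0\<bar> / pi
      < R_L k f Q lam mu a1 a b T\<^sub>0 T"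
  proof -
    have "0 < pi / (3 * ln 2)" by simp
    then show ?thesis using hor err main0 rest unfolding R by linarith
  qed
  finally show ?thesis using main[of T] by (simp add: diff_diff_eq)
qed

end

lemma selberg_class_functional_equation:
  assumes S: "selberg_class L coef k f Q lam mu \<omega>"
    and "c \<ge> 3" and "\<And>s. Re s \<ge> c \<Longrightarrow> norm (L s - 1) \<le> 1 / 2"
  shows "functional_equation L k f Q lam mu \<omega> c"
proof
  show "\<exists>G. G holomorphic_on UNIV \<and> finite_order G \<and> (\<forall>s. s \<noteq> 1 \<longrightarrow> G s = (s - 1) ^ k * L s)"
    using S unfolding selberg_class_def by (elim conjE)
  show "Q > 0" using S unfolding selberg_class_def by (elim conjE)
  show "norm \<omega> = 1" using S unfolding selberg_class_def by (elim conjE)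
  have gamma: "\<forall>j\<in>{1..f}. lam j > 0 \<and> Re (mu j) \<ge> 0"
    using S unfolding selberg_class_def by (elim conjE)
  then show "lam j > 0" "Re (mu j) \<ge> 0" if "j \<in> {1..f}" for j using that by blast+
  have "\<forall>s. s \<noteq> 0 \<and> s \<noteq> 1 \<and>
        (\<forall>j\<in>{1..f}. of_real (lam j) * s + mu j \<notin> \<int>\<^sub>\<le>\<^sub>0 \<and>
                    of_real (lam j) * (1 - cnj s) + mu j \<notin> \<int>\<^sub>\<le>\<^sub>0) \<longrightarrow>
        completed_L L f Q lam mu s = \<omega> * cnj (completed_L L f Q lam mu (1 - cnj s))"
    using S unfolding selberg_class_def by (elim conjE)
  then show "completed_L L f Q lam mu s = \<omega> * cnj (completed_L L f Q lam mu (1 - cnj s))"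
    if "s \<noteq> 0" "s \<noteq> 1" "\<forall>j\<in>{1..f}. of_real (lam j) * s + mu j \<notin> \<int>\<^sub>\<le>\<^sub>0 \<and>
                    of_real (lam j) * (1 - cnj s) + mu j \<notin> \<int>\<^sub>\<le>\<^sub>0" for s
    using that by blast
qed (use assms selberg_class_nonzero[OF S] in auto)

theorem lemma5p1:
  fixes L :: "complex \<Rightarrow> complex" and coef :: "nat \<Rightarrow> complex"
    and k f :: nat and Q :: real and lam :: "nat \<Rightarrow> real" and mu :: "nat \<Rightarrow> complex" and \<omega> :: complex
    and a1 a b R T\<^sub>0 T :: real
  assumes "selberg_class L coef k f Q lam mu \<omega>"
    and "degree_L f lam \<ge> 1"
    and "\<And>n. n \<ge> 1 \<Longrightarrow> norm (coef n) \<le> a1 * real n"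
    and "a > 2" and "(\<Sum>n. a1 * real (n + 2) powr (- a)) < 1 / 2"
    and "b < - 3" and "(\<Sum>n. a1 * real (n + 2) powr (b + 1)) < 1"
    and "R = a - b"
    and "T\<^sub>0 \<ge> 2 * R + 1"
    and "T\<^sub>0 \<ge> 2 * R + (MAX j\<in>{1..f}. 2 * norm (of_real (lam j) + cnj (mu j)) / lam j)"
    and "T\<^sub>0 > 2 * R + (MAX j\<in>{1..f}. 2 * norm (mu j) / lam j)"
    and "k > 0 \<Longrightarrow> T\<^sub>0 \<ge> 2 * R + 1 / (2 powr (1 / real k) - 1)"
    and "T > T\<^sub>0"
  shows "\<bar>real (N_plus L T\<^sub>0 T) - degree_L f lam / (2 * pi) * T * ln (T / exp 1)
            - T / (2 * pi) * ln (lambda_L f lam * Q ^ 2)\<bar> < R_L k f Q lam mu a1 a b T\<^sub>0 T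
       \<and> \<bar>real (N_minus L T\<^sub>0 T) - degree_L f lam / (2 * pi) * T * ln (T / exp 1)
            - T / (2 * pi) * ln (lambda_L f lam * Q ^ 2)\<bar> < R_L k f Q lam mu a1 a b T\<^sub>0 T"
proof -
  define c where "c = min a (- b) + 1"
  have c: "c \<ge> 3" using \<open>a > 2\<close> \<open>b < - 3\<close> by (simp add: c_def)
  have f: "f \<ge> 1" using assms(1) unfolding selberg_class_def by (elim conjE)
  have "coef 1 = 1" by (rule selberg_class_coef_1[OF assms(1,3)])
  \<comment> \<open>This makes the term \<open>ln (a1 * pi ^ 2 / 6)\<close> of \<open>R2_L\<close>
    nonnegative.\<close>
  then have a1: "a1 \<ge> 1" using assms(3)[of 1] by (simp del: One_nat_def)
  interpret functional_equation L k f Q lam mu \<omega> c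
    using c selberg_class_near_one[OF assms(1,3-7)]
    by (intro selberg_class_functional_equation[OF assms(1)]) (auto simp: c_def)
  have c_le: "c - 1 \<le> a" "c - 1 \<le> - b" by (auto simp: c_def)
  have R: "R = a - b" by fact
  \<comment> \<open>Adding the two bounds for \<open>c - 1\<close> gives
    \<open>2 * (c - 1) \<le> R\<close>, and \<open>4 * P - 1 = 4 * (c - 1) + 1\<close>.\<close>
  have PR: "4 * P - 1 \<le> 2 * R + 1" "2 * P \<le> 2 * R"
  proof -
    have P: "P = c - 1 / 2" by (rule P_def)
    show "4 * P - 1 \<le> 2 * R + 1" "2 * P \<le> 2 * R"
      using c_le c unfolding P R by (simp_all add: algebra_simps)
  qed
  have T0: "T\<^sub>0 \<ge> 4 * P - 1" using PR assms(9) by linarith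
  have mut1: "2 * norm (mu j) \<le> lam j * (T\<^sub>0 - 2 * P)" if j: "j \<in> {1..f}" for j
  proof -
    have "2 * norm (mu j) / lam j \<le> (MAX j\<in>{1..f}. 2 * norm (mu j) / lam j)"
      using j by (intro Max_ge) auto
    then have "2 * norm (mu j) / lam j \<le> T\<^sub>0 - 2 * P" using assms(11) PR by linarith
    then show ?thesis using lam[OF j] by (simp add: divide_le_eq mult.commute)
  qed
  have mut2: "2 * norm (of_real (lam j) + cnj (mu j)) \<le> lam j * T\<^sub>0" if j: "j \<in> {1..f}" for j
  proof -
    have "2 * norm (of_real (lam j) + cnj (mu j)) / lam j
        \<le> (MAX j\<in>{1..f}. 2 * norm (of_real (lam j) + cnj (mu j)) / lam j)"
      using j by (intro Max_ge) auto
    then have "2 * norm (of_real (lam j) + cnj (mu j)) / lam j \<le> T\<^sub>0" using assms(10) PR P_ge by linarith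
    then show ?thesis using lam[OF j] by (simp add: divide_le_eq mult.commute)
  qed
  have T0R: "T\<^sub>0 \<ge> 2 * (a - b) + 1" using assms(9) R by simp
  note within = zero_count_within_R_L[OF \<open>a > 2\<close> \<open>b < - 3\<close> c_def a1 f T0R \<open>T > T\<^sub>0\<close>]
  show ?thesis
    by (intro conjI within N_plus_bound[OF T0 \<open>T > T\<^sub>0\<close> mut1 mut2] N_minus_bound[OF T0 \<open>T > T\<^sub>0\<close> mut1 mut2])
qed

end
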